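(* Let $i\ge0$ be an integer and let $\mathcal I=(I_n)_{n\ge1}$ be an $\mathrm{Inc}^i$-invariant chain of proper monomial ideals $I_n\subsetneq R_n$. Let $r\ge\mathrm{ind}^i(\mathcal I)$ and denote by $\mathcal M$ the set of all subsets $M$ of $G_i(I_r)$ such that $v_M$ is not divisible by any element of $G_i^-(I_r)$. If $R_n/I_n$ is Cohen-Macaulay for all $n\gg0$, then $$\gamma_i(\mathcal I)=\max\{\gamma_i(\mathcal I:v_M)\mid M\in\mathcal M\}.$$
   Context: Fix an integer $c\ge 1$ and a field $K$; let $\mathbb N$ be the set of positive integers and $[c]=\{1,\dots,c\}$. For $n\ge1$ let $R_n=K[x_{k,j}\mid 1\le k\le c,\ 1\le j\le n]$ and $R=\bigcup_{n\ge1}R_n$. For an integer $i\ge0$ let $\mathrm{Inc}^i$ be the monoid of all strictly increasing maps $\pi:\mathbb N\to\mathbb N$ with $\pi(j)=j$ for all $j\le i$; it acts on $R$ by $K$-algebra endomorphisms via $\pi\cdot x_{k,j}=x_{k,\pi(j)}$. For $m\le n$ put $\mathrm{Inc}^i_{m,n}=\{\pi\in\mathrm{Inc}^i\mid \pi(m)\le n\}$. A chain $\mathcal I=(I_n)_{n\ge1}$ of ideals $I_n\subseteq R_n$ is $\mathrm{Inc}^i$-invariant if $\pi(f)\in I_n$ for all $m\le n$, $f\in I_m$, $\pi\in\mathrm{Inc}^i_{m,n}$. For such a chain there is an integer $r\ge1$ such that for all $n\ge r$ the ideal $I_n$ of $R_n$ is generated by $\{\pi(f)\mid f\in I_r,\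 \pi\in\mathrm{Inc}^i_{r,n}\}$ (known); the least such $r$ is denoted $\mathrm{ind}^i(\mathcal I)$. For a monomial $u\ne1$, $\min(u)$ (resp. $\max(u)$) is the smallest (resp. largest) index $j$ such that some $x_{k,j}$ divides $u$; by convention the conditions $\max(u)\le i$ and $\min(u)>i$ are regarded as satisfied by $u=1$ when $u$ is a factor in a factorization. For a proper monomial ideal $J\subsetneq R_n$ with minimal set of monomial generators $G(J)$, let $G_i^+(J)=\{u\in G(J)\mid \min(u)>i\}$, $G_i(J)=\{u\in G(J)\mid \min(u)\le i<\max(u)\}$, $G_i^-(J)=\{u\in G(J)\mid \max(u)\le i\}$. A set $C\subseteq[c]$ covers a monomial $u$ if there is $k\in C$ such that $x_{k,j}$ divides $u$ for some $j\ge1$; $C$ is an $i$-cover of $J$ if it covers every element of $G_i^+(J)$. Put $\gamma_i(J)=\min\{\#C\mid C\text{ is an }i\text{-cover of }J\}$, and $\gamma_i(R_n)=\infty$. For an $\mathrm{Inc}^i$-invariant chain $\mathcal J=(J_n)_{n\ge1}$ of monomial ideals, $\gamma_i(J_n)$ is the same for all $n\ge\mathrm{ind}^i(\mathcal J)$, and $\gamma_i(\mathcal J)$ denotes this common value. Every $u\in G_i(I_r)$ is written uniquely as $u=u_1u_2$ with monomials $u_1,u_2$ such that $\max(u_1)\le i$ and $\min(u_2)>i$. For $M\subseteq G_i(I_r)$ put $v_M=\prod_{u\in M}u_1$ (so $v_\emptyset=1$), and let $\mathcal I:v_M$ be the chain $(I_n:v_M)_{n\ge1}$, which is an $\mathrm{Inc}^i$-invariant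 chain with $\mathrm{ind}^i(\mathcal I:v_M)\le\mathrm{ind}^i(\mathcal I)$ (only $n\ge r$ matters here, for which $v_M\in R_n$; thus $\gamma_i(\mathcal I:v_M)=\gamma_i(I_n:v_M)$ for $n\ge r$). *)

theory Defs
  imports
    "HOL-Algebra.QuotRing"
    "HOL-Algebra.Ring_Divisibility"
    "HOL-Library.Poly_Mapping"
    "HOL-Library.Extended_Nat"
begin

section \<open>Localization\<close>

definition loc_rel :: "('a, 'b) ring_scheme \<Rightarrow> 'a set \<Rightarrow> (('a \<times> 'a) \<times> ('a \<times> 'a)) set" where
  "loc_rel A S = {((a, s), (b, t)). a \<in> carrier A \<and> s \<in> S \<and> b \<in> carrier A \<and> t \<in> S \<and>
     (\<exists>u\<in>S. u \<otimes>\<^bsub>A\<^esub> (a \<otimes>\<^bsub>A\<^esub> t) = u \<otimes>\<^bsub>A\<^esub> (b \<otimes>\<^bsub>A\<^esub> s))}"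

definition loc_frac :: "('a, 'b) ring_scheme \<Rightarrow> 'a set \<Rightarrow> 'a \<Rightarrow> 'a \<Rightarrow> ('a \<times> 'a) set" where
  "loc_frac A S a s = loc_rel A S `` {(a, s)}"

text \<open>The union over representatives in \<open>mult\<close> and \<open>add\<close> is a union of equal classes
  (cf. lemmas \<open>localization_mult\<close> and \<open>localization_add\<close> below).\<close>

definition localization :: "('a, 'b) ring_scheme \<Rightarrow> 'a set \<Rightarrow> ('a \<times> 'a) set ring" where
  "localization A S =
    \<lparr>carrier = (carrier A \<times> S) // loc_rel A S,
     mult = (\<lambda>X Y. \<Union>(a, s)\<in>X. \<Union>(b, t)\<in>Y. loc_frac A S (a \<otimes>\<^bsub>A\<^esub> b) (s \<otimes>\<^bsub>A\<^esub> t)),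
     one = loc_frac A S \<one>\<^bsub>A\<^esub> \<one>\<^bsub>A\<^esub>,
     zero = loc_frac A S \<zero>\<^bsub>A\<^esub> \<one>\<^bsub>A\<^esub>,
     add = (\<lambda>X Y. \<Union>(a, s)\<in>X. \<Union>(b, t)\<in>Y.
        loc_frac A S ((a \<otimes>\<^bsub>A\<^esub> t) \<oplus>\<^bsub>A\<^esub> (b \<otimes>\<^bsub>A\<^esub> s)) (s \<otimes>\<^bsub>A\<^esub> t))\<rparr>"

context cring
begin

context
  fixes S
  assumes S: "S \<subseteq> carrier R" "\<one> \<in> S" "\<And>s t. s \<in> S \<Longrightarrow> t \<in> S \<Longrightarrow> s \<otimes> t \<in> S"
begin

lemma loc_relI:
  assumes "a \<in> carrier R" "s \<in> S" "b \<in> carrier R" "t \<in> S" "u \<in> S" "u \<otimes> (a \<otimes> t) = u \<otimes> (b \<otimes> s)"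
  shows "((a, s), (b, t)) \<in> loc_rel R S"
  using assms unfolding loc_rel_def by auto

lemma equiv_loc_rel: "equiv (carrier R \<times> S) (loc_rel R S)"
proof (rule equivI)
  show "loc_rel R S \<subseteq> (carrier R \<times> S) \<times> (carrier R \<times> S)"
    unfolding loc_rel_def by auto
  show "refl_on (carrier R \<times> S) (loc_rel R S)"
    unfolding refl_on_def using S(2) by (auto simp: loc_rel_def)
  show "sym (loc_rel R S)"
    unfolding sym_def loc_rel_def by (auto, metis)
  show "trans (loc_rel R S)"
  proof (rule transI)
    fix x y z assume "(x, y) \<in> loc_rel R S" "(y, z) \<in> loc_rel R S"
    moreover obtain a s b t c v where xyz: "x = (a, s)" "y = (b, t)" "z = (c, v)"
      by (metis prod.exhaust)
    ultimately obtain p q where c: "a \<in> carrier R" "b \<in> carrier R" "c \<in> carrier R"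
      "s \<in> S" "t \<in> S" "v \<in> S" "p \<in> S" "q \<in> S" and
      p: "p \<otimes> (a \<otimes> t) = p \<otimes> (b \<otimes> s)" and q: "q \<otimes> (b \<otimes> v) = q \<otimes> (c \<otimes> t)"
      unfolding loc_rel_def by auto
    have k: "s \<in> carrier R" "t \<in> carrier R" "v \<in> carrier R" "p \<in> carrier R" "q \<in> carrier R"
      using c S(1) by auto
    have "(p \<otimes> q \<otimes> t) \<otimes> (a \<otimes> v) = (q \<otimes> v) \<otimes> (p \<otimes> (a \<otimes> t))"
      using c k by (simp add: m_ac)
    also have "\<dots> = (p \<otimes> s) \<otimes> (q \<otimes> (b \<otimes> v))"
      unfolding p using c k by (simp add: m_ac)
    also have "\<dots> = (p \<otimes> q \<otimes> t) \<otimes> (c \<otimes> s)"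
      unfolding q using c k by (simp add: m_ac)
    finally show "(x, z) \<in> loc_rel R S"
      unfolding xyz using c S(3) by (intro loc_relI[where u = "p \<otimes> q \<otimes> t"]) auto
  qed
qed

lemma loc_frac_eq_iff:
  assumes "a \<in> carrier R" "s \<in> S" "b \<in> carrier R" "t \<in> S"
  shows "loc_frac R S a s = loc_frac R S b t \<longleftrightarrow> (\<exists>u\<in>S. u \<otimes> (a \<otimes> t) = u \<otimes> (b \<otimes> s))"
  unfolding loc_frac_def using assms eq_equiv_class_iff[OF equiv_loc_rel, of "(a,s)" "(b,t)"]
  by (auto simp: loc_rel_def)

lemma localization_carrier:
  "carrier (localization R S) = {loc_frac R S a s | a s. a \<in> carrier R \<and> s \<in> S}"
  unfolding localization_def loc_frac_def quotient_def by auto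

lemma localization_UN:
  assumes "a \<in> carrier R" "s \<in> S" "b \<in> carrier R" "t \<in> S"
    and cong: "\<And>a' s' b' t'. ((a, s), (a', s')) \<in> loc_rel R S \<Longrightarrow>
      ((b, t), (b', t')) \<in> loc_rel R S \<Longrightarrow> f a' s' b' t' = f a s b t"
  shows "(\<Union>(a', s')\<in>loc_frac R S a s. \<Union>(b', t')\<in>loc_frac R S b t. f a' s' b' t') = f a s b t"
proof -
  have "(a, s) \<in> loc_frac R S a s" "(b, t) \<in> loc_frac R S b t"
    unfolding loc_frac_def using equiv_class_self[OF equiv_loc_rel] assms by auto
  moreover have "(\<Union>(b', t')\<in>loc_frac R S b t. f (fst p) (snd p) b' t') = f a s b t"
    if "p \<in> loc_frac R S a s" for p
    using calculation(2) that cong[of "fst p" "snd p"] unfolding loc_frac_def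
    by (intro UN_constant_eq) auto
  ultimately show ?thesis
    unfolding case_prod_beta by (intro UN_constant_eq) auto
qed

lemma localization_mult:
  assumes "a \<in> carrier R" "s \<in> S" "b \<in> carrier R" "t \<in> S"
  shows "loc_frac R S a s \<otimes>\<^bsub>localization R S\<^esub> loc_frac R S b t = loc_frac R S (a \<otimes> b) (s \<otimes> t)"
proof -
  have "loc_frac R S (a' \<otimes> b') (s' \<otimes> t') = loc_frac R S (a \<otimes> b) (s \<otimes> t)"
    if "((a, s), (a', s')) \<in> loc_rel R S" "((b, t), (b', t')) \<in> loc_rel R S" for a' s' b' t'
  proof -
    from that obtain p q where c: "a' \<in> carrier R" "b' \<in> carrier R" "s' \<in> S" "t' \<in> S"
      "p \<in> S" "q \<in> S" and p: "p \<otimes> (a \<otimes> s') = p \<otimes> (a' \<otimes> s)" and q: "q \<otimes> (b \<otimes> t') = q \<otimes> (b' \<otimes> t)"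
      unfolding loc_rel_def by auto
    have k: "s \<in> carrier R" "t \<in> carrier R" "s' \<in> carrier R" "t' \<in> carrier R"
      "p \<in> carrier R" "q \<in> carrier R"
      using c assms S(1) by auto
    have "(p \<otimes> q) \<otimes> ((a' \<otimes> b') \<otimes> (s \<otimes> t)) = (p \<otimes> (a' \<otimes> s)) \<otimes> (q \<otimes> (b' \<otimes> t))"
      using c k assms by (simp add: m_ac)
    also have "\<dots> = (p \<otimes> q) \<otimes> ((a \<otimes> b) \<otimes> (s' \<otimes> t'))"
      unfolding p[symmetric] q[symmetric] using c k assms by (simp add: m_ac)
    finally show ?thesis
      using c assms S(3) by (subst loc_frac_eq_iff) (auto intro!: bexI[of _ "p \<otimes> q"])
  qed
  then show ?thesis
    unfolding localization_def using localization_UN[OF assms, where f = "\<lambda>a s b t. loc_frac R S (a \<otimes> b) (s \<otimes> t)"] by simp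
qed

lemma localization_add:
  assumes "a \<in> carrier R" "s \<in> S" "b \<in> carrier R" "t \<in> S"
  shows "loc_frac R S a s \<oplus>\<^bsub>localization R S\<^esub> loc_frac R S b t =
    loc_frac R S (a \<otimes> t \<oplus> b \<otimes> s) (s \<otimes> t)"
proof -
  have "loc_frac R S (a' \<otimes> t' \<oplus> b' \<otimes> s') (s' \<otimes> t') = loc_frac R S (a \<otimes> t \<oplus> b \<otimes> s) (s \<otimes> t)"
    if "((a, s), (a', s')) \<in> loc_rel R S" "((b, t), (b', t')) \<in> loc_rel R S" for a' s' b' t'
  proof -
    from that obtain p q where c: "a' \<in> carrier R" "b' \<in> carrier R" "s' \<in> S" "t' \<in> S"
      "p \<in> S" "q \<in> S" and p: "p \<otimes> (a \<otimes> s') = p \<otimes> (a' \<otimes> s)" and q: "q \<otimes> (b \<otimes> t') = q \<otimes> (b' \<otimes> t)"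
      unfolding loc_rel_def by auto
    have k: "s \<in> carrier R" "t \<in> carrier R" "s' \<in> carrier R" "t' \<in> carrier R"
      "p \<in> carrier R" "q \<in> carrier R"
      using c assms S(1) by auto
    have "(p \<otimes> q) \<otimes> ((a' \<otimes> t' \<oplus> b' \<otimes> s') \<otimes> (s \<otimes> t)) =
        (p \<otimes> (a' \<otimes> s)) \<otimes> (q \<otimes> t \<otimes> t') \<oplus> (q \<otimes> (b' \<otimes> t)) \<otimes> (p \<otimes> s \<otimes> s')"
      using c k assms by (simp add: r_distr l_distr m_ac)
    also have "\<dots> = (p \<otimes> q) \<otimes> ((a \<otimes> t \<oplus> b \<otimes> s) \<otimes> (s' \<otimes> t'))"
      unfolding p[symmetric] q[symmetric] using c k assms by (simp add: r_distr l_distr m_ac)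
    finally show ?thesis
      using c k assms S(3) by (subst loc_frac_eq_iff) (auto intro!: bexI[of _ "p \<otimes> q"])
  qed
  then show ?thesis
    unfolding localization_def using localization_UN[OF assms,
      where f = "\<lambda>a s b t. loc_frac R S (a \<otimes> t \<oplus> b \<otimes> s) (s \<otimes> t)"] by simp
qed

lemma loc_frac_eqI:
  assumes "a \<in> carrier R" "s \<in> S" "b \<in> carrier R" "t \<in> S" "a \<otimes> t = b \<otimes> s"
  shows "loc_frac R S a s = loc_frac R S b t"
  using assms S(2) by (subst loc_frac_eq_iff) auto

lemma localization_cring: "cring (localization R S)"
proof -
  let ?L = "localization R S"
  have one: "\<one>\<^bsub>?L\<^esub> = loc_frac R S \<one> \<one>" and zero: "\<zero>\<^bsub>?L\<^esub> = loc_frac R S \<zero> \<one>"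
    unfolding localization_def by auto
  have car: "\<exists>a s. x = loc_frac R S a s \<and> a \<in> carrier R \<and> s \<in> S" if "x \<in> carrier ?L" for x
    using that localization_carrier by auto
  have carI: "loc_frac R S a s \<in> carrier ?L" if "a \<in> carrier R" "s \<in> S" for a s
    using that localization_carrier by auto
  have SR: "s \<in> carrier R" if "s \<in> S" for s using that S(1) by auto
  note rules = localization_mult localization_add one zero SR S(2) S(3)
  have "abelian_group ?L"
  proof (rule abelian_groupI)
    fix x y assume "x \<in> carrier ?L" "y \<in> carrier ?L"
    then obtain a s b t where "x = loc_frac R S a s" "a \<in> carrier R" "s \<in> S"
      "y = loc_frac R S b t" "b \<in> carrier R" "t \<in> S" using car by metis
    then show "x \<oplus>\<^bsub>?L\<^esub> y \<in> carrier ?L" "x \<oplus>\<^bsub>?L\<^esub> y = y \<oplus>\<^bsub>?L\<^esub> x"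
      by (auto simp: rules carI m_comm a_comm)
  next
    show "\<zero>\<^bsub>?L\<^esub> \<in> carrier ?L" using carI S(2) zero by auto
  next
    fix x y z assume "x \<in> carrier ?L" "y \<in> carrier ?L" "z \<in> carrier ?L"
    then obtain a s b t c u where *: "x = loc_frac R S a s" "a \<in> carrier R" "s \<in> S"
      "y = loc_frac R S b t" "b \<in> carrier R" "t \<in> S"
      "z = loc_frac R S c u" "c \<in> carrier R" "u \<in> S" using car by metis
    then show "x \<oplus>\<^bsub>?L\<^esub> y \<oplus>\<^bsub>?L\<^esub> z = x \<oplus>\<^bsub>?L\<^esub> (y \<oplus>\<^bsub>?L\<^esub> z)"
      by (simp add: rules) (intro loc_frac_eqI; simp add: rules l_distr r_distr m_ac a_ac)
  next
    fix x assume "x \<in> carrier ?L"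
    then obtain a s where *: "x = loc_frac R S a s" "a \<in> carrier R" "s \<in> S" using car by metis
    then show "\<zero>\<^bsub>?L\<^esub> \<oplus>\<^bsub>?L\<^esub> x = x" by (simp add: rules)
    have "loc_frac R S (\<ominus> a) s \<oplus>\<^bsub>?L\<^esub> x = \<zero>\<^bsub>?L\<^esub>"
      using * by (simp add: rules) (intro loc_frac_eqI; simp add: rules l_minus l_neg)
    then show "\<exists>y\<in>carrier ?L. y \<oplus>\<^bsub>?L\<^esub> x = \<zero>\<^bsub>?L\<^esub>"
      using * carI a_inv_closed by blast
  qed
  moreover have "comm_monoid ?L"
  proof (rule comm_monoidI)
    fix x y assume "x \<in> carrier ?L" "y \<in> carrier ?L"
    then obtain a s b t where "x = loc_frac R S a s" "a \<in> carrier R" "s \<in> S"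
      "y = loc_frac R S b t" "b \<in> carrier R" "t \<in> S" using car by metis
    then show "x \<otimes>\<^bsub>?L\<^esub> y \<in> carrier ?L" "x \<otimes>\<^bsub>?L\<^esub> y = y \<otimes>\<^bsub>?L\<^esub> x"
      by (auto simp: rules carI m_comm)
  next
    show "\<one>\<^bsub>?L\<^esub> \<in> carrier ?L" using carI S(2) one by auto
  next
    fix x y z assume "x \<in> carrier ?L" "y \<in> carrier ?L" "z \<in> carrier ?L"
    then obtain a s b t c u where *: "x = loc_frac R S a s" "a \<in> carrier R" "s \<in> S"
      "y = loc_frac R S b t" "b \<in> carrier R" "t \<in> S"
      "z = loc_frac R S c u" "c \<in> carrier R" "u \<in> S" using car by metis
    then show "x \<otimes>\<^bsub>?L\<^esub> y \<otimes>\<^bsub>?L\<^esub> z = x \<otimes>\<^bsub>?L\<^esub> (y \<otimes>\<^bsub>?L\<^esub> z)"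
      by (simp add: rules m_assoc)
  next
    fix x assume "x \<in> carrier ?L"
    then obtain a s where *: "x = loc_frac R S a s" "a \<in> carrier R" "s \<in> S" using car by metis
    then show "\<one>\<^bsub>?L\<^esub> \<otimes>\<^bsub>?L\<^esub> x = x" by (simp add: rules)
  qed
  moreover have "(x \<oplus>\<^bsub>?L\<^esub> y) \<otimes>\<^bsub>?L\<^esub> z = x \<otimes>\<^bsub>?L\<^esub> z \<oplus>\<^bsub>?L\<^esub> y \<otimes>\<^bsub>?L\<^esub> z"
    if "x \<in> carrier ?L" "y \<in> carrier ?L" "z \<in> carrier ?L" for x y z
  proof -
    from that obtain a s b t c u where *: "x = loc_frac R S a s" "a \<in> carrier R" "s \<in> S"
      "y = loc_frac R S b t" "b \<in> carrier R" "t \<in> S"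
      "z = loc_frac R S c u" "c \<in> carrier R" "u \<in> S" using car by metis
    then show ?thesis
      by (simp add: rules) (intro loc_frac_eqI; simp add: rules l_distr r_distr m_ac a_ac)
  qed
  ultimately show ?thesis by (rule cringI)
qed

end
end

section \<open>Cohen-Macaulay rings\<close>

definition krull_dim :: "('a, 'b) ring_scheme \<Rightarrow> enat" where
  "krull_dim A = (SUP k\<in>{k. \<exists>P. (\<forall>j\<le>k. primeideal (P j) A) \<and> (\<forall>j<k. P j \<subset> P (Suc j))}. enat k)"

text \<open>The implication says that \<open>xs ! j\<close> is a non-zero-divisor modulo the ideal generated by the
  preceding elements.\<close>

definition regular_sequence :: "('a, 'b) ring_scheme \<Rightarrow> 'a list \<Rightarrow> bool" where
  "regular_sequence A xs \<longleftrightarrow> set xs \<subseteq> carrier A \<and>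
     (\<forall>j<length xs. \<forall>b\<in>carrier A.
        xs ! j \<otimes>\<^bsub>A\<^esub> b \<in> Idl\<^bsub>A\<^esub> (set (take j xs)) \<longrightarrow> b \<in> Idl\<^bsub>A\<^esub> (set (take j xs))) \<and>
     Idl\<^bsub>A\<^esub> (set xs) \<noteq> carrier A"

definition local_ring :: "('a, 'b) ring_scheme \<Rightarrow> bool" where
  "local_ring A \<longleftrightarrow> cring A \<and> (\<exists>!m. maximalideal m A)"

definition local_depth :: "('a, 'b) ring_scheme \<Rightarrow> enat" where
  "local_depth A =
     (SUP xs\<in>{xs. regular_sequence A xs \<and> set xs \<subseteq> (THE m. maximalideal m A)}. enat (length xs))"

definition cohen_macaulay_local :: "('a, 'b) ring_scheme \<Rightarrow> bool" where
  "cohen_macaulay_local A \<longleftrightarrow> local_ring A \<and> noetherian_ring A \<and> local_depth A = krull_dim A"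

definition cohen_macaulay :: "('a, 'b) ring_scheme \<Rightarrow> bool" where
  "cohen_macaulay A \<longleftrightarrow> cring A \<and> noetherian_ring A \<and>
     (\<forall>m. maximalideal m A \<longrightarrow> cohen_macaulay_local (localization A (carrier A - m)))"

section \<open>Polynomial rings and monomials\<close>

text \<open>A monomial is its exponent vector; the pair \<open>(k, j)\<close> stands for the variable \<open>x_{k,j}\<close>.
  Hence products of monomials are sums of exponent vectors, and the monomial 1 is \<open>0\<close>.\<close>

type_synonym mon = "nat \<times> nat \<Rightarrow>\<^sub>0 nat"

type_synonym 'k poly_xs = "mon \<Rightarrow>\<^sub>0 'k"

definition mons :: "nat \<Rightarrow> nat \<Rightarrow> mon set" where
  "mons c n = {u. Poly_Mapping.keys u \<subseteq> {1..c} \<times> {1..n}}"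

definition polyR :: "nat \<Rightarrow> nat \<Rightarrow> ('k::field) poly_xs ring" where
  "polyR c n = \<lparr>carrier = {f. Poly_Mapping.keys f \<subseteq> mons c n}, mult = (*), one = 1, zero = 0, add = (+)\<rparr>"

definition monom_poly :: "mon \<Rightarrow> ('k::field) poly_xs" where
  "monom_poly u = Poly_Mapping.single u 1"

definition mon_dvd :: "mon \<Rightarrow> mon \<Rightarrow> bool" where
  "mon_dvd u v \<longleftrightarrow> (\<exists>w. v = u + w)"

definition mon_min :: "mon \<Rightarrow> nat" where
  "mon_min u = Min (snd ` Poly_Mapping.keys u)"

definition mon_max :: "mon \<Rightarrow> nat" where
  "mon_max u = Max (snd ` Poly_Mapping.keys u)"

definition monomial_ideal :: "nat \<Rightarrow> nat \<Rightarrow> ('k::field) poly_xs set \<Rightarrow> bool" where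
  "monomial_ideal c n J \<longleftrightarrow> (\<exists>S\<subseteq>mons c n. J = Idl\<^bsub>polyR c n\<^esub> (monom_poly ` S))"

definition min_gens :: "nat \<Rightarrow> nat \<Rightarrow> ('k::field) poly_xs set \<Rightarrow> mon set" where
  "min_gens c n J = (THE S. S \<subseteq> mons c n \<and> Idl\<^bsub>polyR c n\<^esub> (monom_poly ` S) = J \<and>
     (\<forall>T\<subset>S. Idl\<^bsub>polyR c n\<^esub> (monom_poly ` T) \<noteq> J))"

text \<open>If \<open>v\<close> is not a monomial of the ring, this set is \<open>{0}\<close>.\<close>

definition colon_mon :: "nat \<Rightarrow> nat \<Rightarrow> ('k::field) poly_xs set \<Rightarrow> mon \<Rightarrow> 'k poly_xs set" where
  "colon_mon c n J v = {f \<in> carrier (polyR c n). f * monom_poly v \<in> J}"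

section \<open>Invariant chains\<close>

text \<open>Positive integers are the naturals \<open>\<ge> 1\<close>; the value of a map at 0 is irrelevant.\<close>

definition Inc :: "nat \<Rightarrow> (nat \<Rightarrow> nat) set" where
  "Inc i = {\<pi>. strict_mono_on {1..} \<pi> \<and> \<pi> ` {1..} \<subseteq> {1..} \<and> (\<forall>j\<in>{1..i}. \<pi> j = j)}"

definition Inc_between :: "nat \<Rightarrow> nat \<Rightarrow> nat \<Rightarrow> (nat \<Rightarrow> nat) set" where
  "Inc_between i m n = {\<pi> \<in> Inc i. \<pi> m \<le> n}"

definition mon_act :: "(nat \<Rightarrow> nat) \<Rightarrow> mon \<Rightarrow> mon" where
  "mon_act \<pi> u = (\<Sum>(k, j)\<in>Poly_Mapping.keys u. Poly_Mapping.single (k, \<pi> j) (Poly_Mapping.lookup u (k, j)))"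

definition poly_act :: "(nat \<Rightarrow> nat) \<Rightarrow> ('k::field) poly_xs \<Rightarrow> 'k poly_xs" where
  "poly_act \<pi> f = (\<Sum>u\<in>Poly_Mapping.keys f. Poly_Mapping.single (mon_act \<pi> u) (Poly_Mapping.lookup f u))"

definition invariant_chain :: "nat \<Rightarrow> nat \<Rightarrow> (nat \<Rightarrow> ('k::field) poly_xs set) \<Rightarrow> bool" where
  "invariant_chain c i I \<longleftrightarrow> (\<forall>n\<ge>1. ideal (I n) (polyR c n)) \<and>
     (\<forall>m n f \<pi>. 1 \<le> m \<longrightarrow> m \<le> n \<longrightarrow> f \<in> I m \<longrightarrow> \<pi> \<in> Inc_between i m n \<longrightarrow> poly_act \<pi> f \<in> I n)"

definition ind :: "nat \<Rightarrow> nat \<Rightarrow> (nat \<Rightarrow> ('k::field) poly_xs set) \<Rightarrow> nat" where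
  "ind c i I = (LEAST r. 1 \<le> r \<and>
     (\<forall>n\<ge>r. I n = Idl\<^bsub>polyR c n\<^esub> {poly_act \<pi> f | \<pi> f. f \<in> I r \<and> \<pi> \<in> Inc_between i r n}))"

section \<open>Covers\<close>

definition gens_above :: "nat \<Rightarrow> nat \<Rightarrow> nat \<Rightarrow> ('k::field) poly_xs set \<Rightarrow> mon set" where
  "gens_above c n i J = {u \<in> min_gens c n J. mon_min u > i}"

definition gens_mixed :: "nat \<Rightarrow> nat \<Rightarrow> nat \<Rightarrow> ('k::field) poly_xs set \<Rightarrow> mon set" where
  "gens_mixed c n i J = {u \<in> min_gens c n J. mon_min u \<le> i \<and> i < mon_max u}"

definition gens_below :: "nat \<Rightarrow> nat \<Rightarrow> nat \<Rightarrow> ('k::field) poly_xs set \<Rightarrow> mon set" where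
  "gens_below c n i J = {u \<in> min_gens c n J. mon_max u \<le> i}"

definition covers :: "nat set \<Rightarrow> mon \<Rightarrow> bool" where
  "covers C u \<longleftrightarrow> (\<exists>k\<in>C. \<exists>j\<ge>1. (k, j) \<in> Poly_Mapping.keys u)"

definition i_cover :: "nat \<Rightarrow> nat \<Rightarrow> nat \<Rightarrow> ('k::field) poly_xs set \<Rightarrow> nat set \<Rightarrow> bool" where
  "i_cover c n i J C \<longleftrightarrow> C \<subseteq> {1..c} \<and> (\<forall>u\<in>gens_above c n i J. covers C u)"

definition gamma :: "nat \<Rightarrow> nat \<Rightarrow> nat \<Rightarrow> ('k::field) poly_xs set \<Rightarrow> enat" where
  "gamma c n i J =
     (if J = carrier (polyR c n) then \<infinity> else enat (Min (card ` {C. i_cover c n i J C})))"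

definition chain_gamma :: "nat \<Rightarrow> nat \<Rightarrow> (nat \<Rightarrow> ('k::field) poly_xs set) \<Rightarrow> enat" where
  "chain_gamma c i J = (THE g. \<forall>n\<ge>ind c i J. gamma c n i (J n) = g)"

text \<open>The factor \<open>u\<^sub>1\<close> in the factorization \<open>u = u\<^sub>1 u\<^sub>2\<close>, see lemma \<open>low_part_unique\<close>.\<close>

definition low_part :: "nat \<Rightarrow> mon \<Rightarrow> mon" where
  "low_part i u = (\<Sum>v\<in>{v \<in> Poly_Mapping.keys u. snd v \<le> i}. Poly_Mapping.single v (Poly_Mapping.lookup u v))"

definition v_mon :: "nat \<Rightarrow> mon set \<Rightarrow> mon" where
  "v_mon i M = (\<Sum>u\<in>M. low_part i u)"

definition admissible :: "nat \<Rightarrow> nat \<Rightarrow> nat \<Rightarrow> ('k::field) poly_xs set \<Rightarrow> mon set set" where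
  "admissible c n i J = {M. M \<subseteq> gens_mixed c n i J \<and>
     \<not> (\<exists>w\<in>gens_below c n i J. mon_dvd w (v_mon i M))}"

section \<open>Consistency of the encodings\<close>

lemma lookup_low_part: "Poly_Mapping.lookup (low_part i u) v = (if snd v \<le> i then Poly_Mapping.lookup u v else 0)"
  unfolding low_part_def
  by (auto simp: lookup_sum lookup_single when_def sum.delta' in_keys_iff
      cong: if_cong)

lemma low_part_unique:
  "(\<exists>u2. u = u1 + u2 \<and> (u1 = 0 \<or> mon_max u1 \<le> i) \<and> (u2 = 0 \<or> mon_min u2 > i))
    \<longleftrightarrow> u1 = low_part i u"
proof -
  have f: "finite (snd ` Poly_Mapping.keys a)" for a :: mon
    by (rule finite_imageI[OF finite_keys])
  have n: "snd ` Poly_Mapping.keys a \<noteq> {}" if "a \<noteq> 0" for a :: mon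
    using that by simp
  have contra: "(\<forall>v. P v \<longrightarrow> Q v) \<longleftrightarrow> (\<forall>v. \<not> Q v \<longrightarrow> \<not> P v)" for P Q :: "nat \<times> nat \<Rightarrow> bool"
    by blast
  have mx: "(a = 0 \<or> mon_max a \<le> i) \<longleftrightarrow> (\<forall>v. snd v > i \<longrightarrow> Poly_Mapping.lookup a v = 0)" for a
  proof (cases "a = 0")
    case False
    have "mon_max a \<le> i \<longleftrightarrow> (\<forall>v\<in>Poly_Mapping.keys a. snd v \<le> i)"
      unfolding mon_max_def Max_le_iff[OF f n[OF False]] by blast
    also have "\<dots> \<longleftrightarrow> (\<forall>v. snd v > i \<longrightarrow> Poly_Mapping.lookup a v = 0)"
      using contra[of "\<lambda>v. v \<in> Poly_Mapping.keys a" "\<lambda>v. snd v \<le> i"]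
      unfolding Ball_def not_le in_keys_iff not_not .
    finally show ?thesis using False by blast
  qed auto
  have mn: "(a = 0 \<or> mon_min a > i) \<longleftrightarrow> (\<forall>v. snd v \<le> i \<longrightarrow> Poly_Mapping.lookup a v = 0)" for a
  proof (cases "a = 0")
    case False
    have "mon_min a > i \<longleftrightarrow> (\<forall>v\<in>Poly_Mapping.keys a. snd v > i)"
      unfolding mon_min_def Min_gr_iff[OF f n[OF False]] by blast
    also have "\<dots> \<longleftrightarrow> (\<forall>v. snd v \<le> i \<longrightarrow> Poly_Mapping.lookup a v = 0)"
      using contra[of "\<lambda>v. v \<in> Poly_Mapping.keys a" "\<lambda>v. snd v > i"]
      unfolding Ball_def not_less in_keys_iff not_not .
    finally show ?thesis using False by blast
  qed auto
  show ?thesis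
    unfolding mx mn
  proof
    assume "\<exists>u2. u = u1 + u2 \<and> (\<forall>v. snd v > i \<longrightarrow> Poly_Mapping.lookup u1 v = 0) \<and> (\<forall>v. snd v \<le> i \<longrightarrow> Poly_Mapping.lookup u2 v = 0)"
    then show "u1 = low_part i u"
      by (intro poly_mapping_eqI) (auto simp: lookup_low_part lookup_add)
  next
    assume "u1 = low_part i u"
    then show "\<exists>u2. u = u1 + u2 \<and> (\<forall>v. snd v > i \<longrightarrow> Poly_Mapping.lookup u1 v = 0) \<and> (\<forall>v. snd v \<le> i \<longrightarrow> Poly_Mapping.lookup u2 v = 0)"
      by (intro exI[of _ "u - u1"])
        (auto simp: lookup_low_part lookup_add lookup_minus intro!: poly_mapping_eqI)
  qed
qed

lemma mons_add_iff: "u + v \<in> mons c n \<longleftrightarrow> u \<in> mons c n \<and> v \<in> mons c n"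
proof -
  have "Poly_Mapping.keys (u + v) = Poly_Mapping.keys u \<union> Poly_Mapping.keys v" by (auto simp: in_keys_iff lookup_add)
  then show ?thesis by (auto simp: mons_def)
qed

lemma polyR_mult_closed:
  assumes "f \<in> carrier (polyR c n)" "g \<in> carrier (polyR c n)"
  shows "f * g \<in> carrier (polyR c n)"
  using assms keys_mult[of f g] by (fastforce simp: polyR_def mons_add_iff)

lemma polyR_cring: "cring (polyR c n :: ('k::field) poly_xs ring)" (is "cring ?R")
proof (rule cringI)
  show "abelian_group ?R"
  proof (rule abelian_groupI)
    fix x y assume "x \<in> carrier ?R" "y \<in> carrier ?R"
    then show "x \<oplus>\<^bsub>?R\<^esub> y \<in> carrier ?R"
      using keys_add[of x y] by (auto simp: polyR_def)
  next
    fix x assume "x \<in> carrier ?R"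
    then show "\<exists>y\<in>carrier ?R. y \<oplus>\<^bsub>?R\<^esub> x = \<zero>\<^bsub>?R\<^esub>"
      by (intro bexI[of _ "- x"]) (auto simp: polyR_def)
  qed (auto simp: polyR_def add_ac)
  show "comm_monoid ?R"
  proof (rule comm_monoidI)
    fix x y assume "x \<in> carrier ?R" "y \<in> carrier ?R"
    then show "x \<otimes>\<^bsub>?R\<^esub> y \<in> carrier ?R"
      using polyR_mult_closed[of x c n y] by (auto simp: polyR_def)
  qed (auto simp: polyR_def mult_ac mons_def)
qed (auto simp: polyR_def algebra_simps)

lemma Idl_monom:
  assumes "S \<subseteq> mons c n"
  shows "Idl\<^bsub>polyR c n :: ('k::field) poly_xs ring\<^esub> (monom_poly ` S) =
    {f \<in> carrier (polyR c n). \<forall>m\<in>Poly_Mapping.keys f. \<exists>s\<in>S. mon_dvd s m}" (is "genideal ?R _ = ?J")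
proof -
  interpret R: cring ?R by (rule polyR_cring)
  have sub: "monom_poly ` S \<subseteq> carrier ?R"
    using assms by (auto simp: polyR_def monom_poly_def)
  have "ideal ?J ?R"
  proof (rule idealI[OF R.ring_axioms])
    show "subgroup ?J (add_monoid ?R)"
    proof (rule R.add.subgroupI)
      show "?J \<subseteq> carrier ?R" by auto
      show "?J \<noteq> {}" by (auto simp: polyR_def intro!: exI[of _ 0])
    next
      fix a assume a: "a \<in> ?J"
      have "\<ominus>\<^bsub>?R\<^esub> a = - a"
        using a by (intro R.minus_equality) (auto simp: polyR_def)
      then show "\<ominus>\<^bsub>?R\<^esub> a \<in> ?J" using a by (auto simp: polyR_def)
    next
      fix a b assume "a \<in> ?J" "b \<in> ?J"
      then show "a \<oplus>\<^bsub>?R\<^esub> b \<in> ?J"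
        using keys_add[of a b] by (fastforce simp: polyR_def)
    qed
  next
    fix a x assume a: "a \<in> ?J" and x: "x \<in> carrier ?R"
    have "x * a \<in> ?J"
    proof -
      have "\<exists>s\<in>S. mon_dvd s m" if "m \<in> Poly_Mapping.keys (x * a)" for m
      proof -
        from that obtain p q where pq: "q \<in> Poly_Mapping.keys a" "m = p + q"
          using keys_mult[of x a] by auto
        then obtain s w where "s \<in> S" "q = s + w"
          using a by (auto simp: mon_dvd_def)
        then show ?thesis using pq by (auto simp: mon_dvd_def intro!: bexI[of _ s] exI[of _ "p + w"] simp: add_ac)
      qed
      then show ?thesis using polyR_mult_closed[OF x, of a] a by auto
    qed
    then show "x \<otimes>\<^bsub>?R\<^esub> a \<in> ?J" "a \<otimes>\<^bsub>?R\<^esub> x \<in> ?J"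
      by (auto simp: polyR_def mult.commute)
  qed
  moreover have "monom_poly ` S \<subseteq> ?J"
    using sub by (auto simp: monom_poly_def mon_dvd_def intro!: bexI exI[of _ 0])
  ultimately have "Idl\<^bsub>?R\<^esub> (monom_poly ` S) \<subseteq> ?J"
    by (rule R.genideal_minimal)
  moreover have "f \<in> Idl\<^bsub>?R\<^esub> (monom_poly ` S)" if f: "f \<in> ?J" for f
  proof -
    interpret I: ideal "Idl\<^bsub>?R\<^esub> (monom_poly ` S)" ?R
      by (rule R.genideal_ideal[OF sub])
    have term_in: "Poly_Mapping.single m (Poly_Mapping.lookup f m) \<in> Idl\<^bsub>?R\<^esub> (monom_poly ` S)" if m: "m \<in> Poly_Mapping.keys f" for m
    proof -
      obtain s w where s: "s \<in> S" "m = s + w"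
        using f m by (auto simp: mon_dvd_def)
      have "w \<in> mons c n" using f m s(2) mons_add_iff by (auto simp: polyR_def)
      then have "Poly_Mapping.single w (Poly_Mapping.lookup f m) \<in> carrier ?R"
        by (auto simp: polyR_def)
      moreover have "monom_poly s \<in> Idl\<^bsub>?R\<^esub> (monom_poly ` S)"
        using R.genideal_self[OF sub] s(1) by auto
      ultimately have "monom_poly s \<otimes>\<^bsub>?R\<^esub> Poly_Mapping.single w (Poly_Mapping.lookup f m) \<in> Idl\<^bsub>?R\<^esub> (monom_poly ` S)"
        by (rule I.I_r_closed[rotated])
      then show ?thesis using s(2) by (simp add: polyR_def monom_poly_def mult_single)
    qed
    have partial: "(\<Sum>m\<in>F. Poly_Mapping.single m (Poly_Mapping.lookup f m)) \<in> Idl\<^bsub>?R\<^esub> (monom_poly ` S)"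
      if "finite F" "F \<subseteq> Poly_Mapping.keys f" for F
      using that
    proof (induction F rule: finite_induct)
      case empty
      then show ?case using I.zero_closed by (simp add: polyR_def)
    next
      case (insert x F)
      then have "Poly_Mapping.single x (Poly_Mapping.lookup f x) \<oplus>\<^bsub>?R\<^esub>
          (\<Sum>m\<in>F. Poly_Mapping.single m (Poly_Mapping.lookup f m)) \<in> Idl\<^bsub>?R\<^esub> (monom_poly ` S)"
        using term_in by (intro I.a_closed) auto
      then show ?case using insert by (simp add: polyR_def)
    qed
    have "(\<Sum>m\<in>Poly_Mapping.keys f. Poly_Mapping.single m (Poly_Mapping.lookup f m)) = f"
      by (intro poly_mapping_eqI)
        (auto simp: lookup_sum lookup_single when_def sum.delta in_keys_iff)
    then show ?thesis using partial[OF finite_keys order_refl] by (simp only:)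
  qed
  ultimately show ?thesis by auto
qed

lemma ex_minimal_divisor:
  assumes "P (u::mon)"
  shows "\<exists>v. P v \<and> mon_dvd v u \<and> (\<forall>w. P w \<longrightarrow> mon_dvd w v \<longrightarrow> w = v)"
proof -
  define deg where "deg v = (\<Sum>x\<in>Poly_Mapping.keys u. Poly_Mapping.lookup v x)" for v :: mon
  have ex: "P u \<and> mon_dvd u u" using assms by (auto simp: mon_dvd_def intro: exI[of _ 0])
  obtain v where v: "P v" "mon_dvd v u"
    and least: "\<And>w. P w \<and> mon_dvd w u \<Longrightarrow> deg v \<le> deg w"
    using ex_has_least_nat[of "\<lambda>v. P v \<and> mon_dvd v u" u deg] ex by blast
  have "w = v" if w: "P w" "mon_dvd w v" for w
  proof -
    obtain a b where a: "v = w + a" "u = v + b" using w(2) v(2) by (auto simp: mon_dvd_def)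
    then have "mon_dvd w u" by (auto simp: mon_dvd_def add.assoc)
    then have "deg v \<le> deg w" using least w(1) by auto
    moreover have "deg v = deg w + deg a" by (simp add: a(1) deg_def lookup_add sum.distrib)
    ultimately have "\<forall>x\<in>Poly_Mapping.keys u. Poly_Mapping.lookup a x = 0" by (simp add: deg_def)
    moreover have "Poly_Mapping.keys a \<subseteq> Poly_Mapping.keys u" using a by (auto simp: in_keys_iff lookup_add)
    ultimately have "a = 0" by (intro poly_mapping_eqI) (auto simp: in_keys_iff)
    then show ?thesis using a by simp
  qed
  then show ?thesis using v by blast
qed

text \<open>The defining description of \<open>min_gens\<close> is satisfied by exactly one set.\<close>

lemma min_gens_unique:
  fixes J :: "('k::field) poly_xs set"
  assumes "monomial_ideal c n J"
  defines "G \<equiv> {u. (monom_poly u :: 'k poly_xs) \<in> J \<and> (\<forall>w. monom_poly w \<in> J \<longrightarrow> mon_dvd w u \<longrightarrow> w = u)}"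
  shows "(S \<subseteq> mons c n \<and> Idl\<^bsub>polyR c n\<^esub> (monom_poly ` S) = J \<and>
     (\<forall>T\<subset>S. Idl\<^bsub>polyR c n\<^esub> (monom_poly ` T) \<noteq> J)) \<longleftrightarrow> S = G" and "min_gens c n J = G"
proof -
  obtain B where B: "B \<subseteq> mons c n" "J = Idl\<^bsub>polyR c n\<^esub> (monom_poly ` B)"
    using assms(1) unfolding monomial_ideal_def by blast
  have inJ: "monom_poly u \<in> J \<longleftrightarrow> u \<in> mons c n \<and> (\<exists>s\<in>T. mon_dvd s u)"
    if "T \<subseteq> mons c n" "J = Idl\<^bsub>polyR c n\<^esub> (monom_poly ` T)" for u T
    using Idl_monom[OF that(1), where 'k = 'k] that(2) by (auto simp: polyR_def monom_poly_def)
  have G: "G \<subseteq> mons c n" using inJ[OF B] by (auto simp: G_def)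
  have GJ: "Idl\<^bsub>polyR c n\<^esub> (monom_poly ` G) = J"
  proof -
    have "(\<exists>s\<in>G. mon_dvd s m) \<longleftrightarrow> (\<exists>s\<in>B. mon_dvd s m)" if m: "m \<in> mons c n" for m
    proof
      assume "\<exists>s\<in>G. mon_dvd s m"
      then obtain s where s: "s \<in> G" "mon_dvd s m" by auto
      then obtain b where "b \<in> B" "mon_dvd b s" using inJ[OF B] by (auto simp: G_def)
      then show "\<exists>s\<in>B. mon_dvd s m" using s(2) by (auto simp: mon_dvd_def add.assoc intro!: bexI[of _ b])
    next
      assume "\<exists>s\<in>B. mon_dvd s m"
      then have "monom_poly m \<in> J" using inJ[OF B] m by auto
      then show "\<exists>s\<in>G. mon_dvd s m"
        using ex_minimal_divisor[of "\<lambda>u. monom_poly u \<in> J" m] by (auto simp: G_def)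
    qed
    then show ?thesis
      unfolding B(2) Idl_monom[OF B(1)] Idl_monom[OF G]
      by (intro Collect_cong conj_cong ball_cong refl) (auto simp: polyR_def)
  qed
  have sub: "G \<subseteq> T" if T: "T \<subseteq> mons c n" "Idl\<^bsub>polyR c n\<^esub> (monom_poly ` T) = J" for T
  proof
    fix u assume u: "u \<in> G"
    then obtain s where s: "s \<in> T" "mon_dvd s u" using inJ[OF T(1) T(2)[symmetric]] by (auto simp: G_def)
    then have "monom_poly s \<in> J"
      using inJ[OF T(1) T(2)[symmetric], of s] T(1) by (auto simp: mon_dvd_def intro!: bexI[of _ s] exI[of _ 0])
    then show "u \<in> T" using u s by (auto simp: G_def)
  qed
  show *: "(S \<subseteq> mons c n \<and> Idl\<^bsub>polyR c n\<^esub> (monom_poly ` S) = J \<and>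
     (\<forall>T\<subset>S. Idl\<^bsub>polyR c n\<^esub> (monom_poly ` T) \<noteq> J)) \<longleftrightarrow> S = G" for S
    using sub G GJ by (metis order_trans psubset_eq subset_antisym)
  show "min_gens c n J = G"
    unfolding min_gens_def * by simp
qed

end

theory Submission
  imports
    Defs
    "HOL-Library.Sublist"
    "HOL-Library.Ramsey"
    "HOL-Library.Product_Lexorder"
begin

text \<open>
  By a pigeonhole argument the least number of variables needed to hit all monomials of \<open>I\<^sub>n\<close>
  is \<open>\<gamma> n + O(1)\<close> with \<open>\<gamma> = \<gamma>\<^sub>i(\<I>)\<close>, and likewise for the chain \<open>\<I> : v\<^sub>M\<close>. An associated prime of
  \<open>I\<^sub>n : v\<^sub>M\<close> is associated to \<open>I\<^sub>n\<close>. If \<open>R\<^sub>n / I\<^sub>n\<close> is Cohen-Macaulay, then all associated primes have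
  the same codimension, so \<open>\<gamma>\<^sub>i(\<I> : v\<^sub>M) = \<gamma>\<^sub>i(\<I>)\<close> for all \<open>M\<close>, while \<open>M = \<emptyset>\<close> is always admissible.

  The only fact needed about depth is that \<open>d \<le> dim R/P\<close> for a regular sequence
  \<open>y\<^sub>1, \<dots>, y\<^sub>d\<close> in the localization at the origin and \<open>P = (I : w)\<close>. If \<open>d\<close> were larger, then counting
  monomials would give a nonzero polynomial \<open>F\<close> over the field with \<open>F(y\<^sub>1, \<dots>, y\<^sub>d) w = 0\<close>. Splitting off
  the lowest power of \<open>y\<^sub>1\<close>, cancelling it, and dividing \<open>w\<close> by the highest possible power of \<open>y\<^sub>1\<close>,
  one gets such a relation in \<open>y\<^sub>2, \<dots>, y\<^sub>d\<close> modulo \<open>y\<^sub>1\<close>, and finally a contradiction.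

  That the chain stabilizes at all follows from Higman's lemma.
\<close>

section \<open>Higman's lemma\<close>

text \<open>A cover of \<open>I_n : v\<close> also covers the smaller ideal \<open>I_n\<close>, so
  passing to the colon chain can only enlarge \<open>\<gamma>\<close>; Cohen-Macaulayness is spent
  on the converse. If the colon chain had the larger cover number, a small cover of the original
  chain would give a prime above \<open>I_n\<close> of large dimension, while an associated prime
  containing \<open>I_n : v\<close> would bound the depth. The two numbers then differ by at least
  \<open>n\<close>, up to an error independent of \<open>n\<close>, so a single large
  \<open>n\<close> yields the contradiction.

  Of \<open>v_M\<close> only two properties matter: it lives in the columns up to \<open>i\<close>,
  so that \<open>Inc i\<close> fixes it, and it lies outside \<open>I_n\<close> for all n \<ge> r,
  which is what admissibility expresses. Every ideal generated by variables lies in the maximal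
  ideal of the origin, so one localization serves both bounds.

  \<open>ind\<close> is a least element and says nothing until some stable index is known to exist;
  this is why a well-quasi-order argument is required.\<close>

definition almost_full :: "('a \<Rightarrow> 'a \<Rightarrow> bool) \<Rightarrow> bool" where
  "almost_full P \<longleftrightarrow> (\<forall>f::nat \<Rightarrow> 'a. \<exists>i j. i < j \<and> P (f i) (f j))"

text \<open>Ramsey's theorem for pairs: colour a pair of indices by whether \<open>P\<close> holds.
  An infinite homogeneous set of the other colour would enumerate a sequence violating
  \<open>almost_full P\<close>.\<close>

lemma almost_full_subseq:
  fixes f :: "nat \<Rightarrow> 'a"
  assumes "almost_full P"
  shows "\<exists>\<phi>::nat \<Rightarrow> nat. strict_mono \<phi> \<and> (\<forall>i j. i < j \<longrightarrow> P (f (\<phi> i)) (f (\<phi> j)))"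
proof -
  \<comment> \<open>Colours belong to unordered pairs, so \<open>Min\<close> and \<open>Max\<close>
    restore the order of the two indices.\<close>
  define col where "col A = (if P (f (Min A)) (f (Max A)) then 0 else 1 :: nat)" for A
  have "\<forall>x\<in>UNIV. \<forall>y\<in>UNIV. x \<noteq> y \<longrightarrow> col {x, y} < 2"
    by (auto simp: col_def)
  from Ramsey2[OF infinite_UNIV_nat this] obtain Y t where
    Y: "infinite Y" "\<forall>x\<in>Y. \<forall>y\<in>Y. x \<noteq> y \<longrightarrow> col {x, y} = t"
    by blast
  define \<phi> where "\<phi> = enumerate Y"
  have mono: "strict_mono \<phi>"
    unfolding \<phi>_def using Y(1) by (rule strict_mono_enumerate)
  have colt: "col {\<phi> i, \<phi> j} = t" if "i < j" for i j
    using Y that mono by (auto simp: \<phi>_def enumerate_in_set strict_mono_eq)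
  have colP: "col {\<phi> i, \<phi> j} = 0 \<longleftrightarrow> P (f (\<phi> i)) (f (\<phi> j))" if "i < j" for i j
    using strict_monoD[OF mono that] by (simp add: col_def)
  obtain i j where ij: "i < j" "P (f (\<phi> i)) (f (\<phi> j))"
    using assms unfolding almost_full_def by (metis comp_apply)
  then have "t = 0" using colt[OF ij(1)] colP[OF ij(1)] by simp
  then have "P (f (\<phi> i)) (f (\<phi> j))" if "i < j" for i j
    using colt[OF that] colP[OF that] by simp
  with mono show ?thesis by (intro exI[of _ \<phi>]) simp
qed

lemma almost_full_nat_le: "almost_full ((\<le>) :: nat \<Rightarrow> nat \<Rightarrow> bool)"
  unfolding almost_full_def
proof
  fix f :: "nat \<Rightarrow> nat"
  obtain i where "\<And>j. f i \<le> f j"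
    using ex_has_least_nat[of "\<lambda>_. True" 0 f] by auto
  then show "\<exists>i j. i < j \<and> f i \<le> f j"
    by (intro exI[of _ i] exI[of _ "Suc i"]) auto
qed

text \<open>Pass to a subsequence along which \<open>P\<close> holds for all pairs; a pair that is
  good for \<open>Q\<close> there is good for both.\<close>

lemma almost_full_conj:
  assumes "almost_full P" "almost_full Q"
  shows "almost_full (\<lambda>x y. P x y \<and> Q x y)"
  unfolding almost_full_def
proof
  fix f :: "nat \<Rightarrow> 'a"
  obtain \<phi> :: "nat \<Rightarrow> nat" where "strict_mono \<phi> \<and> (\<forall>i j. i < j \<longrightarrow> P (f (\<phi> i)) (f (\<phi> j)))"
    using almost_full_subseq[OF assms(1), of f] ..
  then have \<phi>: "strict_mono \<phi>" "\<And>i j. i < j \<Longrightarrow> P (f (\<phi> i)) (f (\<phi> j))"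
    by simp_all
  obtain i j where "i < j" "Q (f (\<phi> i)) (f (\<phi> j))"
    using assms(2) unfolding almost_full_def by (metis comp_apply)
  then show "\<exists>i j. i < j \<and> P (f i) (f j) \<and> Q (f i) (f j)"
    using \<phi> strict_monoD by blast
qed

lemma almost_full_pullback: "almost_full P \<Longrightarrow> almost_full (\<lambda>x y. P (g x) (g y))"
  unfolding almost_full_def by (metis comp_apply)

lemma dickson: "almost_full (\<lambda>(x :: nat \<Rightarrow> nat) y. \<forall>k<d. x k \<le> y k)"
proof (induction d)
  case 0
  then show ?case by (auto simp: almost_full_def)
next
  case (Suc d)
  have "almost_full (\<lambda>(x :: nat \<Rightarrow> nat) y. (\<forall>k<d. x k \<le> y k) \<and> x d \<le> y d)"
    by (rule almost_full_conj[OF Suc almost_full_pullback[OF almost_full_nat_le]])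
  moreover have "(\<lambda>(x :: nat \<Rightarrow> nat) y. \<forall>k<Suc d. x k \<le> y k) =
      (\<lambda>x y. (\<forall>k<d. x k \<le> y k) \<and> x d \<le> y d)"
    by (auto simp: less_Suc_eq fun_eq_iff)
  ultimately show ?case by simp
qed

text \<open>Nash-Williams' minimal bad sequence argument.\<close>

theorem higman:
  assumes P: "almost_full P"
  shows "almost_full (list_emb P)"
proof (rule ccontr)
  define bad where "bad f \<longleftrightarrow> (\<forall>i j. i < j \<longrightarrow> \<not> list_emb P (f i) (f j))" for f :: "nat \<Rightarrow> 'a list"
  \<comment> \<open>Each stage of the construction is an entire bad sequence; stage \<open>n\<close>
    makes entry \<open>n\<close> as short as the entries before it permit.\<close>
  define least where "least n x \<longleftrightarrow> bad x \<and>
    (\<forall>h. bad h \<longrightarrow> (\<forall>k<n. h k = x k) \<longrightarrow> length (x n) \<le> length (h n))" for n x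
  have ex_least: "\<exists>y. least n y \<and> (\<forall>k<n. y k = x k)" if "bad x" for n x
  proof -
    define Q where "Q y \<longleftrightarrow> bad y \<and> (\<forall>k<n. y k = x k)" for y
    have "Q x" using that by (simp add: Q_def)
    from ex_has_least_nat[of Q, OF this, of "\<lambda>y. length (y n)"] obtain y
      where y: "Q y" "\<forall>h. Q h \<longrightarrow> length (y n) \<le> length (h n)" by blast
    have "length (y n) \<le> length (h n)" if "bad h" "\<forall>k<n. h k = y k" for h
      using y that by (simp add: Q_def)
    then show ?thesis using y(1) unfolding least_def Q_def by (intro exI[of _ y]) simp
  qed
  assume "\<not> almost_full (list_emb P)"
  then obtain f0 where "bad f0" unfolding almost_full_def bad_def by meson
  then have base: "\<exists>x. least 0 x" using ex_least[of f0 0] by blast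
  have step: "\<exists>y. least (Suc n) y \<and> (\<forall>k<Suc n. y k = x k)" if "least n x" for x n
    using ex_least[of x "Suc n"] that unfolding least_def by simp
  obtain g where g: "\<And>n. least n (g n)" "\<And>n. \<forall>k<Suc n. g (Suc n) k = g n k"
    using dependent_nat_choice[of least "\<lambda>n x y. \<forall>k<Suc n. y k = x k", OF base step] by blast
  \<comment> \<open>The diagonal agrees with \<open>g n\<close> on all entries up to
    \<open>n\<close>, and so inherits badness from the stages.\<close>
  define m where "m n = g n n" for n
  have gm: "g n k = m k" if "k \<le> n" for n k
    using that by (induction n rule: dec_induct) (auto simp: m_def g(2))
  have bad_m: "\<not> list_emb P (m i) (m j)" if "i < j" for i j
  proof -
    have "bad (g j)" using g(1)[of j] by (simp add: least_def)
    then have "\<not> list_emb P (g j i) (g j j)" using that by (simp add: bad_def)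
    then show ?thesis using gm[of i j] gm[of j j] that by simp
  qed
  have ne: "m n \<noteq> []" for n
    using bad_m[of n "Suc n"] by (metis lessI list_emb_Nil)
  obtain \<phi> :: "nat \<Rightarrow> nat" where "strict_mono \<phi> \<and> (\<forall>i j. i < j \<longrightarrow> P (hd (m (\<phi> i))) (hd (m (\<phi> j))))"
    using almost_full_subseq[OF P, of "\<lambda>n. hd (m n)"] ..
  then have \<phi>: "strict_mono \<phi>" "\<And>i j. i < j \<Longrightarrow> P (hd (m (\<phi> i))) (hd (m (\<phi> j)))"
    by simp_all
  \<comment> \<open>From position \<open>\<phi> 0\<close> on, words are replaced by the tails of
    those with pairwise related heads. An embedding of tails extends over the heads, and an
    embedding into a tail is one into the whole word; so \<open>h\<close> is still bad, although its
    entry \<open>\<phi> 0\<close> became shorter.\<close>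
  define h where "h k = (if k < \<phi> 0 then m k else tl (m (\<phi> (k - \<phi> 0))))" for k
  have tl_emb: "list_emb P xs (m n)" if "list_emb P xs (tl (m n))" for xs n
    using that ne[of n] by (metis list.exhaust_sel list_emb_Cons)
  have "bad h"
    unfolding bad_def
  proof (intro allI impI notI)
    fix i j :: nat
    assume ij: "i < j" and emb: "list_emb P (h i) (h j)"
    consider "j < \<phi> 0" | "i < \<phi> 0" "\<phi> 0 \<le> j" | "\<phi> 0 \<le> i" by linarith
    then show False
    proof cases
      case 1
      then show False using emb ij bad_m by (simp add: h_def)
    next
      case 2
      have "\<phi> 0 \<le> \<phi> (j - \<phi> 0)" using \<phi>(1) by (simp add: strict_mono_less_eq)
      then show False using 2 emb tl_emb bad_m[of i "\<phi> (j - \<phi> 0)"] by (simp add: h_def)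
    next
      case 3
      let ?a = "\<phi> (i - \<phi> 0)" and ?b = "\<phi> (j - \<phi> 0)"
      have lt: "i - \<phi> 0 < j - \<phi> 0" using 3 ij by auto
      have "list_emb P (hd (m ?a) # tl (m ?a)) (hd (m ?b) # tl (m ?b))"
        using emb 3 ij \<phi>(2)[OF lt] by (intro list_emb_Cons2) (auto simp: h_def)
      then show False
        using ne bad_m[OF strict_monoD[OF \<phi>(1) lt]] by simp
    qed
  qed
  moreover have "\<forall>k<\<phi> 0. h k = g (\<phi> 0) k" by (simp add: h_def gm)
  ultimately have "length (g (\<phi> 0) (\<phi> 0)) \<le> length (h (\<phi> 0))"
    using g(1)[of "\<phi> 0"] unfolding least_def by blast
  then show False
    using ne[of "\<phi> 0"] by (cases "m (\<phi> 0)") (simp_all add: h_def gm)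
qed

lemma list_emb_index_map:
  assumes "list_emb P xs ys"
  obtains p where "strict_mono_on {..<length xs} p" "\<And>j. j < length xs \<Longrightarrow> p j < length ys"
    "\<And>j. j < length xs \<Longrightarrow> P (xs ! j) (ys ! p j)"
  using assms
proof (induction arbitrary: thesis rule: list_emb.induct)
  case (list_emb_Nil ys)
  then show ?case by (auto simp: strict_mono_on_def)
next
  case (list_emb_Cons xs ys y)
  obtain p where p: "strict_mono_on {..<length xs} p" "\<And>j. j < length xs \<Longrightarrow> p j < length ys"
    "\<And>j. j < length xs \<Longrightarrow> P (xs ! j) (ys ! p j)"
    using list_emb_Cons.IH by blast
  then show ?case
    by (intro list_emb_Cons.prems[of "\<lambda>j. Suc (p j)"]) (auto simp: strict_mono_on_def)
next
  case (list_emb_Cons2 x y xs ys)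
  obtain p where p: "strict_mono_on {..<length xs} p" "\<And>j. j < length xs \<Longrightarrow> p j < length ys"
    "\<And>j. j < length xs \<Longrightarrow> P (xs ! j) (ys ! p j)"
    using list_emb_Cons2.IH by blast
  then show ?case
    using list_emb_Cons2.hyps(1)
    by (intro list_emb_Cons2.prems[of "\<lambda>j. case j of 0 \<Rightarrow> 0 | Suc j \<Rightarrow> Suc (p j)"])
      (auto simp: strict_mono_on_def split: nat.splits)
qed

section \<open>The action on monomials\<close>

lemma mon_dvd_iff: "mon_dvd u v \<longleftrightarrow> (\<forall>p. Poly_Mapping.lookup u p \<le> Poly_Mapping.lookup v p)"
proof
  assume "\<forall>p. Poly_Mapping.lookup u p \<le> Poly_Mapping.lookup v p"
  then have "v = u + (v - u)"
    by (intro poly_mapping_eqI) (simp add: lookup_add lookup_minus del: split_paired_All)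
  then show "mon_dvd u v" unfolding mon_dvd_def by blast
qed (auto simp: mon_dvd_def lookup_add)

lemma keys_plus_mon: "Poly_Mapping.keys (a + b :: mon) = Poly_Mapping.keys a \<union> Poly_Mapping.keys b"
  by (auto simp: in_keys_iff lookup_add)

lemma mon_dvd_refl: "mon_dvd u u"
  by (simp add: mon_dvd_iff)

lemma mon_dvd_trans: "mon_dvd u v \<Longrightarrow> mon_dvd v w \<Longrightarrow> mon_dvd u w"
  by (meson mon_dvd_iff order_trans)

lemma mon_dvd_keys: "mon_dvd u v \<Longrightarrow> Poly_Mapping.keys u \<subseteq> Poly_Mapping.keys v"
  by (auto simp: mon_dvd_def in_keys_iff lookup_add)

lemma mon_dvd_mons: "mon_dvd u v \<Longrightarrow> v \<in> mons c n \<Longrightarrow> u \<in> mons c n"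
  using mon_dvd_keys by (auto simp: mons_def)

text \<open>An arbitrary map may merge columns, whose exponents then add up. For maps in
  \<open>Inc\<close> and monomials in \<open>mons\<close> the sum has at most one term.\<close>

lemma lookup_mon_act:
  "Poly_Mapping.lookup (mon_act \<pi> u) (k, j) =
    (\<Sum>l | (k, l) \<in> Poly_Mapping.keys u \<and> \<pi> l = j. Poly_Mapping.lookup u (k, l))"
proof -
  let ?K = "Poly_Mapping.keys u"
  have "Poly_Mapping.lookup (mon_act \<pi> u) (k, j) =
      (\<Sum>q\<in>?K. if (fst q, \<pi> (snd q)) = (k, j) then Poly_Mapping.lookup u q else 0)"
    unfolding mon_act_def by (simp add: lookup_sum lookup_single when_def case_prod_beta)
  also have "\<dots> = (\<Sum>q\<in>?K \<inter> {q. (fst q, \<pi> (snd q)) = (k, j)}. Poly_Mapping.lookup u q)"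
    by (simp add: sum.inter_restrict)
  also have "\<dots> = (\<Sum>l | (k, l) \<in> ?K \<and> \<pi> l = j. Poly_Mapping.lookup u (k, l))"
    by (rule sum.reindex_bij_witness[of _ "\<lambda>l. (k, l)" snd]) auto
  finally show ?thesis .
qed

lemma Inc_inj: "\<pi> \<in> Inc i \<Longrightarrow> 1 \<le> a \<Longrightarrow> 1 \<le> b \<Longrightarrow> \<pi> a = \<pi> b \<longleftrightarrow> a = b"
  by (auto simp: Inc_def strict_mono_on_def) (metis less_irrefl nat_neq_iff)

lemma Inc_less: "\<pi> \<in> Inc i \<Longrightarrow> 1 \<le> a \<Longrightarrow> a < b \<Longrightarrow> \<pi> a < \<pi> b"
  by (auto simp: Inc_def strict_mono_on_def)

lemma Inc_le: "\<pi> \<in> Inc i \<Longrightarrow> 1 \<le> a \<Longrightarrow> a \<le> b \<Longrightarrow> \<pi> a \<le> \<pi> b"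
  using Inc_less[of \<pi> i a b] by (cases "a = b") auto

lemma Inc_ge: "\<pi> \<in> Inc i \<Longrightarrow> 1 \<le> a \<Longrightarrow> a \<le> \<pi> a"
proof (induction a)
  case (Suc n)
  show ?case
  proof (cases "n = 0")
    case True
    then show ?thesis using Suc.prems(1) by (auto simp: Inc_def)
  next
    case False
    then show ?thesis using Suc Inc_less[of \<pi> i n "Suc n"] by simp
  qed
qed simp

lemma Inc_fix: "\<pi> \<in> Inc i \<Longrightarrow> 1 \<le> a \<Longrightarrow> a \<le> i \<Longrightarrow> \<pi> a = a"
  by (auto simp: Inc_def)

lemma Inc_le_iff: "\<pi> \<in> Inc i \<Longrightarrow> 1 \<le> a \<Longrightarrow> \<pi> a \<le> i \<longleftrightarrow> a \<le> i"
  using Inc_ge[of \<pi> i a] Inc_fix[of \<pi> i a] by auto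

lemma lookup_mon_act_Inc:
  assumes "u \<in> mons c n" "\<pi> \<in> Inc i" "1 \<le> j"
  shows "Poly_Mapping.lookup (mon_act \<pi> u) (k, \<pi> j) = Poly_Mapping.lookup u (k, j)"
proof -
  have "{l. (k, l) \<in> Poly_Mapping.keys u \<and> \<pi> l = \<pi> j} =
      (if (k, j) \<in> Poly_Mapping.keys u then {j} else {})"
  proof -
    have "l = j" if "(k, l) \<in> Poly_Mapping.keys u" "\<pi> l = \<pi> j" for l
      using that assms(1,3) Inc_inj[OF assms(2), of l j] by (auto simp: mons_def)
    then show ?thesis by auto
  qed
  then show ?thesis by (simp add: lookup_mon_act in_keys_iff)
qed

lemma keys_mon_act:
  assumes "u \<in> mons c n" "\<pi> \<in> Inc i"
  shows "Poly_Mapping.keys (mon_act \<pi> u) = (\<lambda>(k, j). (k, \<pi> j)) ` Poly_Mapping.keys u"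
proof -
  have "(k, j) \<in> Poly_Mapping.keys (mon_act \<pi> u) \<longleftrightarrow> (\<exists>l. (k, l) \<in> Poly_Mapping.keys u \<and> \<pi> l = j)" for k j
  proof
    assume "(k, j) \<in> Poly_Mapping.keys (mon_act \<pi> u)"
    then show "\<exists>l. (k, l) \<in> Poly_Mapping.keys u \<and> \<pi> l = j"
      unfolding in_keys_iff[of _ "mon_act \<pi> u"] lookup_mon_act
      by (rule contrapos_np) (simp cong: conj_cong)
  next
    assume "\<exists>l. (k, l) \<in> Poly_Mapping.keys u \<and> \<pi> l = j"
    then obtain l where l: "(k, l) \<in> Poly_Mapping.keys u" "\<pi> l = j" by blast
    then have "1 \<le> l" using assms(1) by (auto simp: mons_def)
    then show "(k, j) \<in> Poly_Mapping.keys (mon_act \<pi> u)"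
      using lookup_mon_act_Inc[OF assms, of l k] l by (simp add: in_keys_iff)
  qed
  then show ?thesis by (force simp: image_iff)
qed

lemma mon_act_mons:
  assumes "u \<in> mons c m" "\<pi> \<in> Inc_between i m n" "1 \<le> m"
  shows "mon_act \<pi> u \<in> mons c n"
proof -
  have \<pi>: "\<pi> \<in> Inc i" "\<pi> m \<le> n" using assms(2) by (auto simp: Inc_between_def)
  have "1 \<le> \<pi> j \<and> \<pi> j \<le> n" if "1 \<le> j" "j \<le> m" for j
    using that Inc_ge[OF \<pi>(1), of j] Inc_le[OF \<pi>(1), of j m] \<pi>(2) by auto
  then show ?thesis
    using assms(1) unfolding mons_def by (auto simp: keys_mon_act[OF assms(1) \<pi>(1)])
qed

lemma mon_act_eqI:
  assumes "u \<in> mons c m" "\<And>j. 1 \<le> j \<Longrightarrow> j \<le> m \<Longrightarrow> \<pi> j = \<sigma> j"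
  shows "mon_act \<pi> u = mon_act \<sigma> u"
  unfolding mon_act_def using assms by (intro sum.cong) (auto simp: mons_def)

lemma mon_act_id: "mon_act id u = u"
proof (rule poly_mapping_eqI, clarify)
  fix k j
  have "{l. (k, l) \<in> Poly_Mapping.keys u \<and> id l = j} =
      (if (k, j) \<in> Poly_Mapping.keys u then {j} else {})" by auto
  then show "Poly_Mapping.lookup (mon_act id u) (k, j) = Poly_Mapping.lookup u (k, j)"
    by (simp add: lookup_mon_act in_keys_iff)
qed

lemma mon_act_fixed:
  assumes "u \<in> mons c m" "\<pi> \<in> Inc i" "\<And>k j. (k, j) \<in> Poly_Mapping.keys u \<Longrightarrow> j \<le> i"
  shows "mon_act \<pi> u = u"
proof -
  have "u \<in> mons c i" using assms(1,3) by (auto simp: mons_def)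
  from mon_act_eqI[OF this, of \<pi> id] show ?thesis
    using Inc_fix[OF assms(2)] by (simp add: mon_act_id)
qed

lemma mon_act_comp:
  assumes "u \<in> mons c m" "\<sigma> \<in> Inc i"
  shows "mon_act \<tau> (mon_act \<sigma> u) = mon_act (\<tau> \<circ> \<sigma>) u"
proof -
  have inj: "inj_on (\<lambda>(k, j). (k, \<sigma> j)) (Poly_Mapping.keys u)"
  proof (rule inj_onI, clarsimp)
    fix k a b assume "(k, a) \<in> Poly_Mapping.keys u" "(k, b) \<in> Poly_Mapping.keys u" "\<sigma> a = \<sigma> b"
    moreover from this have "1 \<le> a" "1 \<le> b" using assms(1) by (auto simp: mons_def)
    ultimately show "a = b" using Inc_inj[OF assms(2)] by blast
  qed
  have "Poly_Mapping.lookup (mon_act \<sigma> u) (k, \<sigma> j) = Poly_Mapping.lookup u (k, j)"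
    if "(k, j) \<in> Poly_Mapping.keys u" for k j
    using that assms by (intro lookup_mon_act_Inc[OF assms]) (auto simp: mons_def)
  then show ?thesis
    unfolding mon_act_def[of \<tau>] mon_act_def[of "\<tau> \<circ> \<sigma>"] keys_mon_act[OF assms] sum.reindex[OF inj]
    by (intro sum.cong) auto
qed

lemma mon_act_mono:
  assumes "v \<in> mons c m" "mon_dvd u v" "\<pi> \<in> Inc i"
  shows "mon_dvd (mon_act \<pi> u) (mon_act \<pi> v)"
proof -
  have u: "u \<in> mons c m" using mon_dvd_mons assms by blast
  have "Poly_Mapping.lookup (mon_act \<pi> u) (k, j) \<le> Poly_Mapping.lookup (mon_act \<pi> v) (k, j)" for k j
  proof (cases "(k, j) \<in> Poly_Mapping.keys (mon_act \<pi> u)")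
    case True
    then obtain l where l: "j = \<pi> l" "(k, l) \<in> Poly_Mapping.keys u"
      unfolding keys_mon_act[OF u assms(3)] by auto
    then have "1 \<le> l" using u by (auto simp: mons_def)
    then show ?thesis
      using l lookup_mon_act_Inc[OF u assms(3)] lookup_mon_act_Inc[OF assms(1,3)] assms(2)
      by (simp add: mon_dvd_iff)
  qed (simp add: in_keys_iff)
  then show ?thesis by (auto simp: mon_dvd_iff)
qed

lemma poly_act_monom: "poly_act \<pi> (monom_poly u :: 'k::field poly_xs) = monom_poly (mon_act \<pi> u)"
  by (simp add: poly_act_def monom_poly_def)

lemma keys_poly_act: "Poly_Mapping.keys (poly_act \<pi> f) \<subseteq> mon_act \<pi> ` Poly_Mapping.keys f"
proof -
  have "Poly_Mapping.keys (poly_act \<pi> f) \<subseteq>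
      (\<Union>u\<in>Poly_Mapping.keys f. Poly_Mapping.keys (Poly_Mapping.single (mon_act \<pi> u) (Poly_Mapping.lookup f u)))"
    unfolding poly_act_def by (rule keys_sum)
  also have "\<dots> \<subseteq> mon_act \<pi> ` Poly_Mapping.keys f"
    by (auto simp: keys_single split: if_splits)
  finally show ?thesis .
qed

lemma id_Inc: "id \<in> Inc i"
  by (auto simp: Inc_def strict_mono_on_def)

text \<open>If \<open>\<pi> m < n\<close>, the second factor is the identity. Otherwise only
  \<open>m\<close> of the \<open>n\<close> columns are hit, so some column \<open>p\<close> below
  \<open>n\<close> is missed: \<open>\<sigma>\<close> closes this gap and \<open>\<tau>\<close>
  opens it again. Thus whatever a smaller width generates at width \<open>n\<close> is already
  generated from width \<open>n - 1\<close>.\<close>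

lemma Inc_one_step_factor:
  assumes "\<pi> \<in> Inc_between i m n" "1 \<le> m" "m < n"
  obtains \<sigma> \<tau> where "\<sigma> \<in> Inc_between i m (n - 1)" "\<tau> \<in> Inc_between i (n - 1) n"
    "\<And>j. 1 \<le> j \<Longrightarrow> j \<le> m \<Longrightarrow> \<tau> (\<sigma> j) = \<pi> j"
proof -
  have \<pi>: "\<pi> \<in> Inc i" "\<pi> m \<le> n" using assms(1) by (auto simp: Inc_between_def)
  show ?thesis
  proof (cases "\<pi> m < n")
    case True
    then show ?thesis
      using that[of \<pi> id] \<pi> id_Inc by (auto simp: Inc_between_def)
  next
    case False
    then have mn: "\<pi> m = n" using \<pi> by simp
    have "card (\<pi> ` {1..m}) \<le> m" using card_image_le[of "{1..m}" \<pi>] by simp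
    then have "\<not> {1..n} \<subseteq> \<pi> ` {1..m}"
      using card_mono[of "\<pi> ` {1..m}" "{1..n}"] assms(3) by auto
    then obtain p where "p \<in> {1..n}" "p \<notin> \<pi> ` {1..m}" by blast
    then have p: "1 \<le> p" "p \<le> n" "p \<notin> \<pi> ` {1..m}" by simp_all
    have pn: "p < n" using p mn assms(2) by (cases "p = n") auto
    have np: "\<pi> j \<noteq> p" if "1 \<le> j" for j
      using p pn mn that Inc_le[OF \<pi>(1), of m j] assms(2) by (cases "j \<le> m") auto
    \<comment> \<open>Columns up to \<open>i\<close> are fixed and therefore hit, so the gap lies
      beyond them and both factors fix them too.\<close>
    have ip: "i < p"
      using np[of p] p Inc_fix[OF \<pi>(1), of p] by (meson not_le)
    define \<tau> where "\<tau> j = (if j < p then j else Suc j)" for j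
    define \<sigma> where "\<sigma> j = (if \<pi> j < p then \<pi> j else \<pi> j - 1)" for j
    have less: "\<sigma> a < \<sigma> b" if "1 \<le> a" "a < b" for a b
      using Inc_less[OF \<pi>(1) that] np[of a] np[of b] that by (auto simp: \<sigma>_def)
    have "\<sigma> j \<ge> 1" if "1 \<le> j" for j
      using Inc_ge[OF \<pi>(1) that] np[of j] that p by (auto simp: \<sigma>_def)
    moreover have "\<sigma> j = j" if "1 \<le> j" "j \<le> i" for j
      using Inc_fix[OF \<pi>(1) that] that ip by (auto simp: \<sigma>_def)
    ultimately have "\<sigma> \<in> Inc_between i m (n - 1)"
      using less mn pn p(1) \<sigma>_def[of m]
      unfolding Inc_between_def Inc_def strict_mono_on_def by (auto simp: image_subset_iff)
    moreover have "\<tau> \<in> Inc_between i (n - 1) n"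
      using ip pn by (auto simp: Inc_between_def Inc_def strict_mono_on_def \<tau>_def)
    moreover have "\<tau> (\<sigma> j) = \<pi> j" if "1 \<le> j" for j
      using np[OF that] by (auto simp: \<tau>_def \<sigma>_def)
    ultimately show ?thesis by (intro that)
  qed
qed

lemma Inc_between_comp:
  assumes "\<sigma> \<in> Inc_between i l m" "\<tau> \<in> Inc_between i m n" "1 \<le> l"
  shows "\<tau> \<circ> \<sigma> \<in> Inc_between i l n"
proof -
  have \<sigma>: "\<sigma> \<in> Inc i" "\<sigma> l \<le> m" and \<tau>: "\<tau> \<in> Inc i" "\<tau> m \<le> n"
    using assms by (auto simp: Inc_between_def)
  have ge: "1 \<le> \<sigma> j" if "1 \<le> j" for j using Inc_ge[OF \<sigma>(1) that] that by simp
  have "\<tau> (\<sigma> l) \<le> n"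
    using Inc_le[OF \<tau>(1) ge[OF assms(3)] \<sigma>(2)] \<tau>(2) by simp
  moreover have "\<tau> \<circ> \<sigma> \<in> Inc i"
    using \<sigma>(1) \<tau>(1) ge unfolding Inc_def strict_mono_on_def by (auto simp: image_subset_iff)
  ultimately show ?thesis by (simp add: Inc_between_def)
qed

lemma mon_act_unique:
  assumes "u \<in> mons c m" "\<pi> \<in> Inc i"
    and keys: "\<And>k j. (k, j) \<in> Poly_Mapping.keys w \<Longrightarrow> \<exists>l\<ge>1. j = \<pi> l"
    and lookup: "\<And>k l. 1 \<le> l \<Longrightarrow> Poly_Mapping.lookup w (k, \<pi> l) = Poly_Mapping.lookup u (k, l)"
  shows "mon_act \<pi> u = w"
proof (rule poly_mapping_eqI, clarify)
  fix k j
  show "Poly_Mapping.lookup (mon_act \<pi> u) (k, j) = Poly_Mapping.lookup w (k, j)"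
  proof (cases "\<exists>l\<ge>1. j = \<pi> l")
    case True
    then show ?thesis using lookup lookup_mon_act_Inc[OF assms(1,2)] by auto
  next
    case False
    have "(k, j) \<notin> Poly_Mapping.keys (mon_act \<pi> u)"
    proof
      assume "(k, j) \<in> Poly_Mapping.keys (mon_act \<pi> u)"
      then obtain l where l: "j = \<pi> l" "(k, l) \<in> Poly_Mapping.keys u"
        unfolding keys_mon_act[OF assms(1,2)] by auto
      then have "1 \<le> l" using assms(1) by (auto simp: mons_def)
      then show False using False l(1) by blast
    qed
    then show ?thesis using False keys by (metis in_keys_iff)
  qed
qed

lemma mon_act_keysD:
  assumes "u \<in> mons c m" "\<pi> \<in> Inc i" "(k, j) \<in> Poly_Mapping.keys (mon_act \<pi> u)"
  shows "\<exists>l\<ge>1. j = \<pi> l"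
proof -
  obtain l where l: "j = \<pi> l" "(k, l) \<in> Poly_Mapping.keys u"
    using assms(3) unfolding keys_mon_act[OF assms(1,2)] by auto
  then have "1 \<le> l" using assms(1) by (auto simp: mons_def)
  then show ?thesis using l(1) by blast
qed

lemma mon_act_add:
  assumes "u \<in> mons c m" "v \<in> mons c m" "\<pi> \<in> Inc i"
  shows "mon_act \<pi> (u + v) = mon_act \<pi> u + mon_act \<pi> v"
proof (rule mon_act_unique[OF _ assms(3)])
  show "u + v \<in> mons c m" using assms by (simp add: mons_add_iff)
  show "\<exists>l\<ge>1. j = \<pi> l" if "(k, j) \<in> Poly_Mapping.keys (mon_act \<pi> u + mon_act \<pi> v)" for k j
    using that mon_act_keysD[OF assms(1,3)] mon_act_keysD[OF assms(2,3)] by (auto simp: keys_plus_mon)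
qed (simp add: lookup_add lookup_mon_act_Inc[OF assms(1,3)] lookup_mon_act_Inc[OF assms(2,3)])

text \<open>Subtraction of exponents is truncated, so \<open>u - v\<close> is u divided by gcd(u,
  v); an injective renaming of columns commutes with this.\<close>

lemma mon_act_diff:
  assumes "u \<in> mons c m" "v \<in> mons c m" "\<pi> \<in> Inc i"
  shows "mon_act \<pi> (u - v) = mon_act \<pi> u - mon_act \<pi> v"
proof (rule mon_act_unique[OF _ assms(3)])
  show "u - v \<in> mons c m" using assms keys_diff[of u v] unfolding mons_def by blast
  show "\<exists>l\<ge>1. j = \<pi> l" if "(k, j) \<in> Poly_Mapping.keys (mon_act \<pi> u - mon_act \<pi> v)" for k j
    using that keys_diff[of "mon_act \<pi> u" "mon_act \<pi> v"] mon_act_keysD[OF assms(1,3)]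
      mon_act_keysD[OF assms(2,3)] by blast
qed (simp add: lookup_minus lookup_mon_act_Inc[OF assms(1,3)] lookup_mon_act_Inc[OF assms(2,3)])

section \<open>Monomial ideals\<close>

definition mon_set :: "('k::field) poly_xs set \<Rightarrow> mon set" where
  "mon_set J = {u. monom_poly u \<in> J}"

lemma carrier_polyR: "f \<in> carrier (polyR c n) \<longleftrightarrow> Poly_Mapping.keys f \<subseteq> mons c n"
  by (simp add: polyR_def)

lemma polyR_ops [simp]:
  "mult (polyR c n) = (*)" "add (polyR c n) = (+)" "one (polyR c n) = 1" "zero (polyR c n) = 0"
  by (auto simp: polyR_def)

lemma keys_monom_poly [simp]: "Poly_Mapping.keys (monom_poly u :: 'k::field poly_xs) = {u}"
  by (simp add: monom_poly_def)

lemma monom_poly_carrier: "(monom_poly u :: 'k::field poly_xs) \<in> carrier (polyR c n) \<longleftrightarrow> u \<in> mons c n"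
  by (simp add: carrier_polyR)

lemma monom_poly_mult: "monom_poly u * monom_poly v = (monom_poly (u + v) :: 'k::field poly_xs)"
  by (simp add: monom_poly_def mult_single)

lemma zero_mons: "0 \<in> mons c n"
  by (simp add: mons_def)

lemma monomial_ideal_iff:
  fixes J :: "('k::field) poly_xs set"
  assumes "monomial_ideal c n J"
  shows "f \<in> J \<longleftrightarrow> Poly_Mapping.keys f \<subseteq> mon_set J"
proof -
  obtain S where S: "S \<subseteq> mons c n" "J = Idl\<^bsub>polyR c n\<^esub> (monom_poly ` S)"
    using assms unfolding monomial_ideal_def by blast
  note J = S(2)[unfolded Idl_monom[OF S(1)]]
  have "mon_set J = {u \<in> mons c n. \<exists>s\<in>S. mon_dvd s u}"
    unfolding mon_set_def J by (auto simp: monom_poly_carrier)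
  then show ?thesis unfolding J by (auto simp: carrier_polyR)
qed

lemma mon_set_subset:
  assumes "monomial_ideal c n (J :: ('k::field) poly_xs set)"
  shows "mon_set J \<subseteq> mons c n"
proof -
  obtain S where S: "S \<subseteq> mons c n" "J = Idl\<^bsub>polyR c n\<^esub> (monom_poly ` S)"
    using assms unfolding monomial_ideal_def by blast
  note J = S(2)[unfolded Idl_monom[OF S(1)]]
  show ?thesis unfolding mon_set_def J by (auto simp: monom_poly_carrier)
qed

lemma mon_set_upward:
  assumes "monomial_ideal c n (J :: ('k::field) poly_xs set)"
    "u \<in> mon_set J" "mon_dvd u v" "v \<in> mons c n"
  shows "v \<in> mon_set J"
proof -
  obtain S where S: "S \<subseteq> mons c n" "J = Idl\<^bsub>polyR c n\<^esub> (monom_poly ` S)"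
    using assms unfolding monomial_ideal_def by blast
  note J = S(2)[unfolded Idl_monom[OF S(1)]]
  show ?thesis using assms(2-4) mon_dvd_trans unfolding mon_set_def J
    by (auto simp: monom_poly_carrier)
qed

lemma monomial_idealI:
  fixes J :: "('k::field) poly_xs set"
  assumes "T \<subseteq> mons c n" "\<And>u v. u \<in> T \<Longrightarrow> mon_dvd u v \<Longrightarrow> v \<in> mons c n \<Longrightarrow> v \<in> T"
    and J: "\<And>f. f \<in> J \<longleftrightarrow> Poly_Mapping.keys f \<subseteq> T"
  shows "monomial_ideal c n J" "mon_set J = T"
proof -
  have "J = Idl\<^bsub>polyR c n\<^esub> (monom_poly ` T)"
  proof (rule Set.set_eqI)
    fix f :: "'k poly_xs"
    have "Poly_Mapping.keys f \<subseteq> T \<longleftrightarrow>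
        Poly_Mapping.keys f \<subseteq> mons c n \<and> (\<forall>m\<in>Poly_Mapping.keys f. \<exists>s\<in>T. mon_dvd s m)"
      using assms(1,2) mon_dvd_refl by blast
    then show "f \<in> J \<longleftrightarrow> f \<in> Idl\<^bsub>polyR c n\<^esub> (monom_poly ` T)"
      unfolding Idl_monom[OF assms(1)] J by (simp add: carrier_polyR)
  qed
  then show "monomial_ideal c n J" using assms(1) unfolding monomial_ideal_def by blast
  show "mon_set J = T" by (auto simp: mon_set_def J)
qed

lemma monomial_ideal_ideal:
  "monomial_ideal c n (J :: ('k::field) poly_xs set) \<Longrightarrow> ideal J (polyR c n)"
proof -
  interpret R: cring "polyR c n :: 'k poly_xs ring" by (rule polyR_cring)
  assume "monomial_ideal c n J"
  then obtain S where S: "S \<subseteq> mons c n" "J = Idl\<^bsub>polyR c n\<^esub> (monom_poly ` S)"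
    unfolding monomial_ideal_def by blast
  show ?thesis unfolding S(2)
    using S(1) by (intro R.genideal_ideal) (auto simp: monom_poly_carrier)
qed

lemma monomial_ideal_proper_iff:
  assumes "monomial_ideal c n (J :: ('k::field) poly_xs set)"
  shows "J = carrier (polyR c n) \<longleftrightarrow> 0 \<in> mon_set J"
proof
  assume "J = carrier (polyR c n)"
  then show "0 \<in> mon_set J" by (simp add: mon_set_def monom_poly_carrier zero_mons)
next
  assume "0 \<in> mon_set J"
  then have "mon_set J = mons c n"
    using mon_set_subset[OF assms] mon_set_upward[OF assms, of 0] by (auto simp: mon_dvd_def)
  then show "J = carrier (polyR c n)"
    using monomial_ideal_iff[OF assms] by (auto simp: carrier_polyR)
qed

text \<open>Multiplication by a monomial shifts exponent vectors injectively, so nothing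
  cancels.\<close>

lemma keys_mult_monom:
  "Poly_Mapping.keys (f * monom_poly v :: 'k::field poly_xs) = (\<lambda>u. u + v) ` Poly_Mapping.keys f"
proof -
  have "Poly_Mapping.lookup (f * monom_poly v) (u + v) = Poly_Mapping.lookup f u" for u
  proof -
    have "f = (\<Sum>m\<in>Poly_Mapping.keys f. Poly_Mapping.single m (Poly_Mapping.lookup f m))"
      by (intro poly_mapping_eqI)
        (auto simp: lookup_sum lookup_single when_def sum.delta in_keys_iff)
    then have "f * monom_poly v = (\<Sum>m\<in>Poly_Mapping.keys f. Poly_Mapping.single (m + v) (Poly_Mapping.lookup f m))"
      by (metis (no_types, lifting) sum.cong sum_distrib_right monom_poly_def mult_single mult.right_neutral)
    then show ?thesis
      by (auto simp: lookup_sum lookup_single when_def sum.delta in_keys_iff)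
  qed
  moreover have "m \<in> (\<lambda>u. u + v) ` Poly_Mapping.keys f"
    if "m \<in> Poly_Mapping.keys (f * monom_poly v)" for m
    using that keys_mult[of f "monom_poly v :: 'k poly_xs"] by auto
  ultimately show ?thesis by (auto simp: in_keys_iff)
qed

lemma colon_mon_monomial:
  fixes J :: "('k::field) poly_xs set"
  assumes "monomial_ideal c n J"
  shows "monomial_ideal c n (colon_mon c n J v)"
    "mon_set (colon_mon c n J v) = {u \<in> mons c n. u + v \<in> mon_set J}"
proof -
  have *: "f \<in> colon_mon c n J v \<longleftrightarrow> Poly_Mapping.keys f \<subseteq> {u \<in> mons c n. u + v \<in> mon_set J}" for f
    unfolding colon_mon_def mem_Collect_eq monomial_ideal_iff[OF assms] keys_mult_monom
    by (auto simp: carrier_polyR)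
  have up: "w \<in> {u \<in> mons c n. u + v \<in> mon_set J}"
    if "u \<in> {u \<in> mons c n. u + v \<in> mon_set J}" "mon_dvd u w" "w \<in> mons c n" for u w
  proof -
    have "u + v \<in> mons c n" using that(1) mon_set_subset[OF assms] by auto
    then have "w + v \<in> mons c n" using that(3) by (simp add: mons_add_iff)
    moreover have "mon_dvd (u + v) (w + v)" using that(2) by (simp add: mon_dvd_iff lookup_add)
    ultimately show ?thesis using that mon_set_upward[OF assms] by blast
  qed
  show "monomial_ideal c n (colon_mon c n J v)"
    "mon_set (colon_mon c n J v) = {u \<in> mons c n. u + v \<in> mon_set J}"
    by (rule monomial_idealI[OF _ up *]; simp)+
qed

lemma min_gens_iff:
  assumes "monomial_ideal c n (J :: ('k::field) poly_xs set)"
  shows "u \<in> min_gens c n J \<longleftrightarrow> u \<in> mon_set J \<and> (\<forall>w\<in>mon_set J. mon_dvd w u \<longrightarrow> w = u)"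
  unfolding min_gens_unique(2)[OF assms] mon_set_def by auto

lemma min_gens_dvd:
  assumes "monomial_ideal c n (J :: ('k::field) poly_xs set)" "u \<in> mon_set J"
  obtains g where "g \<in> min_gens c n J" "mon_dvd g u"
proof -
  obtain g where g: "g \<in> mon_set J" "mon_dvd g u" "\<forall>w. w \<in> mon_set J \<longrightarrow> mon_dvd w g \<longrightarrow> w = g"
    using ex_minimal_divisor[of "\<lambda>u. u \<in> mon_set J", OF assms(2)] by auto
  then have "g \<in> min_gens c n J" using min_gens_iff[OF assms(1)] by blast
  then show ?thesis using g(2) by (rule that)
qed

section \<open>Covers\<close>

lemma mon_min_gt_iff: "u \<noteq> 0 \<Longrightarrow> mon_min u > i \<longleftrightarrow> (\<forall>(k, j)\<in>Poly_Mapping.keys u. i < j)"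
  unfolding mon_min_def by (subst Min_gr_iff) auto

lemma mon_max_le_iff: "u \<noteq> 0 \<Longrightarrow> mon_max u \<le> i \<longleftrightarrow> (\<forall>(k, j)\<in>Poly_Mapping.keys u. j \<le> i)"
  unfolding mon_max_def by (subst Max_le_iff) auto

text \<open>A generator dividing a monomial in columns beyond \<open>i\<close> uses only such
  columns itself, so covers may be tested on all monomials of \<open>J\<close>, and
  \<open>min_gens\<close> drops out. Properness keeps the monomial 1 out of \<open>J\<close>, for
  which \<open>mon_min\<close> would be a minimum over the empty set.\<close>

lemma i_cover_iff:
  assumes J: "monomial_ideal c n (J :: ('k::field) poly_xs set)" "J \<noteq> carrier (polyR c n)"
  shows "i_cover c n i J C \<longleftrightarrow> C \<subseteq> {1..c} \<and>
    (\<forall>u\<in>mon_set J. (\<forall>(k, j)\<in>Poly_Mapping.keys u. i < j) \<longrightarrow> (\<exists>k\<in>C. \<exists>j. (k, j) \<in> Poly_Mapping.keys u))"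
proof -
  have z: "0 \<notin> mon_set J" using monomial_ideal_proper_iff[OF J(1)] J(2) by simp
  have cov: "covers C u \<longleftrightarrow> (\<exists>k\<in>C. \<exists>j. (k, j) \<in> Poly_Mapping.keys u)" if "u \<in> mon_set J" for u
    using that mon_set_subset[OF J(1)] unfolding covers_def mons_def by fastforce
  have "(\<forall>u\<in>gens_above c n i J. covers C u) \<longleftrightarrow>
    (\<forall>u\<in>mon_set J. (\<forall>(k, j)\<in>Poly_Mapping.keys u. i < j) \<longrightarrow> covers C u)"
  proof (intro iffI ballI impI)
    fix u assume A: "\<forall>u\<in>gens_above c n i J. covers C u"
      and u: "u \<in> mon_set J" "\<forall>(k, j)\<in>Poly_Mapping.keys u. i < j"
    obtain g where g: "g \<in> min_gens c n J" "mon_dvd g u" using min_gens_dvd[OF J(1) u(1)] .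
    then have gJ: "g \<in> mon_set J" using min_gens_iff[OF J(1)] by blast
    then have "g \<noteq> 0" using z by auto
    then have "mon_min g > i"
      using u(2) mon_dvd_keys[OF g(2)] by (subst mon_min_gt_iff) auto
    then have "covers C g" using A g(1) by (auto simp: gens_above_def)
    then show "covers C u" using mon_dvd_keys[OF g(2)] unfolding covers_def by blast
  next
    fix u assume A: "\<forall>u\<in>mon_set J. (\<forall>(k, j)\<in>Poly_Mapping.keys u. i < j) \<longrightarrow> covers C u"
      and u: "u \<in> gens_above c n i J"
    then have uJ: "u \<in> mon_set J" using min_gens_iff[OF J(1)] by (auto simp: gens_above_def)
    then have "u \<noteq> 0" using z by auto
    then show "covers C u" using A u uJ mon_min_gt_iff[of u i] by (auto simp: gens_above_def)
  qed
  then show ?thesis using cov unfolding i_cover_def by auto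
qed

lemma i_cover_all:
  assumes J: "monomial_ideal c n (J :: ('k::field) poly_xs set)" "J \<noteq> carrier (polyR c n)"
  shows "i_cover c n i J {1..c}"
proof -
  have "\<exists>k\<in>{1..c}. \<exists>j. (k, j) \<in> Poly_Mapping.keys u" if "u \<in> mon_set J" for u
  proof -
    have "u \<noteq> 0" using that monomial_ideal_proper_iff[OF J(1)] J(2) by auto
    then obtain k j where kj: "(k, j) \<in> Poly_Mapping.keys u"
      by (metis keys_eq_empty ex_in_conv surj_pair)
    then show ?thesis using that mon_set_subset[OF J(1)] by (auto simp: mons_def intro!: bexI[of _ k])
  qed
  then show ?thesis unfolding i_cover_iff[OF J] by auto
qed

lemma finite_covers: "finite {C. i_cover c n i J C}"
  by (rule finite_subset[of _ "Pow {1..c}"]) (auto simp: i_cover_def)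

lemma gamma_attained:
  assumes J: "monomial_ideal c n (J :: ('k::field) poly_xs set)" "J \<noteq> carrier (polyR c n)"
  obtains C where "i_cover c n i J C" "gamma c n i J = enat (card C)"
    "\<And>D. i_cover c n i J D \<Longrightarrow> card C \<le> card D"
proof -
  let ?S = "card ` {C. i_cover c n i J C}"
  have fin: "finite ?S" using finite_covers by blast
  have "?S \<noteq> {}" using i_cover_all[OF J] by blast
  then have "Min ?S \<in> ?S" using fin by (rule Min_in[rotated])
  then obtain C where C: "i_cover c n i J C" "card C = Min ?S" by force
  then show ?thesis
    using J(2) fin by (intro that[of C]) (auto simp: gamma_def)
qed

section \<open>Stabilization of invariant chains\<close>

text \<open>One inclusion of the equality in \<open>generated_by\<close>, read off on monomials; the
  other one is invariance and is supplied separately.\<close>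

definition mon_generated :: "nat \<Rightarrow> (nat \<Rightarrow> ('k::field) poly_xs set) \<Rightarrow> nat \<Rightarrow> nat \<Rightarrow> bool" where
  "mon_generated i J m n \<longleftrightarrow>
    (\<forall>w\<in>mon_set (J n). \<exists>u\<in>mon_set (J m). \<exists>\<pi>\<in>Inc_between i m n. mon_dvd (mon_act \<pi> u) w)"

definition generated_by :: "nat \<Rightarrow> nat \<Rightarrow> (nat \<Rightarrow> ('k::field) poly_xs set) \<Rightarrow> nat \<Rightarrow> nat \<Rightarrow> bool" where
  "generated_by c i J r n \<longleftrightarrow>
    J n = Idl\<^bsub>polyR c n\<^esub> {poly_act \<pi> f | \<pi> f. f \<in> J r \<and> \<pi> \<in> Inc_between i r n}"

lemma poly_act_carrier:
  assumes "f \<in> carrier (polyR c m)" "\<pi> \<in> Inc_between i m n" "1 \<le> m"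
  shows "poly_act \<pi> f \<in> carrier (polyR c n)"
proof -
  have "mon_act \<pi> ` Poly_Mapping.keys f \<subseteq> mons c n"
    using mon_act_mons[OF _ assms(2,3)] assms(1) by (auto simp: carrier_polyR)
  then show ?thesis
    using keys_poly_act[of \<pi> f] by (simp add: carrier_polyR)
qed

text \<open>The monomials of \<open>poly_act \<pi> f\<close> are images of monomials of
  \<open>f\<close>, which themselves belong to the monomial ideal \<open>J r\<close>; hence the
  orbit of \<open>mon_set (J r)\<close> generates. The identity map gives the second claim.\<close>

lemma generated_by_imp:
  fixes J :: "nat \<Rightarrow> ('k::field) poly_xs set"
  assumes "generated_by c i J r n" "monomial_ideal c r (J r)" "1 \<le> r" "r \<le> n"
  shows "mon_generated i J r n" "mon_set (J r) \<subseteq> mon_set (J n)"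
proof -
  interpret R: cring "polyR c n :: 'k poly_xs ring" by (rule polyR_cring)
  let ?G = "{poly_act \<pi> f | \<pi> f. f \<in> J r \<and> \<pi> \<in> Inc_between i r n}"
  define S where "S = {mon_act \<pi> u | \<pi> u. u \<in> mon_set (J r) \<and> \<pi> \<in> Inc_between i r n}"
  have S: "S \<subseteq> mons c n"
    using mon_act_mons[OF _ _ assms(3)] mon_set_subset[OF assms(2)] unfolding S_def by blast
  have Jc: "J r \<subseteq> carrier (polyR c r)"
    using monomial_ideal_iff[OF assms(2)] mon_set_subset[OF assms(2)] by (auto simp: carrier_polyR)
  have G: "?G \<subseteq> carrier (polyR c n)" using poly_act_carrier assms(3) Jc by blast
  have "?G \<subseteq> Idl\<^bsub>polyR c n\<^esub> (monom_poly ` S)"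
  proof
    fix g assume "g \<in> ?G"
    then obtain \<pi> f where g: "g = poly_act \<pi> f" "f \<in> J r" "\<pi> \<in> Inc_between i r n" by blast
    have "Poly_Mapping.keys g \<subseteq> S"
      using keys_poly_act[of \<pi> f] g monomial_ideal_iff[OF assms(2), of f] unfolding S_def by blast
    then show "g \<in> Idl\<^bsub>polyR c n\<^esub> (monom_poly ` S)"
      using S mon_dvd_refl unfolding Idl_monom[OF S] by (auto simp: carrier_polyR)
  qed
  then have sub: "J n \<subseteq> Idl\<^bsub>polyR c n\<^esub> (monom_poly ` S)"
    unfolding assms(1)[unfolded generated_by_def]
    using S by (intro R.genideal_minimal R.genideal_ideal) (auto simp: monom_poly_carrier)
  show "mon_generated i J r n"
    unfolding mon_generated_def
  proof
    fix w assume "w \<in> mon_set (J n)"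
    then have "monom_poly w \<in> Idl\<^bsub>polyR c n :: 'k poly_xs ring\<^esub> (monom_poly ` S)"
      using sub by (auto simp: mon_set_def)
    then show "\<exists>u\<in>mon_set (J r). \<exists>\<pi>\<in>Inc_between i r n. mon_dvd (mon_act \<pi> u) w"
      unfolding Idl_monom[OF S] by (auto simp: S_def)
  qed
  show "mon_set (J r) \<subseteq> mon_set (J n)"
  proof
    fix u assume u: "u \<in> mon_set (J r)"
    have "id \<in> Inc_between i r n" using assms(4) id_Inc by (auto simp: Inc_between_def)
    moreover have "poly_act id (monom_poly u :: 'k poly_xs) = monom_poly u"
      by (simp add: poly_act_monom mon_act_id)
    ultimately have "monom_poly u \<in> ?G" using u unfolding mon_set_def by (metis (mono_tags, lifting) mem_Collect_eq)
    then show "u \<in> mon_set (J n)"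
      using R.genideal_self[OF G] assms(1) unfolding mon_set_def generated_by_def by auto
  qed
qed

lemma generated_byI:
  fixes J :: "nat \<Rightarrow> ('k::field) poly_xs set"
  assumes "mon_generated i J r n" "monomial_ideal c r (J r)" "monomial_ideal c n (J n)" "1 \<le> r"
    and inv: "\<And>u \<pi>. u \<in> mon_set (J r) \<Longrightarrow> \<pi> \<in> Inc_between i r n \<Longrightarrow> mon_act \<pi> u \<in> mon_set (J n)"
  shows "generated_by c i J r n"
  unfolding generated_by_def
proof
  interpret R: cring "polyR c n :: 'k poly_xs ring" by (rule polyR_cring)
  let ?G = "{poly_act \<pi> f | \<pi> f. f \<in> J r \<and> \<pi> \<in> Inc_between i r n}"
  have Jc: "J r \<subseteq> carrier (polyR c r)"
    using monomial_ideal_iff[OF assms(2)] mon_set_subset[OF assms(2)] by (auto simp: carrier_polyR)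
  have G: "?G \<subseteq> carrier (polyR c n)" using poly_act_carrier assms(4) Jc by blast
  show "Idl\<^bsub>polyR c n\<^esub> ?G \<subseteq> J n"
  proof (rule R.genideal_minimal[OF monomial_ideal_ideal[OF assms(3)]], safe)
    fix \<pi> f assume f: "f \<in> J r" "\<pi> \<in> Inc_between i r n"
    show "poly_act \<pi> f \<in> J n"
      using monomial_ideal_iff[OF assms(2), of f] f inv keys_poly_act[of \<pi> f]
      unfolding monomial_ideal_iff[OF assms(3)] by blast
  qed
  interpret I: ideal "Idl\<^bsub>polyR c n\<^esub> ?G" "polyR c n" by (rule R.genideal_ideal[OF G])
  obtain S where S: "S \<subseteq> mons c n" "J n = Idl\<^bsub>polyR c n\<^esub> (monom_poly ` S)"
    using assms(3) unfolding monomial_ideal_def by blast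
  show "J n \<subseteq> Idl\<^bsub>polyR c n\<^esub> ?G"
    unfolding S(2)
  proof (rule R.genideal_minimal[OF I.is_ideal], safe)
    fix w assume "w \<in> S"
    then have w: "w \<in> mon_set (J n)" "w \<in> mons c n"
      using R.genideal_self[of "monom_poly ` S"] S
      by (auto simp: mon_set_def monom_poly_carrier image_subset_iff)
    then obtain u \<pi> x where u: "u \<in> mon_set (J r)" "\<pi> \<in> Inc_between i r n" "w = mon_act \<pi> u + x"
      using assms(1) unfolding mon_generated_def mon_dvd_def by blast
    have x: "x \<in> mons c n" using w(2) u(3) mons_add_iff by blast
    have "poly_act \<pi> (monom_poly u) \<in> ?G" using u unfolding mon_set_def by blast
    then have "monom_poly (mon_act \<pi> u) \<in> Idl\<^bsub>polyR c n :: 'k poly_xs ring\<^esub> ?G"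
      using R.genideal_self[OF G] by (auto simp: poly_act_monom)
    from I.I_r_closed[OF this, of "monom_poly x"] x
    show "monom_poly w \<in> Idl\<^bsub>polyR c n\<^esub> ?G"
      by (simp add: u(3) monom_poly_mult monom_poly_carrier)
  qed
qed

text \<open>Maps in \<open>Inc i\<close> preserve the row of a variable and the side of
  \<open>i\<close> on which its column lies. So a monomial and its image are covered by the same
  sets, and an image dividing a monomial beyond \<open>i\<close> comes from a monomial beyond
  \<open>i\<close>.\<close>

lemma gamma_cong_generated:
  fixes J :: "nat \<Rightarrow> ('k::field) poly_xs set"
  assumes m: "monomial_ideal c m (J m)" and n: "monomial_ideal c n (J n)"
    and gen: "mon_generated i J m n" and sub: "mon_set (J m) \<subseteq> mon_set (J n)"
  shows "gamma c m i (J m) = gamma c n i (J n)"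
proof -
  have \<pi>: "u \<in> mons c m \<and> \<pi> \<in> Inc i" if "u \<in> mon_set (J m)" "\<pi> \<in> Inc_between i m n" for u \<pi>
    using that mon_set_subset[OF m] by (auto simp: Inc_between_def)
  have zero: "0 \<in> mon_set (J m) \<longleftrightarrow> 0 \<in> mon_set (J n)"
  proof
    assume "0 \<in> mon_set (J n)"
    then obtain u \<pi> where u: "u \<in> mon_set (J m)" "\<pi> \<in> Inc_between i m n" "mon_dvd (mon_act \<pi> u) 0"
      using gen unfolding mon_generated_def by blast
    then have "Poly_Mapping.keys u = {}"
      using mon_dvd_keys[OF u(3)] keys_mon_act[of u c m \<pi> i] \<pi> by auto
    then show "0 \<in> mon_set (J m)" using u by simp
  qed (use sub in blast)
  show ?thesis
  proof (cases "0 \<in> mon_set (J m)")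
    case True
    then show ?thesis
      using zero monomial_ideal_proper_iff[OF m] monomial_ideal_proper_iff[OF n]
      by (simp add: gamma_def)
  next
    case False
    then have ne: "J m \<noteq> carrier (polyR c m)" "J n \<noteq> carrier (polyR c n)"
      using zero monomial_ideal_proper_iff[OF m] monomial_ideal_proper_iff[OF n] by auto
    have "i_cover c m i (J m) C \<longleftrightarrow> i_cover c n i (J n) C" for C
      unfolding i_cover_iff[OF m ne(1)] i_cover_iff[OF n ne(2)]
    proof (intro conj_cong refl iffI ballI impI)
      fix w assume A: "\<forall>u\<in>mon_set (J m). (\<forall>(k, j)\<in>Poly_Mapping.keys u. i < j) \<longrightarrow> (\<exists>k\<in>C. \<exists>j. (k, j) \<in> Poly_Mapping.keys u)"
        and w: "w \<in> mon_set (J n)" "\<forall>(k, j)\<in>Poly_Mapping.keys w. i < j"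
      obtain u \<pi> where u: "u \<in> mon_set (J m)" "\<pi> \<in> Inc_between i m n" "mon_dvd (mon_act \<pi> u) w"
        using gen w(1) unfolding mon_generated_def by blast
      have um: "u \<in> mons c m" "\<pi> \<in> Inc i" using \<pi>[OF u(1,2)] by auto
      have sub': "(k, \<pi> j) \<in> Poly_Mapping.keys w" if "(k, j) \<in> Poly_Mapping.keys u" for k j
        using that keys_mon_act[OF um] mon_dvd_keys[OF u(3)] by force
      have "i < j" if "(k, j) \<in> Poly_Mapping.keys u" for k j
      proof -
        have "i < \<pi> j" using sub'[OF that] w(2) by auto
        moreover have "1 \<le> j" using that um(1) by (auto simp: mons_def)
        ultimately show ?thesis using Inc_le_iff[OF um(2)] by (meson not_le)
      qed
      then show "\<exists>k\<in>C. \<exists>j. (k, j) \<in> Poly_Mapping.keys w"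
        using A u(1) sub' by blast
    qed (use sub in blast)
    then have "{C. i_cover c m i (J m) C} = {C. i_cover c n i (J n) C}" by simp
    then show ?thesis using ne by (simp only: gamma_def if_False)
  qed
qed

text \<open>\<open>chain_gamma\<close> refers to \<open>ind\<close>, but any index from which the
  chain is generated gives the same value: two such indices are compared at their maximum.\<close>

lemma chain_gamma_eq:
  fixes J :: "nat \<Rightarrow> ('k::field) poly_xs set"
  assumes J: "\<And>n. 1 \<le> n \<Longrightarrow> monomial_ideal c n (J n)"
    and r: "1 \<le> r" "\<And>n. r \<le> n \<Longrightarrow> generated_by c i J r n"
  shows "chain_gamma c i J = gamma c r i (J r)"
proof -
  have const: "gamma c n i (J n) = gamma c q i (J q)"
    if "1 \<le> q" "\<And>n. q \<le> n \<Longrightarrow> generated_by c i J q n" "q \<le> n" for q n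
    using gamma_cong_generated[of c q J n i] generated_by_imp[OF that(2)[OF that(3)] J[OF that(1)] that(1,3)]
      J[of q] J[of n] that by simp
  let ?p = "ind c i J"
  have ind: "?p = (LEAST r. 1 \<le> r \<and> (\<forall>n\<ge>r. generated_by c i J r n))"
    unfolding ind_def generated_by_def ..
  have "1 \<le> ?p \<and> (\<forall>n\<ge>?p. generated_by c i J ?p n)"
    unfolding ind by (rule LeastI[of _ r]) (use r in blast)
  then have p: "gamma c n i (J n) = gamma c ?p i (J ?p)" if "?p \<le> n" for n
    using const that by blast
  have pr: "gamma c ?p i (J ?p) = gamma c r i (J r)"
    using p[of "max ?p r"] const[OF r, of "max ?p r"] by (metis max.cobounded1 max.cobounded2)
  have all: "\<forall>n\<ge>?p. gamma c n i (J n) = gamma c r i (J r)"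
  proof (intro allI impI)
    fix n assume "?p \<le> n"
    then show "gamma c n i (J n) = gamma c r i (J r)" by (rule trans[OF p pr])
  qed
  show ?thesis
    unfolding chain_gamma_def
  proof (rule the_equality)
    fix g assume "\<forall>n\<ge>?p. gamma c n i (J n) = g"
    then have "gamma c ?p i (J ?p) = g" by blast
    then show "g = gamma c r i (J r)" using pr by (rule trans[OF sym])
  qed (rule all)
qed

text \<open>The coordinates 0 and 1 make a word embedding fix the first \<open>i\<close> columns: a column \<open>j \<le> i\<close> can
  only be mapped to a column with the same label.\<close>

definition column_letter :: "nat \<Rightarrow> mon \<Rightarrow> nat \<Rightarrow> nat \<Rightarrow> nat" where
  "column_letter i w j k =
    (let l = if j \<le> i then j else 0
     in if k = 0 then l else if k = 1 then i - l else Poly_Mapping.lookup w (k - 1, j))"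

definition mon_word :: "nat \<Rightarrow> nat \<Rightarrow> mon \<Rightarrow> (nat \<Rightarrow> nat) list" where
  "mon_word i n w = map (column_letter i w) [1..<Suc n]"

lemma length_mon_word: "length (mon_word i n w) = n"
  by (simp add: mon_word_def)

text \<open>The positions used by a word embedding form an increasing map of columns; letters
  dominate coordinatewise, and from coordinate 2 on the coordinates are exponents.\<close>

lemma mon_word_emb_imp_dvd:
  assumes emb: "list_emb (\<lambda>x y. \<forall>k<c + 2. x k \<le> y k) (mon_word i m w) (mon_word i n w')"
    and w: "w \<in> mons c m" and m: "1 \<le> m" "i \<le> m"
  obtains \<pi> where "\<pi> \<in> Inc_between i m n" "mon_dvd (mon_act \<pi> w) w'"
proof -
  obtain p where p: "strict_mono_on {..<m} p" "\<And>j. j < m \<Longrightarrow> p j < n"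
    "\<And>j. j < m \<Longrightarrow> \<forall>k<c + 2. (mon_word i m w ! j) k \<le> (mon_word i n w' ! p j) k"
    using list_emb_index_map[OF emb, unfolded length_mon_word] by metis
  \<comment> \<open>Lists are indexed from 0 and columns from 1. Beyond \<open>m\<close> the map
    continues with slope 1, merely to be strictly increasing everywhere.\<close>
  define \<pi> where "\<pi> j = (if j \<le> m then Suc (p (j - 1)) else Suc (p (m - 1)) + (j - m))" for j
  have letter: "column_letter i w j k \<le> column_letter i w' (\<pi> j) k"
    if "1 \<le> j" "j \<le> m" "k < c + 2" for j k
  proof -
    have "(mon_word i m w ! (j - 1)) k \<le> (mon_word i n w' ! p (j - 1)) k"
      using p(3)[of "j - 1"] that by auto
    then show ?thesis
      using that p(2)[of "j - 1"] by (auto simp: mon_word_def \<pi>_def nth_append simp del: upt_Suc)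
  qed
  have less: "\<pi> a < \<pi> b" if "1 \<le> a" "a < b" for a b
  proof -
    have pm: "p x < p y" if "x < y" "y < m" for x y
      using p(1) that by (auto simp: strict_mono_on_def)
    have pm': "p x \<le> p y" if "x \<le> y" "y < m" for x y
      using pm[of x y] that by (cases "x = y") auto
    consider "b \<le> m" | "a \<le> m" "m < b" | "m < a" using that(2) by linarith
    then show ?thesis
    proof cases
      case 1
      then show ?thesis using pm[of "a - 1" "b - 1"] that by (auto simp: \<pi>_def)
    next
      case 2
      then have "a - 1 \<le> m - 1" by simp
      from pm'[OF this] 2 m(1) show ?thesis by (auto simp: \<pi>_def)
    next
      case 3
      then show ?thesis using that by (auto simp: \<pi>_def)
    qed
  qed
  \<comment> \<open>Let l be the label of column \<open>\<pi> j\<close>. Coordinates 0 and 1 give j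
    \<le> l and i - j \<le> i - l, so l = j. Since j is positive, l is not the default label 0, and
    therefore l is \<open>\<pi> j\<close> itself.\<close>
  have fixed: "\<pi> j = j" if "1 \<le> j" "j \<le> i" for j
    using letter[of j 0] letter[of j 1] that m
    by (auto simp: column_letter_def Let_def split: if_splits)
  have \<pi>: "\<pi> \<in> Inc i"
    using less fixed by (auto simp: Inc_def strict_mono_on_def) (simp add: \<pi>_def)
  have "\<pi> m \<le> n" using p(2)[of "m - 1"] m by (auto simp: \<pi>_def)
  with \<pi> have "\<pi> \<in> Inc_between i m n" by (simp add: Inc_between_def)
  moreover have "mon_dvd (mon_act \<pi> w) w'"
    unfolding mon_dvd_iff
  proof (intro allI)
    fix q :: "nat \<times> nat"
    obtain k l where q: "q = (k, l)" by (cases q)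
    show "Poly_Mapping.lookup (mon_act \<pi> w) q \<le> Poly_Mapping.lookup w' q"
    proof (cases "q \<in> Poly_Mapping.keys (mon_act \<pi> w)")
      case True
      then obtain j where j: "l = \<pi> j" "(k, j) \<in> Poly_Mapping.keys w"
        unfolding keys_mon_act[OF w \<pi>] q by auto
      then have kj: "1 \<le> k" "k \<le> c" "1 \<le> j" "j \<le> m" using w by (auto simp: mons_def)
      show ?thesis
        unfolding q j(1) lookup_mon_act_Inc[OF w \<pi> kj(3)]
        using letter[OF kj(3,4), of "Suc k"] kj by (auto simp: column_letter_def)
    qed (simp add: in_keys_iff)
  qed
  ultimately show ?thesis by (rule that)
qed

lemma mon_generated_trans:
  fixes J :: "nat \<Rightarrow> ('k::field) poly_xs set"
  assumes "mon_generated i J l m" "mon_generated i J m n" "1 \<le> l"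
    and "mon_set (J l) \<subseteq> mons c l" "mon_set (J m) \<subseteq> mons c m"
  shows "mon_generated i J l n"
  unfolding mon_generated_def
proof
  fix w assume "w \<in> mon_set (J n)"
  then obtain v \<tau> where v: "v \<in> mon_set (J m)" "\<tau> \<in> Inc_between i m n" "mon_dvd (mon_act \<tau> v) w"
    using assms(2) unfolding mon_generated_def by blast
  then obtain u \<sigma> where u: "u \<in> mon_set (J l)" "\<sigma> \<in> Inc_between i l m" "mon_dvd (mon_act \<sigma> u) v"
    using assms(1) unfolding mon_generated_def by blast
  have \<sigma>: "\<sigma> \<in> Inc i" "\<tau> \<in> Inc i" using u v by (auto simp: Inc_between_def)
  have "mon_dvd (mon_act \<tau> (mon_act \<sigma> u)) (mon_act \<tau> v)"
    by (rule mon_act_mono[OF _ u(3) \<sigma>(2)]) (use v(1) assms(5) in blast)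
  then have "mon_dvd (mon_act (\<tau> \<circ> \<sigma>) u) w"
    using mon_act_comp[of u c l \<sigma> i \<tau>] u(1) assms(4) \<sigma>(1) v(3) mon_dvd_trans by auto
  then show "\<exists>u\<in>mon_set (J l). \<exists>\<pi>\<in>Inc_between i l n. mon_dvd (mon_act \<pi> u) w"
    using u(1) Inc_between_comp[OF u(2) v(2) assms(3)] by blast
qed

lemma mon_generated_refl: "mon_generated i J n n"
  unfolding mon_generated_def
proof
  fix w assume "w \<in> mon_set (J n)"
  moreover have "id \<in> Inc_between i n n" using id_Inc by (auto simp: Inc_between_def)
  ultimately show "\<exists>u\<in>mon_set (J n). \<exists>\<pi>\<in>Inc_between i n n. mon_dvd (mon_act \<pi> u) w"
    using mon_dvd_refl[of w] by (metis mon_act_id)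
qed

section \<open>Existence of a stable index\<close>

locale monomial_chain =
  fixes c i :: nat and J :: "nat \<Rightarrow> ('k::field) poly_xs set"
  assumes monomial: "\<And>n. 1 \<le> n \<Longrightarrow> monomial_ideal c n (J n)"
    and invariant: "\<And>m n u \<pi>. 1 \<le> m \<Longrightarrow> m \<le> n \<Longrightarrow> u \<in> mon_set (J m) \<Longrightarrow>
      \<pi> \<in> Inc_between i m n \<Longrightarrow> mon_act \<pi> u \<in> mon_set (J n)"
begin

lemma mon_set_mons: "1 \<le> n \<Longrightarrow> mon_set (J n) \<subseteq> mons c n"
  using mon_set_subset monomial by blast

lemma factor_dvd:
  assumes "u \<in> mon_set (J m)" "\<pi> \<in> Inc_between i m n" "1 \<le> m" "m < n"
  obtains v \<tau> where "v \<in> mon_set (J (n - 1))" "\<tau> \<in> Inc_between i (n - 1) n"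
    "mon_act \<tau> v = mon_act \<pi> u"
proof -
  obtain \<sigma> \<tau> where st: "\<sigma> \<in> Inc_between i m (n - 1)" "\<tau> \<in> Inc_between i (n - 1) n"
    "\<And>j. 1 \<le> j \<Longrightarrow> j \<le> m \<Longrightarrow> \<tau> (\<sigma> j) = \<pi> j"
    using Inc_one_step_factor[OF assms(2-4)] by metis
  have u: "u \<in> mons c m" using assms(1,3) mon_set_mons by blast
  have "mon_act \<tau> (mon_act \<sigma> u) = mon_act (\<tau> \<circ> \<sigma>) u"
    using st(1) by (intro mon_act_comp[OF u]) (auto simp: Inc_between_def)
  also have "\<dots> = mon_act \<pi> u"
    using st(3) by (intro mon_act_eqI[OF u]) simp
  finally show ?thesis
    by (rule that[rotated 2]) (use st(2) invariant[OF assms(3) _ assms(1) st(1)] assms(4) in auto)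
qed

text \<open>A map from width \<open>\<rho>\<close> to width \<open>Suc n\<close> factors through
  width \<open>n\<close>, so every single step is generated, and the steps compose.\<close>

lemma mon_generated_shift:
  assumes \<rho>: "1 \<le> \<rho>" "\<And>n. \<rho> \<le> n \<Longrightarrow> mon_generated i J \<rho> n" and r: "\<rho> \<le> r" "r \<le> n"
  shows "mon_generated i J r n"
  using r(2)
proof (induction n rule: dec_induct)
  case base
  show ?case by (rule mon_generated_refl)
next
  case (step n)
  have "mon_generated i J n (Suc n)"
    unfolding mon_generated_def
  proof
    fix w assume "w \<in> mon_set (J (Suc n))"
    then obtain u \<pi> where u: "u \<in> mon_set (J \<rho>)" "\<pi> \<in> Inc_between i \<rho> (Suc n)" "mon_dvd (mon_act \<pi> u) w"
      using \<rho>(2)[of "Suc n"] step r(1) unfolding mon_generated_def by force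
    obtain v \<tau> where "v \<in> mon_set (J n)" "\<tau> \<in> Inc_between i n (Suc n)" "mon_act \<tau> v = mon_act \<pi> u"
      using factor_dvd[OF u(1,2) \<rho>(1)] step r(1) by auto
    then show "\<exists>u\<in>mon_set (J n). \<exists>\<pi>\<in>Inc_between i n (Suc n). mon_dvd (mon_act \<pi> u) w"
      using u(3) by metis
  qed
  with step show ?case
    using \<rho>(1) r(1) by (intro mon_generated_trans[of i J r n "Suc n" c] mon_set_mons) auto
qed

text \<open>If infinitely many widths needed new monomials, Higman's lemma would embed the word of
  one of them into that of a later one. The resulting map factors through the width just before the
  later one, where the supposedly new monomial is then generated.\<close>

theorem eventually_generated:
  obtains r where "1 \<le> r" "\<And>n. r \<le> n \<Longrightarrow> mon_generated i J r n"
proof -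
  \<comment> \<open>Widths up to \<open>i\<close> are left out because the encoding by words
    requires \<open>i \<le> m\<close>; finitely many widths do not affect stability.\<close>
  define B where "B = {n. max 1 i < n \<and> \<not> mon_generated i J (n - 1) n}"
  have "finite B"
  proof (rule ccontr)
    assume inf: "infinite B"
    define \<phi> where "\<phi> = enumerate B"
    have mono: "strict_mono \<phi>" unfolding \<phi>_def using inf by (rule strict_mono_enumerate)
    have "\<phi> k \<in> B" for k unfolding \<phi>_def using inf by (rule enumerate_in_set)
    then have \<phi>: "1 < \<phi> k" "i < \<phi> k" "\<not> mon_generated i J (\<phi> k - 1) (\<phi> k)" for k
      by (auto simp: B_def)
    have "\<exists>w. w \<in> mon_set (J (\<phi> k)) \<and> (\<forall>u\<in>mon_set (J (\<phi> k - 1)).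
        \<forall>\<pi>\<in>Inc_between i (\<phi> k - 1) (\<phi> k). \<not> mon_dvd (mon_act \<pi> u) w)" for k
      using \<phi>(3)[of k] unfolding mon_generated_def by blast
    then obtain w where w: "\<And>k. w k \<in> mon_set (J (\<phi> k))"
      "\<And>k u \<pi>. u \<in> mon_set (J (\<phi> k - 1)) \<Longrightarrow> \<pi> \<in> Inc_between i (\<phi> k - 1) (\<phi> k) \<Longrightarrow>
        \<not> mon_dvd (mon_act \<pi> u) (w k)"
      by metis
    let ?P = "\<lambda>x y :: nat \<Rightarrow> nat. \<forall>k<c + 2. x k \<le> y k"
    obtain a b where ab: "a < b"
      and emb: "list_emb ?P (mon_word i (\<phi> a) (w a)) (mon_word i (\<phi> b) (w b))"
      using higman[OF dickson[of "c + 2"], unfolded almost_full_def, rule_format,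
          of "\<lambda>k. mon_word i (\<phi> k) (w k)"] by blast
    have wm: "w a \<in> mons c (\<phi> a)" using w(1) \<phi>(1)[of a] mon_set_mons[of "\<phi> a"] by auto
    obtain \<pi> where \<pi>: "\<pi> \<in> Inc_between i (\<phi> a) (\<phi> b)" "mon_dvd (mon_act \<pi> (w a)) (w b)"
      using mon_word_emb_imp_dvd[OF emb wm] \<phi>(1,2)[of a] by auto
    obtain v \<tau> where "v \<in> mon_set (J (\<phi> b - 1))" "\<tau> \<in> Inc_between i (\<phi> b - 1) (\<phi> b)"
      "mon_act \<tau> v = mon_act \<pi> (w a)"
      using factor_dvd[OF w(1) \<pi>(1)] \<phi>(1)[of a] strict_monoD[OF mono ab] by auto
    then show False using w(2)[of v b \<tau>] \<pi>(2) by simp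
  qed
  define r where "r = Max (insert (Suc i) B)"
  have r: "x \<le> r" if "x = Suc i \<or> x \<in> B" for x
    using that \<open>finite B\<close> by (auto simp: r_def)
  have r1: "Suc i \<le> r" using r by blast
  have "mon_generated i J r n" if "r \<le> n" for n
    using that
  proof (induction n rule: dec_induct)
    case base
    show ?case by (rule mon_generated_refl)
  next
    case (step n)
    have "Suc n \<notin> B" using r[of "Suc n"] step(1) by auto
    then have "mon_generated i J n (Suc n)" using r1 step(1) by (simp add: B_def)
    with step show ?case
      using r1 by (intro mon_generated_trans[of i J r n "Suc n" c] mon_set_mons) auto
  qed
  then show ?thesis using r1 that[of r] by simp
qed

text \<open>Only the existence of a stable index makes the \<open>LEAST\<close> in
  \<open>ind\<close> denote one; \<open>mon_generated_shift\<close> then carries generation up to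
  \<open>r\<close>.\<close>

lemma mon_generated_ind:
  assumes "ind c i J \<le> r"
  shows "1 \<le> r" "r \<le> n \<Longrightarrow> mon_generated i J r n"
proof -
  have ind: "ind c i J = (LEAST r. 1 \<le> r \<and> (\<forall>n\<ge>r. generated_by c i J r n))"
    unfolding ind_def generated_by_def ..
  obtain q where q: "1 \<le> q" "\<And>n. q \<le> n \<Longrightarrow> mon_generated i J q n"
    using eventually_generated by metis
  have "generated_by c i J q n" if "q \<le> n" for n
    using q that invariant[OF q(1) that] by (intro generated_byI monomial) auto
  with q(1) have "1 \<le> ind c i J \<and> (\<forall>n\<ge>ind c i J. generated_by c i J (ind c i J) n)"
    unfolding ind using LeastI[of "\<lambda>r. 1 \<le> r \<and> (\<forall>n\<ge>r. generated_by c i J r n)" q] by simp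
  then have g: "1 \<le> ind c i J" "\<And>n. n \<ge> ind c i J \<Longrightarrow> generated_by c i J (ind c i J) n" by auto
  show "1 \<le> r" using g(1) assms by simp
  show "mon_generated i J r n" if "r \<le> n"
    using mon_generated_shift[OF g(1) _ assms that] generated_by_imp(1)[OF g(2) monomial[OF g(1)] g(1)]
    by blast
qed

end

section \<open>Monomial prime ideals\<close>

text \<open>This is an associated prime in terms of monomials: \<open>L : w\<close> is generated by
  the variables outside \<open>F\<close>. First \<open>F\<close> is chosen as large as possible such
  that some multiple \<open>w\<close> of \<open>v\<close> is killed by no monomial in the variables
  \<open>F\<close>; then \<open>w\<close> is chosen to be killed by as many variables as
  possible.\<close>

lemma ex_monomial_prime_colon:
  fixes L :: "mon set"
  assumes X: "finite X" and v: "Poly_Mapping.keys v \<subseteq> X" "v \<notin> L"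
    and up: "\<And>u w. u \<in> L \<Longrightarrow> Poly_Mapping.keys (u + w) \<subseteq> X \<Longrightarrow> u + w \<in> L"
  obtains w F where "Poly_Mapping.keys w \<subseteq> X" "F \<subseteq> X" "mon_dvd v w"
    "\<And>u. Poly_Mapping.keys u \<subseteq> X \<Longrightarrow> w + u \<in> L \<longleftrightarrow> \<not> Poly_Mapping.keys u \<subseteq> F"
proof -
  have keys_plus: "Poly_Mapping.keys (a + b) = Poly_Mapping.keys a \<union> Poly_Mapping.keys b" for a b :: mon
    by (auto simp: in_keys_iff lookup_add)
  define good where "good w F \<longleftrightarrow> Poly_Mapping.keys w \<subseteq> X \<and> F \<subseteq> X \<and> mon_dvd v w \<and>
    (\<forall>u. Poly_Mapping.keys u \<subseteq> F \<longrightarrow> w + u \<notin> L)" for w F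
  define H where "H w = {x \<in> X. w + Poly_Mapping.single x 1 \<in> L}" for w
  have "\<exists>w. good w {}" using v mon_dvd_refl by (auto simp: good_def intro!: exI[of _ v])
  moreover have "\<forall>F. (\<exists>w. good w F) \<longrightarrow> card F < Suc (card X)"
    using X card_mono by (auto simp: good_def less_Suc_eq_le)
  ultimately obtain F where F: "\<exists>w. good w F" "\<forall>F'. (\<exists>w. good w F') \<longrightarrow> card F' \<le> card F"
    using Lattices_Big.ex_has_greatest_nat[of "\<lambda>F. \<exists>w. good w F" "{}" card "Suc (card X)"] by blast
  have "\<forall>w. good w F \<longrightarrow> card (H w) < Suc (card X)"
    using X by (auto simp: H_def less_Suc_eq_le intro!: card_mono)
  then obtain w where w: "good w F" "\<forall>w'. good w' F \<longrightarrow> card (H w') \<le> card (H w)"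
    using F(1) Lattices_Big.ex_has_greatest_nat[of "\<lambda>w. good w F" _ "\<lambda>w. card (H w)" "Suc (card X)"] by blast
  have FX: "F \<subseteq> X" and wX: "Poly_Mapping.keys w \<subseteq> X" using w(1) by (auto simp: good_def)
  have H: "x \<in> H w" if x: "x \<in> X" "x \<notin> F" for x
  proof (rule ccontr)
    assume nH: "x \<notin> H w"
    have finF: "finite F" using FX X finite_subset by blast
    have "\<not> good w (insert x F)"
      using F(2)[rule_format, of "insert x F"] x(2) finF by auto
    then obtain u where u: "Poly_Mapping.keys u \<subseteq> insert x F" "w + u \<in> L"
      using w(1) x(1) by (auto simp: good_def)
    \<comment> \<open>If \<open>x\<close> outside \<open>F\<close> does not kill \<open>w\<close>,
      maximality of \<open>F\<close> gives a monomial \<open>t\<close> in \<open>F\<close> and a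
      power of \<open>x\<close> which together do. The least such power is positive.\<close>
    define Q where "Q a \<longleftrightarrow> (\<exists>t. Poly_Mapping.keys t \<subseteq> F \<and> w + t + Poly_Mapping.single x a \<in> L)" for a
    define t where "t = u - Poly_Mapping.single x (Poly_Mapping.lookup u x)"
    have ut: "u = t + Poly_Mapping.single x (Poly_Mapping.lookup u x)"
      unfolding t_def by (intro poly_mapping_eqI) (auto simp: lookup_add lookup_minus lookup_single when_def)
    have "Poly_Mapping.keys t \<subseteq> F"
    proof
      fix y assume "y \<in> Poly_Mapping.keys t"
      then have "y \<noteq> x" "y \<in> Poly_Mapping.keys u"
        unfolding t_def by (auto simp: in_keys_iff lookup_minus lookup_single when_def split: if_splits)
      then show "y \<in> F" using u(1) by blast
    qed
    then have "Q (Poly_Mapping.lookup u x)"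
      unfolding Q_def using u(2) ut by (metis add.assoc)
    define a where "a = (LEAST a. Q a)"
    have Qa: "Q a" unfolding a_def by (rule LeastI) fact
    have least: "\<not> Q b" if "b < a" for b using not_less_Least that unfolding a_def by blast
    have "\<not> Q 0" using w(1) unfolding Q_def good_def by simp
    then have a0: "a \<noteq> 0" using Qa by metis
    obtain t where t: "Poly_Mapping.keys t \<subseteq> F" "w + t + Poly_Mapping.single x a \<in> L"
      using Qa unfolding Q_def by blast
    \<comment> \<open>One factor \<open>x\<close> short of the least power: no monomial in
      \<open>F\<close> kills \<open>w1\<close>, but \<open>x\<close> does, along with every variable
      that kills \<open>w\<close>. This contradicts the choice of \<open>w\<close>.\<close>
    define w1 where "w1 = w + t + Poly_Mapping.single x (a - 1)"
    have w1X: "Poly_Mapping.keys w1 \<subseteq> X"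
      using wX t(1) FX x(1) by (auto simp: w1_def keys_plus keys_single split: if_splits)
    have w1x: "w1 + Poly_Mapping.single x 1 = w + t + Poly_Mapping.single x a"
      unfolding w1_def add.assoc single_add[symmetric] using a0 by simp
    have "w1 + s \<notin> L" if "Poly_Mapping.keys s \<subseteq> F" for s
    proof
      assume "w1 + s \<in> L"
      then have "w + (t + s) + Poly_Mapping.single x (a - 1) \<in> L" by (simp add: w1_def ac_simps)
      moreover have "Poly_Mapping.keys (t + s) \<subseteq> F" using t(1) that by (simp add: keys_plus)
      ultimately have "Q (a - 1)" unfolding Q_def by blast
      then show False using least[of "a - 1"] a0 by simp
    qed
    moreover have "mon_dvd v w1"
      using w(1) unfolding good_def w1_def mon_dvd_iff lookup_add by (metis add.commute trans_le_add2)
    ultimately have good1: "good w1 F" using w1X FX by (simp add: good_def)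
    have "H w \<subseteq> H w1"
    proof
      fix y assume y: "y \<in> H w"
      have "w1 + Poly_Mapping.single y 1 = w + Poly_Mapping.single y 1 + (t + Poly_Mapping.single x (a - 1))"
        by (simp add: w1_def ac_simps)
      moreover have "Poly_Mapping.keys (w1 + Poly_Mapping.single y 1) \<subseteq> X"
        using w1X y by (auto simp: keys_plus H_def)
      ultimately show "y \<in> H w1"
        using y up[of "w + Poly_Mapping.single y 1"] by (simp add: H_def)
    qed
    moreover have "x \<in> H w1" using t(2) x(1) w1x by (simp add: H_def)
    ultimately have "card (H w) < card (H w1)"
      using nH X by (intro psubset_card_mono) (auto simp: H_def)
    then show False using w(2)[rule_format, OF good1] by simp
  qed
  have "w + u \<in> L \<longleftrightarrow> \<not> Poly_Mapping.keys u \<subseteq> F" if u: "Poly_Mapping.keys u \<subseteq> X" for u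
  proof
    assume "\<not> Poly_Mapping.keys u \<subseteq> F"
    then obtain x where x: "x \<in> Poly_Mapping.keys u" "x \<notin> F" by blast
    have "w + u = w + Poly_Mapping.single x 1 + (u - Poly_Mapping.single x 1)"
      using x(1) by (intro poly_mapping_eqI)
        (auto simp: lookup_add lookup_minus lookup_single when_def in_keys_iff)
    moreover have "w + Poly_Mapping.single x 1 \<in> L" using H[of x] x u by (auto simp: H_def)
    moreover have "Poly_Mapping.keys (w + u) \<subseteq> X" using wX u by (simp add: keys_plus)
    ultimately show "w + u \<in> L" using up by metis
  qed (use w(1) in \<open>auto simp: good_def\<close>)
  then show ?thesis using that wX FX w(1) by (auto simp: good_def)
qed

lemma Inc_between_into:
  assumes T: "T \<subseteq> {i<..n}" "r \<le> card T" and r: "1 \<le> r" "r \<le> n"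
  obtains \<pi> where "\<pi> \<in> Inc_between i r n" "\<And>j. i < j \<Longrightarrow> j \<le> r \<Longrightarrow> \<pi> j \<in> T"
proof -
  \<comment> \<open>The tail beyond \<open>max i n\<close> makes the set infinite, so that
    \<open>enumerate\<close> is strictly increasing throughout; the elements of \<open>T\<close>
    come first.\<close>
  define S where "S = T \<union> {max i n<..}"
  have inf: "infinite S" unfolding S_def by (simp add: infinite_Ioi)
  have enumT: "enumerate S k \<in> T" if "k < card T" for k
  proof (rule ccontr)
    assume "enumerate S k \<notin> T"
    then have big: "n < enumerate S k"
      using enumerate_in_set[OF inf, of k] by (auto simp: S_def)
    have "T \<subseteq> enumerate S ` {..<k}"
    proof
      fix t assume t: "t \<in> T"
      then obtain l where l: "t = enumerate S l"
        using enumerate_Ex[OF inf, of t] by (auto simp: S_def)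
      then have "enumerate S l < enumerate S k" using t T(1) big by fastforce
      then have "l < k" using inf by (simp add: strict_mono_less[OF strict_mono_enumerate])
      then show "t \<in> enumerate S ` {..<k}" using l by blast
    qed
    then have "card T \<le> k"
      using card_mono[of "enumerate S ` {..<k}" T] card_image_le[of "{..<k}" "enumerate S"] by simp
    then show False using that by simp
  qed
  define \<pi> where "\<pi> j = (if j \<le> i then j else enumerate S (j - i - 1))" for j
  have gt: "i < enumerate S k" for k
  proof -
    have "S \<subseteq> {i<..}" using T(1) by (auto simp: S_def)
    then show ?thesis using enumerate_in_set[OF inf, of k] by blast
  qed
  have "\<pi> a < \<pi> b" if "1 \<le> a" "a < b" for a b
  proof -
    have "enumerate S (a - i - 1) < enumerate S (b - i - 1)" if "i < a"
      using inf that \<open>a < b\<close> by (intro enumerate_mono) auto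
    then show ?thesis using that(2) gt[of "b - i - 1"] by (auto simp: \<pi>_def)
  qed
  moreover have "1 \<le> \<pi> j" if "1 \<le> j" for j
    using that gt[of "j - i - 1"] by (simp add: \<pi>_def)
  ultimately have "\<pi> \<in> Inc i"
    unfolding Inc_def strict_mono_on_def by (auto simp: image_subset_iff) (simp add: \<pi>_def)
  moreover have into: "\<pi> j \<in> T" if "i < j" "j \<le> r" for j
    using enumT[of "j - i - 1"] that T(2) by (simp add: \<pi>_def)
  moreover have "\<pi> r \<le> n"
    using into[of r] T(1) r(2) by (cases "r \<le> i") (auto simp: \<pi>_def)
  ultimately show ?thesis using that by (simp add: Inc_between_def)
qed

text \<open>Sort the columns beyond \<open>i\<close> by the set \<open>A\<close> of their rows in
  \<open>F\<close>. If \<open>A\<close> has more than \<open>c - g\<close> elements, its complement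
  is too small to meet all elements of \<open>U\<close> beyond \<open>i\<close>, so some
  \<open>u\<close> lives in the rows \<open>A\<close>; given \<open>r\<close> columns of type
  \<open>A\<close>, a map could move \<open>u\<close> into \<open>F\<close>. Hence each such type
  occurs at most \<open>r\<close> times, and there are at most \<open>2 ^ c\<close> types.\<close>

lemma card_avoiding_le:
  fixes U :: "mon set"
  assumes F: "F \<subseteq> {1..c} \<times> {1..n}" and U: "U \<subseteq> mons c r" and r: "1 \<le> r" "r \<le> n" and g: "g \<le> c"
    and avoid: "\<And>u \<pi>. u \<in> U \<Longrightarrow> \<pi> \<in> Inc_between i r n \<Longrightarrow> \<not> Poly_Mapping.keys (mon_act \<pi> u) \<subseteq> F"
    and uncovered: "\<And>C. C \<subseteq> {1..c} \<Longrightarrow> card C < g \<Longrightarrow>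
      \<exists>u\<in>U. \<forall>(k, j)\<in>Poly_Mapping.keys u. i < j \<and> k \<notin> C"
  shows "card F \<le> (c - g) * n + c * (i + r * 2 ^ c)"
proof -
  define col where "col j = {k. (k, j) \<in> F}" for j
  have col: "col j \<subseteq> {1..c}" for j using F by (auto simp: col_def)
  then have fcol: "finite (col j)" for j using finite_subset by blast
  have colc: "card (col j) \<le> c" for j using card_mono[OF _ col, of j] by simp
  define TA where "TA A = {j \<in> {i<..n}. col j = A}" for A
  have TA: "card (TA A) \<le> r" if A: "A \<subseteq> {1..c}" "c - g < card A" for A
  proof (rule ccontr)
    assume "\<not> card (TA A) \<le> r"
    then have "r \<le> card (TA A)" by simp
    then obtain \<pi> where \<pi>: "\<pi> \<in> Inc_between i r n" "\<And>j. i < j \<Longrightarrow> j \<le> r \<Longrightarrow> \<pi> j \<in> TA A"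
      using Inc_between_into[of "TA A" i n r, OF _ _ r] unfolding TA_def by blast
    have "card ({1..c} - A) < g"
      using A card_mono[of "{1..c}" A] by (subst card_Diff_subset) (auto intro: finite_subset)
    then obtain u where u: "u \<in> U" "\<forall>(k, j)\<in>Poly_Mapping.keys u. i < j \<and> k \<notin> {1..c} - A"
      using uncovered[of "{1..c} - A"] by auto
    have um: "u \<in> mons c r" using u(1) U by blast
    have "Poly_Mapping.keys (mon_act \<pi> u) \<subseteq> F"
    proof
      fix x assume "x \<in> Poly_Mapping.keys (mon_act \<pi> u)"
      then obtain k j where kj: "x = (k, \<pi> j)" "(k, j) \<in> Poly_Mapping.keys u"
        using keys_mon_act[OF um, of \<pi> i] \<pi>(1) by (auto simp: Inc_between_def)
      have "k \<in> {1..c}" "j \<le> r" using kj(2) um by (auto simp: mons_def)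
      moreover have "k \<in> A" "i < j" using bspec[OF u(2) kj(2)] calculation(1) by auto
      ultimately have "k \<in> A" "i < j" "j \<le> r" by simp_all
      then show "x \<in> F" using \<pi>(2)[of j] kj(1) by (auto simp: TA_def col_def)
    qed
    then show False using avoid[OF u(1) \<pi>(1)] by blast
  qed
  define T where "T = {j \<in> {i<..n}. c - g < card (col j)}"
  let ?P = "{A \<in> Pow {1..c}. c - g < card A}"
  have "T = (\<Union>A\<in>?P. TA A)" using col by (auto simp: T_def TA_def)
  then have "card T \<le> (\<Sum>A\<in>?P. card (TA A))" by (simp add: card_UN_le)
  also have "\<dots> \<le> (\<Sum>A\<in>?P. r)" using TA by (intro sum_mono) auto
  also have "\<dots> \<le> r * 2 ^ c"
  proof -
    have "card ?P \<le> card (Pow {1..c})" by (intro card_mono) auto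
    then show ?thesis by (simp add: card_Pow mult.commute)
  qed
  finally have cT: "card T \<le> r * 2 ^ c" .
  have "card F = card (SIGMA j:{1..n}. col j)"
  proof -
    have "prod.swap ` F = (SIGMA j:{1..n}. col j)" using F by (force simp: col_def)
    then show ?thesis by (metis card_image inj_swap)
  qed
  also have "\<dots> = (\<Sum>j\<in>{1..n}. card (col j))" using fcol by (intro card_SigmaI) auto
  \<comment> \<open>Every column is charged \<open>c - g\<close>, with a surcharge of
    \<open>c\<close> for the first \<open>i\<close> columns and those in \<open>T\<close>.\<close>
  also have "\<dots> \<le> (\<Sum>j\<in>{1..n}. (c - g) + (if j \<in> {1..i} \<union> T then c else 0))"
    using colc by (intro sum_mono) (auto simp: T_def not_less trans_le_add2)
  also have "\<dots> = (c - g) * n + (\<Sum>j\<in>{1..n} \<inter> ({1..i} \<union> T). c)"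
    unfolding sum.distrib by (subst sum.inter_restrict) auto
  also have "\<dots> \<le> (c - g) * n + card ({1..i} \<union> T) * c"
  proof -
    have "finite T" by (simp add: T_def)
    then have "card ({1..n} \<inter> ({1..i} \<union> T)) \<le> card ({1..i} \<union> T)" by (intro card_mono) auto
    then show ?thesis by simp
  qed
  also have "\<dots> \<le> (c - g) * n + (i + r * 2 ^ c) * c"
    using card_Un_le[of "{1..i}" T] cT by (intro add_left_mono mult_right_mono) auto
  finally show ?thesis by (simp add: mult.commute)
qed

section \<open>Algebraic relations between polynomials\<close>

text \<open>Gaussian elimination by induction on the equations: \<open>z\<close> is a pivot for
  equation \<open>y\<close>, it is eliminated in \<open>g\<close>, and \<open>b\<close> gives it the
  coefficient that solves equation \<open>y\<close>.\<close>

lemma ex_linear_relation: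
  fixes f :: "'a \<Rightarrow> 'b \<Rightarrow> 'k::field"
  assumes "finite Y" "finite X" "card Y < card X"
  shows "\<exists>a. (\<exists>x\<in>X. a x \<noteq> 0) \<and> (\<forall>y\<in>Y. (\<Sum>x\<in>X. a x * f x y) = 0)"
  using assms
proof (induction Y arbitrary: X f rule: finite_induct)
  case empty
  then have "X \<noteq> {}" by auto
  then show ?case by (intro exI[of _ "\<lambda>_. 1"]) auto
next
  case (insert y Y)
  show ?case
  proof (cases "\<forall>x\<in>X. f x y = 0")
    case True
    obtain a where "\<exists>x\<in>X. a x \<noteq> 0" "\<forall>y\<in>Y. (\<Sum>x\<in>X. a x * f x y) = 0"
      using insert.IH[of X f] insert.prems insert.hyps by auto
    then show ?thesis using True by (intro exI[of _ a]) auto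
  next
    case False
    then obtain z where z: "z \<in> X" "f z y \<noteq> 0" by blast
    define g where "g x t = f x t - f x y / f z y * f z t" for x t
    have "card Y < card (X - {z})" using insert.prems insert.hyps z(1) by simp
    then obtain a where a: "\<exists>x\<in>X - {z}. a x \<noteq> 0" "\<forall>t\<in>Y. (\<Sum>x\<in>X - {z}. a x * g x t) = 0"
      using insert.IH[of "X - {z}" g] insert.prems by auto
    define S where "S = (\<Sum>x\<in>X - {z}. a x * f x y)"
    define b where "b = a(z := - (S / f z y))"
    have "(\<Sum>x\<in>X. b x * f x t) = 0" if t: "t \<in> insert y Y" for t
    proof -
      have "(\<Sum>x\<in>X. b x * f x t) = b z * f z t + (\<Sum>x\<in>X - {z}. b x * f x t)"
        using z(1) insert.prems(1) by (simp add: sum.remove)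
      also have "(\<Sum>x\<in>X - {z}. b x * f x t) = (\<Sum>x\<in>X - {z}. a x * f x t)"
        by (intro sum.cong) (auto simp: b_def)
      also have "\<dots> = (\<Sum>x\<in>X - {z}. a x * g x t + a x * f x y * (f z t / f z y))"
        by (intro sum.cong) (auto simp: g_def algebra_simps)
      also have "\<dots> = (\<Sum>x\<in>X - {z}. a x * g x t) + S * (f z t / f z y)"
        unfolding S_def sum_distrib_right by (rule sum.distrib)
      also have "(\<Sum>x\<in>X - {z}. a x * g x t) = 0"
      proof (cases "t = y")
        case True
        then show ?thesis using z(2) by (simp add: g_def)
      next
        case False
        then show ?thesis using a(2) t by simp
      qed
      finally show ?thesis using z(2) by (simp add: b_def)
    qed
    moreover have "\<exists>x\<in>X. b x \<noteq> 0" using a(1) by (auto simp: b_def)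
    ultimately show ?thesis by blast
  qed
qed

section \<open>Polynomial expressions in given polynomials, and a count of their monomials\<close>

definition const_poly :: "'k::field \<Rightarrow> 'k poly_xs" where
  "const_poly a = Poly_Mapping.single 0 a"

fun power_prod :: "('a::comm_semiring_1) list \<Rightarrow> nat list \<Rightarrow> 'a" where
  "power_prod (f # fs) (k # ks) = f ^ k * power_prod fs ks"
| "power_prod _ _ = 1"

text \<open>Values at \<open>fs\<close> of polynomials that are nonzero because, taking the variables in order, the
  lowest coefficient in each of them is.\<close>

fun nested_combs :: "nat \<Rightarrow> nat \<Rightarrow> ('k::field) poly_xs list \<Rightarrow> 'k poly_xs set" where
  "nested_combs c n [] = {const_poly a | a. a \<noteq> 0}"
| "nested_combs c n (f # fs) =
    {f ^ m * (F + f * G) | m F G. F \<in> nested_combs c n fs \<and> G \<in> carrier (polyR c n)}"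

lemma polyR_sum_closed:
  assumes "\<And>x. x \<in> X \<Longrightarrow> f x \<in> carrier (polyR c n)"
  shows "(\<Sum>x\<in>X. f x) \<in> carrier (polyR c n :: ('k::field) poly_xs ring)"
  using assms
proof (induction X rule: infinite_finite_induct)
  case (insert x X)
  then show ?case using keys_add[of "f x" "sum f X"] by (auto simp: carrier_polyR)
qed (auto simp: carrier_polyR)

lemma polyR_power_closed:
  "f \<in> carrier (polyR c n) \<Longrightarrow> f ^ k \<in> carrier (polyR c n :: ('k::field) poly_xs ring)"
proof (induction k)
  case 0
  then show ?case by (simp add: carrier_polyR zero_mons)
next
  case (Suc k)
  then show ?case using polyR_mult_closed by simp
qed

lemma const_poly_carrier: "const_poly a \<in> carrier (polyR c n :: ('k::field) poly_xs ring)"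
  by (auto simp: const_poly_def carrier_polyR zero_mons)

lemma power_prod_closed:
  assumes "set fs \<subseteq> carrier (polyR c n)"
  shows "power_prod fs ks \<in> carrier (polyR c n :: ('k::field) poly_xs ring)"
  using assms
proof (induction fs ks rule: power_prod.induct)
  case (1 f fs k ks)
  then show ?case by (auto intro!: polyR_mult_closed polyR_power_closed)
qed (auto simp: carrier_polyR zero_mons)

text \<open>The exponent vectors with the lowest first entry \<open>m\<close> stay distinct when
  that entry is dropped, so by induction they yield a nested combination \<open>F\<close>; all
  others are divisible by one more power of \<open>f\<close>.\<close>

lemma sum_power_prod_nested:
  fixes fs :: "('k::field) poly_xs list"
  assumes "set fs \<subseteq> carrier (polyR c n)" "finite X" "X \<noteq> {}" "\<And>k. k \<in> X \<Longrightarrow> length k = length fs"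
    "\<And>k. k \<in> X \<Longrightarrow> a k \<noteq> 0"
  shows "(\<Sum>k\<in>X. const_poly (a k) * power_prod fs k) \<in> nested_combs c n fs"
  using assms
proof (induction fs arbitrary: X a)
  case Nil
  then have "X = {[]}" by auto
  then show ?case using Nil by auto
next
  case (Cons f fs)
  define m where "m = Min (hd ` X)"
  have m_le: "m \<le> hd k" if "k \<in> X" for k using that Cons.prems(2) by (simp add: m_def)
  have "m \<in> hd ` X" unfolding m_def using Cons.prems by (intro Min_in) auto
  then obtain k0 where k0: "k0 \<in> X" "hd k0 = m" by auto
  have cons: "k = hd k # tl k" "length (tl k) = length fs" if "k \<in> X" for k
    using Cons.prems(4)[OF that] by (cases k; simp)+
  define X1 where "X1 = {k \<in> X. hd k = m}"
  define X2 where "X2 = {k \<in> X. hd k \<noteq> m}"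
  define F where "F = (\<Sum>k\<in>tl ` X1. const_poly (a (m # k)) * power_prod fs k)"
  \<comment> \<open>On \<open>X2\<close> the first exponent exceeds \<open>m\<close>, so the
    subtraction is not truncated; one factor \<open>f\<close> is kept outside of
    \<open>G\<close>.\<close>
  define G where "G = (\<Sum>k\<in>X2. const_poly (a k) * (f ^ (hd k - m - 1) * power_prod fs (tl k)))"
  have inj: "inj_on tl X1"
    by (rule inj_onI) (metis (mono_tags, lifting) X1_def cons(1) mem_Collect_eq)
  have X1: "m # tl k = k" if "k \<in> X1" for k using that cons(1)[of k] by (simp add: X1_def)
  have F: "F \<in> nested_combs c n fs"
    unfolding F_def
  proof (rule Cons.IH)
    show "set fs \<subseteq> carrier (polyR c n)" using Cons.prems(1) by simp
    show "finite (tl ` X1)" using Cons.prems(2) by (simp add: X1_def)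
    show "tl ` X1 \<noteq> {}" using k0 by (auto simp: X1_def)
    show "length k = length fs" if "k \<in> tl ` X1" for k
      using that cons(2) by (auto simp: X1_def)
    show "a (m # k) \<noteq> 0" if "k \<in> tl ` X1" for k
      using that X1 Cons.prems(5) by (auto simp: X1_def)
  qed
  have G: "G \<in> carrier (polyR c n)"
    unfolding G_def using Cons.prems(1)
    by (intro polyR_sum_closed polyR_mult_closed const_poly_carrier polyR_power_closed power_prod_closed) auto
  have pp: "power_prod (f # fs) k = f ^ hd k * power_prod fs (tl k)" if "k \<in> X" for k
    using cons(1)[OF that] by (metis power_prod.simps(1))
  have "(\<Sum>k\<in>X. const_poly (a k) * power_prod (f # fs) k) =
      (\<Sum>k\<in>X1. const_poly (a k) * power_prod (f # fs) k) + (\<Sum>k\<in>X2. const_poly (a k) * power_prod (f # fs) k)"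
  proof -
    have X: "X = X1 \<union> X2" "X1 \<inter> X2 = {}" by (auto simp: X1_def X2_def)
    have "finite X1" "finite X2" using Cons.prems(2) by (simp_all add: X1_def X2_def)
    then show ?thesis unfolding X(1) using X(2) by (rule sum.union_disjoint)
  qed
  also have "(\<Sum>k\<in>X1. const_poly (a k) * power_prod (f # fs) k) = f ^ m * F"
    unfolding F_def sum.reindex[OF inj] sum_distrib_left comp_def
    using X1 pp by (intro sum.cong) (auto simp: X1_def ac_simps)
  also have "(\<Sum>k\<in>X2. const_poly (a k) * power_prod (f # fs) k) = f ^ m * (f * G)"
  proof -
    have "f ^ hd k = f ^ m * (f * f ^ (hd k - m - 1))" if "k \<in> X2" for k
    proof -
      have "hd k = m + Suc (hd k - m - 1)" using that m_le[of k] by (auto simp: X2_def)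
      then show ?thesis by (metis power_Suc power_add)
    qed
    then show ?thesis
      unfolding G_def sum_distrib_left
      using pp by (intro sum.cong) (auto simp: X2_def ac_simps)
  qed
  finally have "(\<Sum>k\<in>X. const_poly (a k) * power_prod (f # fs) k) = f ^ m * (F + f * G)"
    by (simp add: distrib_left)
  then show ?case using F G by auto
qed

text \<open>Each exponent is bounded separately, rather than the total degree, so that the monomials
  in a set of variables form a box that is easy to count.\<close>

definition exps_le :: "nat \<Rightarrow> ('k::field) poly_xs \<Rightarrow> bool" where
  "exps_le e f \<longleftrightarrow> (\<forall>m\<in>Poly_Mapping.keys f. \<forall>p. Poly_Mapping.lookup m p \<le> e)"

lemma exps_le_mult: "exps_le d f \<Longrightarrow> exps_le e g \<Longrightarrow> exps_le (d + e) (f * g)"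
  unfolding exps_le_def
proof (intro ballI allI)
  fix m p
  assume f: "\<forall>m\<in>Poly_Mapping.keys f. \<forall>p. Poly_Mapping.lookup m p \<le> d"
    and g: "\<forall>m\<in>Poly_Mapping.keys g. \<forall>p. Poly_Mapping.lookup m p \<le> e"
    and "m \<in> Poly_Mapping.keys (f * g)"
  then obtain a b where ab: "m = a + b" "a \<in> Poly_Mapping.keys f" "b \<in> Poly_Mapping.keys g"
    using keys_mult[of f g] by blast
  have "Poly_Mapping.lookup a p \<le> d" "Poly_Mapping.lookup b p \<le> e" using f g ab by blast+
  then show "Poly_Mapping.lookup m p \<le> d + e" by (simp add: ab(1) lookup_add)
qed

lemma exps_le_one: "exps_le d 1"
  by (simp add: exps_le_def)

lemma exps_le_power: "exps_le e f \<Longrightarrow> exps_le (k * e) (f ^ k)"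
proof (induction k)
  case (Suc k)
  then show ?case using exps_le_mult[of e f "k * e" "f ^ k"] by simp
qed (simp add: exps_le_one)

lemma exps_le_mono: "exps_le d f \<Longrightarrow> d \<le> e \<Longrightarrow> exps_le e f"
  unfolding exps_le_def by (meson order_trans)

lemma exps_le_power_prod:
  assumes "\<And>f. f \<in> set fs \<Longrightarrow> exps_le e f" "\<And>k. k \<in> set ks \<Longrightarrow> k \<le> D"
  shows "exps_le (length fs * (D * e)) (power_prod fs ks)"
  using assms
proof (induction fs ks rule: power_prod.induct)
  case (1 f fs k ks)
  have "exps_le (D * e) (f ^ k)"
    using exps_le_power[of e f k] 1 exps_le_mono mult_le_mono1 by (metis list.set_intros(1))
  then show ?case using exps_le_mult 1 by fastforce
qed (auto intro: exps_le_one)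

lemma ex_exps_le: "\<exists>e. exps_le e f"
proof -
  define e where "e = (\<Sum>m\<in>Poly_Mapping.keys f. \<Sum>p\<in>Poly_Mapping.keys m. Poly_Mapping.lookup m p)"
  have "Poly_Mapping.lookup m p \<le> e" if "m \<in> Poly_Mapping.keys f" for m p
  proof (cases "p \<in> Poly_Mapping.keys m")
    case True
    then have "Poly_Mapping.lookup m p \<le> (\<Sum>p\<in>Poly_Mapping.keys m. Poly_Mapping.lookup m p)"
      by (intro member_le_sum) auto
    also have "\<dots> \<le> e" unfolding e_def using that
      by (intro member_le_sum[where f = "\<lambda>m. \<Sum>p\<in>Poly_Mapping.keys m. Poly_Mapping.lookup m p"]) auto
    finally show ?thesis .
  qed (simp add: in_keys_iff)
  then show ?thesis unfolding exps_le_def by blast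
qed

lemma ex_exps_le_list: "\<exists>e. \<forall>f\<in>set fs. exps_le e f"
proof (induction fs)
  case (Cons f fs)
  then obtain d e where "\<forall>f\<in>set fs. exps_le e f" "exps_le d f" using ex_exps_le by metis
  then show ?case using exps_le_mono[of _ _ "max d e"]
    by (intro exI[of _ "max d e"]) (auto intro: exps_le_mono)
qed simp

lemma card_bounded_monomials:
  assumes "finite F"
  shows "finite {m :: mon. Poly_Mapping.keys m \<subseteq> F \<and> (\<forall>p. Poly_Mapping.lookup m p \<le> B)}" (is "finite ?Y")
    and "card {m :: mon. Poly_Mapping.keys m \<subseteq> F \<and> (\<forall>p. Poly_Mapping.lookup m p \<le> B)} \<le> Suc B ^ card F"
proof -
  let ?h = "\<lambda>m. restrict (Poly_Mapping.lookup m) F"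
  have inj: "inj_on ?h ?Y"
  proof (rule inj_onI)
    fix a b assume ab: "a \<in> ?Y" "b \<in> ?Y" "?h a = ?h b"
    have "Poly_Mapping.lookup a p = Poly_Mapping.lookup b p" for p
    proof (cases "p \<in> F")
      case True
      then show ?thesis using ab(3) by (metis restrict_apply')
    next
      case False
      then have "p \<notin> Poly_Mapping.keys a" "p \<notin> Poly_Mapping.keys b" using ab by auto
      then show ?thesis by (simp add: in_keys_iff)
    qed
    then show "a = b" by (intro poly_mapping_eqI)
  qed
  have sub: "?h ` ?Y \<subseteq> (\<Pi>\<^sub>E _\<in>F. {..B})" by auto
  have fin: "finite (\<Pi>\<^sub>E _\<in>F. {..B})" using assms by (intro finite_PiE) auto
  then show "finite ?Y" using finite_imageD[OF finite_subset[OF sub] inj] by blast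
  have "card ?Y = card (?h ` ?Y)" using inj by (simp add: card_image)
  also have "\<dots> \<le> card (\<Pi>\<^sub>E _\<in>F. {..B})" using fin sub by (rule card_mono)
  finally show "card ?Y \<le> Suc B ^ card F" using assms by (simp add: card_PiE)
qed

text \<open>There are \<open>D ^ length fs\<close> power products with exponents below \<open>D\<close>, but they involve only
  \<open>O(D ^ card F)\<close> monomials in the variables from \<open>F\<close>.\<close>

lemma ex_nested_comb_vanishing:
  fixes fs :: "('k::field) poly_xs list"
  assumes fs: "set fs \<subseteq> carrier (polyR c n)" and F: "finite F" "card F < length fs"
  obtains g where "g \<in> nested_combs c n fs" "g \<in> carrier (polyR c n)"
    "\<And>m. m \<in> Poly_Mapping.keys g \<Longrightarrow> \<not> Poly_Mapping.keys m \<subseteq> F"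
proof -
  obtain e where e: "\<forall>f\<in>set fs. exps_le e f" using ex_exps_le_list by blast
  define d where "d = length fs"
  \<comment> \<open>In a power product with exponents below \<open>D\<close> every variable has
    exponent at most \<open>B\<close>, and \<open>Suc B \<le> q * D\<close>. So there are at most
    \<open>q ^ card F * D ^ card F\<close> monomials in the variables \<open>F\<close>, and
    \<open>D\<close> is chosen to exceed \<open>q ^ card F\<close>, which makes them fewer than
    \<open>D ^ Suc (card F)\<close>.\<close>
  define q where "q = d * e + 1"
  define D where "D = q ^ card F + 1"
  define B where "B = d * (D * e)"
  define X where "X = {k. set k \<subseteq> {..<D} \<and> length k = d}"
  define Y where "Y = {m :: mon. Poly_Mapping.keys m \<subseteq> F \<and> (\<forall>p. Poly_Mapping.lookup m p \<le> B)}"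
  have cardX: "card X = D ^ d" unfolding X_def using card_lists_length_eq[of "{..<D}" d] by simp
  have finX: "finite X" unfolding X_def using finite_lists_length_eq[of "{..<D}" d] by simp
  have Y: "finite Y" "card Y \<le> Suc B ^ card F"
    unfolding Y_def using card_bounded_monomials[OF F(1)] by auto
  have "Suc B \<le> q * D" by (simp add: B_def q_def D_def algebra_simps)
  then have "card Y \<le> (q * D) ^ card F"
    using Y(2) power_mono[of "Suc B" "q * D" "card F"] by simp
  also have "\<dots> = q ^ card F * D ^ card F" by (simp add: power_mult_distrib)
  also have "\<dots> < D * D ^ card F" by (simp add: D_def)
  also have "\<dots> = D ^ Suc (card F)" by simp
  also have "\<dots> \<le> D ^ d" using F(2) by (intro power_increasing) (auto simp: D_def d_def)
  finally have "card Y < card X" using cardX by simp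
  from ex_linear_relation[OF Y(1) finX this, of "\<lambda>k. Poly_Mapping.lookup (power_prod fs k)"]
  obtain a where a: "\<exists>k\<in>X. a k \<noteq> 0"
    "\<forall>m\<in>Y. (\<Sum>k\<in>X. a k * Poly_Mapping.lookup (power_prod fs k) m) = 0" by blast
  define Z where "Z = {k \<in> X. a k \<noteq> 0}"
  define g where "g = (\<Sum>k\<in>Z. const_poly (a k) * power_prod fs k)"
  have lookup_const: "Poly_Mapping.lookup (const_poly b * h) m = b * Poly_Mapping.lookup h m"
    for b :: 'k and h m
  proof -
    have "h = (\<Sum>m\<in>Poly_Mapping.keys h. Poly_Mapping.single m (Poly_Mapping.lookup h m))"
      by (intro poly_mapping_eqI) (auto simp: lookup_sum lookup_single when_def in_keys_iff)
    then have "const_poly b * h =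
        (\<Sum>m\<in>Poly_Mapping.keys h. Poly_Mapping.single m (b * Poly_Mapping.lookup h m))"
      unfolding const_poly_def by (metis (no_types, lifting) sum.cong sum_distrib_left mult_single add_0)
    then show ?thesis
      by (auto simp: lookup_sum lookup_single when_def in_keys_iff)
  qed
  have look: "Poly_Mapping.lookup g m = (\<Sum>k\<in>X. a k * Poly_Mapping.lookup (power_prod fs k) m)" for m
    unfolding g_def lookup_sum lookup_const Z_def using finX by (intro sum.mono_neutral_left) auto
  show ?thesis
  proof (rule that[of g])
    show "g \<in> nested_combs c n fs"
      unfolding g_def
    proof (rule sum_power_prod_nested[OF fs])
      show "finite Z" using finX by (simp add: Z_def)
    qed (use a(1) in \<open>auto simp: Z_def X_def d_def\<close>)
    show "g \<in> carrier (polyR c n)"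
      unfolding g_def by (intro polyR_sum_closed polyR_mult_closed const_poly_carrier power_prod_closed fs)
    show "\<not> Poly_Mapping.keys m \<subseteq> F" if m: "m \<in> Poly_Mapping.keys g" for m
    proof
      assume mF: "Poly_Mapping.keys m \<subseteq> F"
      have ne: "Poly_Mapping.lookup g m \<noteq> 0" using m by (simp add: in_keys_iff)
      then obtain k where k: "k \<in> X" "Poly_Mapping.lookup (power_prod fs k) m \<noteq> 0"
        unfolding look by (metis (no_types, lifting) mult_zero_right sum.neutral)
      have "exps_le B (power_prod fs k)"
        unfolding B_def d_def using k(1) e by (intro exps_le_power_prod) (auto simp: X_def)
      then have "m \<in> Y" using k(2) mF by (simp add: exps_le_def Y_def in_keys_iff)
      then show False using a(2) ne look by simp
    qed
  qed
qed

section \<open>Regular sequences in Noetherian local rings\<close>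

text \<open>In a Noetherian ring the union of a nonempty chain of ideals belongs to the chain, so it
  is automatically proper and Zorn's lemma applies.\<close>

lemma (in noetherian_ring) ex_maximalideal:
  assumes "ideal J R" "J \<noteq> carrier R"
  obtains M where "maximalideal M R" "J \<subseteq> M"
proof -
  define S where "S = {I. ideal I R \<and> I \<noteq> carrier R \<and> J \<subseteq> I}"
  have "\<exists>M\<in>S. \<forall>X\<in>S. M \<subseteq> X \<longrightarrow> X = M"
  proof (rule subset_Zorn)
    fix C assume C: "subset.chain S C"
    show "\<exists>U\<in>S. \<forall>X\<in>C. X \<subseteq> U"
    proof (cases "C = {}")
      case True
      then show ?thesis using assms by (auto simp: S_def)
    next
      case False
      have "S \<subseteq> {I. ideal I R}" by (auto simp: S_def)
      then have "subset.chain {I. ideal I R} C" using C unfolding pred_on.chain_def by auto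
      then have "\<Union>C \<in> C" using ideal_chain_is_trivial False by blast
      then show ?thesis using C unfolding pred_on.chain_def by (meson Union_upper subsetD)
    qed
  qed
  then obtain M where M: "M \<in> S" "\<And>X. X \<in> S \<Longrightarrow> M \<subseteq> X \<Longrightarrow> X = M" by blast
  have "maximalideal M R"
    using M by (intro maximalidealI) (auto simp: S_def)
  then show ?thesis using M(1) that by (auto simp: S_def)
qed

lemma (in ideal) Units_mult_cancel:
  assumes "u \<in> Units R" "b \<in> carrier R" "u \<otimes> b \<in> I"
  shows "b \<in> I"
proof -
  have "inv u \<otimes> (u \<otimes> b) = b"
    using assms(1,2) by (metis Units_closed Units_inv_closed Units_l_inv l_one m_assoc)
  then show ?thesis using I_l_closed[OF assms(3) Units_inv_closed[OF assms(1)]] by simp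
qed

locale noetherian_local = cring R + noetherian_ring R for R (structure) +
  assumes unique_max: "\<exists>!m. maximalideal m R"
begin

text \<open>A non-unit lies in some maximal ideal, hence in the only one; as \<open>x\<close> lies
  there too, so would 1.\<close>

lemma one_minus_Units:
  assumes x: "x \<in> (THE m. maximalideal m R)" and t: "t \<in> carrier R"
  shows "\<one> \<ominus> x \<otimes> t \<in> Units R"
proof (rule ccontr)
  have max: "maximalideal (THE m. maximalideal m R) R" by (rule theI'[OF unique_max])
  then interpret m: maximalideal "THE m. maximalideal m R" R .
  have xc: "x \<in> carrier R" using x m.a_Hcarr by blast
  let ?a = "\<one> \<ominus> x \<otimes> t"
  have a: "?a \<in> carrier R" using xc t by simp
  assume nu: "?a \<notin> Units R"
  have "PIdl ?a \<noteq> carrier R"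
  proof
    assume "PIdl ?a = carrier R"
    then obtain b where b: "b \<in> carrier R" "\<one> = b \<otimes> ?a"
      using one_closed unfolding cgenideal_def by blast
    then have "?a \<otimes> b = \<one>" "b \<otimes> ?a = \<one>" using a m_comm by metis+
    then show False using nu a b(1) unfolding Units_def by blast
  qed
  then obtain M where M: "maximalideal M R" "PIdl ?a \<subseteq> M"
    using ex_maximalideal[OF cgenideal_ideal[OF a]] by blast
  then have "M = (THE m. maximalideal m R)" using unique_max max by blast
  then have "?a \<in> (THE m. maximalideal m R)" using M(2) cgenideal_self[OF a] by blast
  then have "?a \<oplus> x \<otimes> t \<in> (THE m. maximalideal m R)"
    using m.I_r_closed[OF x t] by (rule m.a_closed)
  moreover have "?a \<oplus> x \<otimes> t = \<one>" using xc t by algebra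
  ultimately show False using m.one_imp_carrier m.I_notcarr by auto
qed

text \<open>The relevant case of Krull's intersection theorem: \<open>w\<close> is divisible by only finitely many
  powers of \<open>x\<close> modulo \<open>J\<close>.\<close>

lemma power_factor:
  assumes J: "ideal J R" and x: "x \<in> (THE m. maximalideal m R)"
    and reg: "\<And>b. b \<in> carrier R \<Longrightarrow> x \<otimes> b \<in> J \<Longrightarrow> b \<in> J"
    and w: "w \<in> carrier R" "w \<notin> J"
  shows "\<exists>(a::nat) v. v \<in> carrier R \<and> v \<notin> set_add R J (PIdl x) \<and> w \<ominus> x [^] a \<otimes> v \<in> J"
proof (rule ccontr)
  interpret J: ideal J R by fact
  have max: "maximalideal (THE m. maximalideal m R) R" by (rule theI'[OF unique_max])
  then interpret m: maximalideal "THE m. maximalideal m R" R .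
  have xc: "x \<in> carrier R" using x m.a_Hcarr by blast
  assume none: "\<not> ?thesis"
  have div: "v \<in> set_add R J (PIdl x)" if "v \<in> carrier R" "w \<ominus> x [^] a \<otimes> v \<in> J" for a :: nat and v
    using that none by blast
  define P where "P a v \<longleftrightarrow> v \<in> carrier R \<and> w \<ominus> x [^] a \<otimes> v \<in> J" for a :: nat and v
  have step: "\<exists>u. P (Suc a) u \<and> v \<ominus> x \<otimes> u \<in> J" if "P a v" for a v
  proof -
    have v: "v \<in> carrier R" "w \<ominus> x [^] a \<otimes> v \<in> J" using that by (auto simp: P_def)
    obtain j b where jb: "j \<in> J" "b \<in> carrier R" "v = j \<oplus> b \<otimes> x"
      using div[OF v] unfolding set_add_def' cgenideal_def by blast
    have jc: "j \<in> carrier R" using jb(1) J.a_Hcarr by blast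
    have "v \<ominus> x \<otimes> b = j" unfolding jb(3) using jc jb(2) xc by algebra
    moreover have "w \<ominus> x [^] Suc a \<otimes> b = (w \<ominus> x [^] a \<otimes> v) \<oplus> x [^] a \<otimes> j"
      unfolding jb(3) using jc jb(2) xc w(1) nat_pow_closed[OF xc, of a] by (simp, algebra)
    moreover have "(w \<ominus> x [^] a \<otimes> v) \<oplus> x [^] a \<otimes> j \<in> J"
      using v(2) J.I_l_closed[OF jb(1) nat_pow_closed[OF xc, of a]] by (rule J.a_closed)
    ultimately show ?thesis using jb by (intro exI[of _ b]) (simp add: P_def)
  qed
  have base: "P 0 w" using w(1) J.zero_closed by (simp add: P_def a_minus_def r_neg)
  \<comment> \<open>If every quotient were again divisible by \<open>x\<close>, division would never
    stop: modulo \<open>J\<close>, \<open>W a\<close> is \<open>x \<otimes> W (Suc a)\<close>,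
    starting with \<open>w\<close>.\<close>
  obtain W where W: "\<And>a. P a (W a) \<and> (a = 0 \<longrightarrow> W a = w)" "\<And>a. W a \<ominus> x \<otimes> W (Suc a) \<in> J"
    using dependent_nat_choice[of "\<lambda>a v. P a v \<and> (a = 0 \<longrightarrow> v = w)" "\<lambda>a v u. v \<ominus> x \<otimes> u \<in> J"] base step by auto
  have Wc: "W a \<in> carrier R" for a using W(1) by (simp add: P_def)
  define K where "K a = set_add R J (PIdl (W a))" for a
  have K: "ideal (K a) R" for a
    unfolding K_def using add_ideals[OF J cgenideal_ideal[OF Wc]] .
  have K_iff: "z \<in> K a \<longleftrightarrow> (\<exists>j\<in>J. \<exists>b\<in>carrier R. z = j \<oplus> b \<otimes> W a)" for z a
    unfolding K_def set_add_def' cgenideal_def by blast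
  have K_Suc: "K a \<subseteq> K (Suc a)" for a
  proof
    fix z assume "z \<in> K a"
    then obtain j b where z: "j \<in> J" "b \<in> carrier R" "z = j \<oplus> b \<otimes> W a" unfolding K_iff by blast
    let ?k = "W a \<ominus> x \<otimes> W (Suc a)"
    have "z = (j \<oplus> b \<otimes> ?k) \<oplus> (b \<otimes> x) \<otimes> W (Suc a)"
      unfolding z(3) using z(2) J.a_Hcarr[OF z(1)] Wc xc by algebra
    moreover have "j \<oplus> b \<otimes> ?k \<in> J" using z W(2) by (intro J.a_closed J.I_l_closed)
    ultimately show "z \<in> K (Suc a)" unfolding K_iff using z(2) xc m_closed by blast
  qed
  then have K_mono: "K a \<subseteq> K b" if "a \<le> b" for a b using that by (rule lift_Suc_mono_le)
  have "subset.chain {I. ideal I R} (range K)"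
  proof -
    have "K a \<subseteq> K b \<or> K b \<subseteq> K a" for a b using K_mono nle_le by metis
    then show ?thesis unfolding pred_on.chain_def using K by blast
  qed
  then have "\<Union>(range K) \<in> range K" by (rule ideal_chain_is_trivial[rotated]) simp
  then obtain a where a: "\<Union>(range K) = K a" by blast
  have "W (Suc a) \<in> K (Suc a)"
    unfolding K_iff using J.zero_closed Wc by (intro bexI[of _ \<zero>] bexI[of _ \<one>]) auto
  then have "W (Suc a) \<in> K a" using a by blast
  then obtain j b where jb: "j \<in> J" "b \<in> carrier R" "W (Suc a) = j \<oplus> b \<otimes> W a" unfolding K_iff by blast
  \<comment> \<open>Stabilization of the ideals \<open>K a\<close> expresses
    \<open>W (Suc a)\<close> through \<open>W a\<close>, which is
    \<open>x \<otimes> W (Suc a)\<close> modulo \<open>J\<close>. So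
    \<open>?u \<otimes> W (Suc a)\<close> lies in \<open>J\<close>, where \<open>?u\<close> is a
    unit; going back down the sequence, \<open>w\<close> itself lies in \<open>J\<close>.\<close>
  let ?u = "\<one> \<ominus> x \<otimes> b" and ?k = "W a \<ominus> x \<otimes> W (Suc a)"
  have "?u \<otimes> W (Suc a) = j \<oplus> b \<otimes> ?k"
  proof -
    have "?u \<otimes> W (Suc a) = W (Suc a) \<ominus> b \<otimes> (x \<otimes> W (Suc a))"
      using jb(2) xc Wc by algebra
    also have "\<dots> = (j \<oplus> b \<otimes> W a) \<ominus> b \<otimes> (x \<otimes> W (Suc a))" using jb(3) by simp
    also have "\<dots> = j \<oplus> b \<otimes> ?k" using J.a_Hcarr[OF jb(1)] jb(2) xc Wc by algebra
    finally show ?thesis .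
  qed
  also have "\<dots> \<in> J" using jb W(2) by (intro J.a_closed J.I_l_closed)
  finally have uW: "?u \<otimes> W (Suc a) \<in> J" .
  have u: "?u \<in> Units R" by (rule one_minus_Units[OF x jb(2)])
  have "W (Suc a) \<in> J" by (rule J.Units_mult_cancel[OF u Wc uW])
  moreover have "W a \<in> J" if "W (Suc a) \<in> J" for a
  proof -
    have "(W a \<ominus> x \<otimes> W (Suc a)) \<oplus> x \<otimes> W (Suc a) \<in> J"
      using W(2) J.I_l_closed[OF that xc] by (rule J.a_closed)
    moreover have "(W a \<ominus> x \<otimes> W (Suc a)) \<oplus> x \<otimes> W (Suc a) = W a" using Wc xc by algebra
    ultimately show ?thesis by simp
  qed
  ultimately have "W 0 \<in> J" using inc_induct[of 0 "Suc a" "\<lambda>a. W a \<in> J"] by blast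
  then show False using W(1)[of 0] w(2) by simp
qed

end

text \<open>Receives the images of \<open>nested_combs\<close> under ring homomorphisms: nonzero
  constants become units, and being a unit is all that is used of them.\<close>

fun ring_combs :: "('a, 'b) ring_scheme \<Rightarrow> 'a list \<Rightarrow> 'a set" where
  "ring_combs A [] = Units A"
| "ring_combs A (y # ys) =
    {y [^]\<^bsub>A\<^esub> (m::nat) \<otimes>\<^bsub>A\<^esub> (F \<oplus>\<^bsub>A\<^esub> y \<otimes>\<^bsub>A\<^esub> G) | m F G. F \<in> ring_combs A ys \<and> G \<in> carrier A}"

lemma (in cring) ring_combs_closed: "set ys \<subseteq> carrier R \<Longrightarrow> ring_combs R ys \<subseteq> carrier R"
proof (induction ys)
  case (Cons y ys)
  then have "ring_combs R ys \<subseteq> carrier R" "y \<in> carrier R" by simp_all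
  then show ?case by (auto intro!: m_closed a_closed nat_pow_closed)
qed (simp add: Units_closed subset_iff)

context noetherian_local
begin

text \<open>If a combination \<open>F\<close> kills \<open>w\<close> modulo the first elements of a regular sequence, then its
  lowest part in the next variable kills some \<open>v\<close> modulo one element more.\<close>

lemma ring_combs_not_kill:
  assumes reg: "regular_sequence R xs" and max: "set xs \<subseteq> (THE m. maximalideal m R)"
    and len: "length ys = length xs"
    and unit: "\<And>j. j < length xs \<Longrightarrow> \<exists>u\<in>Units R. ys ! j = u \<otimes> xs ! j"
    and j: "j \<le> length xs" and F: "F \<in> ring_combs R (drop j ys)"
    and w: "w \<in> carrier R" "w \<notin> Idl (set (take j xs))"
  shows "F \<otimes> w \<notin> Idl (set (take j xs))"
  using j F w
proof (induction j arbitrary: F w rule: inc_induct)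
  case base
  have xs: "set xs \<subseteq> carrier R" using reg by (simp add: regular_sequence_def)
  interpret J: ideal "Idl (set xs)" R by (rule genideal_ideal[OF xs])
  have F: "F \<in> Units R" using base.prems(1) len by simp
  show ?case
  proof
    assume "F \<otimes> w \<in> Idl (set (take (length xs) xs))"
    then have "F \<otimes> w \<in> Idl (set xs)" by simp
    then have "w \<in> Idl (set xs)" by (rule J.Units_mult_cancel[OF F base.prems(2)])
    then show False using base.prems(3) by simp
  qed
next
  case (step j)
  have xs: "set xs \<subseteq> carrier R" using reg by (simp add: regular_sequence_def)
  define x where "x = xs ! j"
  define y where "y = ys ! j"
  define J where "J = Idl (set (take j xs))"
  define J' where "J' = Idl (set (take (Suc j) xs))"
  have take: "set (take (Suc j) xs) = insert x (set (take j xs))"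
    using step.hyps(2) by (simp add: take_Suc_conv_app_nth x_def)
  have sub: "set (take j xs) \<subseteq> carrier R" "set (take (Suc j) xs) \<subseteq> carrier R"
    using xs by (meson set_take_subset subset_trans)+
  interpret J: ideal J R unfolding J_def by (rule genideal_ideal[OF sub(1)])
  interpret J': ideal J' R unfolding J'_def by (rule genideal_ideal[OF sub(2)])
  have xc: "x \<in> carrier R" using xs step.hyps(2) by (auto simp: x_def)
  have xm: "x \<in> (THE m. maximalideal m R)" using max step.hyps(2) by (auto simp: x_def)
  obtain u where u: "u \<in> Units R" "y = u \<otimes> x" using unit[OF step.hyps(2)] by (auto simp: x_def y_def)
  have uc: "u \<in> carrier R" using u(1) by (rule Units_closed)
  have yc: "y \<in> carrier R" using u(2) uc xc by simp
  have JJ': "J \<subseteq> J'"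
    unfolding J_def using genideal_self[OF sub(2)] take
    by (intro genideal_minimal[OF J'.is_ideal]) (auto simp: J'_def)
  have xJ': "x \<in> J'" using genideal_self[OF sub(2)] take by (auto simp: J'_def)
  have J'J: "J' \<subseteq> set_add R J (PIdl x)"
    unfolding J'_def
  proof (rule genideal_minimal[OF add_ideals[OF J.is_ideal cgenideal_ideal[OF xc]]])
    have "z \<in> set_add R J (PIdl x)" if "z = j \<oplus> b \<otimes> x" "j \<in> J" "b \<in> carrier R" for z j b
      using that unfolding set_add_def' cgenideal_def by blast
    from this[of x \<zero> \<one>] this[of _ _ \<zero>] show "set (take (Suc j) xs) \<subseteq> set_add R J (PIdl x)"
      unfolding take using J.zero_closed xc genideal_self[OF sub(1)] sub(1) by (auto simp: J_def)
  qed
  have regJ: "b \<in> J" if "b \<in> carrier R" "x \<otimes> b \<in> J" for b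
    using reg step.hyps(2) that unfolding regular_sequence_def x_def J_def by blast
  have regpow: "b \<in> J" if "b \<in> carrier R" "x [^] (a::nat) \<otimes> b \<in> J" for a b
    using that
  proof (induction a)
    case (Suc a)
    have pc: "x [^] a \<otimes> b \<in> carrier R" by (intro m_closed nat_pow_closed xc Suc.prems(1))
    have "x [^] Suc a \<otimes> b = x \<otimes> (x [^] a \<otimes> b)"
      unfolding nat_pow_Suc using xc Suc.prems(1) nat_pow_closed[OF xc, of a] by (simp only: m_ac m_closed)
    then have "x \<otimes> (x [^] a \<otimes> b) \<in> J" using Suc.prems(2) by (simp only:)
    then show ?case using Suc.IH[OF Suc.prems(1)] regJ[OF pc] by blast
  qed simp
  obtain a v where v: "v \<in> carrier R" "v \<notin> set_add R J (PIdl x)" "w \<ominus> x [^] (a::nat) \<otimes> v \<in> J"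
  proof -
    have "w \<notin> J" using step.prems(3) by (simp add: J_def)
    have "\<exists>(a::nat) v. v \<in> carrier R \<and> v \<notin> set_add R J (PIdl x) \<and> w \<ominus> x [^] a \<otimes> v \<in> J"
      by (rule power_factor[OF J.is_ideal xm _ step.prems(2) \<open>w \<notin> J\<close>]) (rule regJ)
    then show thesis using that by blast
  qed
  have drop: "drop j ys = y # drop (Suc j) ys"
    using step.hyps(2) len by (simp add: y_def Cons_nth_drop_Suc)
  obtain m F1 G where F: "F = y [^] (m::nat) \<otimes> (F1 \<oplus> y \<otimes> G)" "F1 \<in> ring_combs R (drop (Suc j) ys)" "G \<in> carrier R"
    using step.prems(1) unfolding drop by auto
  have "set ys \<subseteq> carrier R"
  proof
    fix z assume "z \<in> set ys"
    then obtain k where "k < length xs" "z = ys ! k" using len by (auto simp: in_set_conv_nth)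
    moreover from this obtain u where "u \<in> Units R" "ys ! k = u \<otimes> xs ! k" using unit by blast
    ultimately show "z \<in> carrier R"
      using xs nth_mem[of k xs] Units_closed[of u] by (simp add: subset_iff)
  qed
  then have F1: "F1 \<in> carrier R"
    using F(2) ring_combs_closed[of "drop (Suc j) ys"] set_drop_subset[of "Suc j" ys] by blast
  show ?case
  proof
    assume "F \<otimes> w \<in> Idl (set (take j xs))"
    then have Fw: "F \<otimes> w \<in> J" by (simp add: J_def)
    \<comment> \<open>Modulo \<open>J\<close>, \<open>w\<close> is
      \<open>x [^] a \<otimes> v\<close>, so \<open>F \<otimes> w\<close> becomes a unit times a
      power of \<open>x\<close> times \<open>?E\<close>. The power of \<open>x\<close> cancels
      modulo \<open>J\<close>, and the part of \<open>?E\<close> containing \<open>y\<close>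
      vanishes modulo \<open>J'\<close>; what remains is \<open>F1 \<otimes> v\<close>.\<close>
    let ?E = "(F1 \<oplus> y \<otimes> G) \<otimes> v"
    have Ec: "?E \<in> carrier R" using F1 yc F(3) v(1) by simp
    have Fc: "F \<in> carrier R" using F(1,3) F1 yc by simp
    have pa: "x [^] a \<in> carrier R" "y [^] m \<in> carrier R" "x [^] m \<in> carrier R" "u [^] m \<in> carrier R"
      using xc yc uc by auto
    have "F \<otimes> w \<ominus> F \<otimes> (w \<ominus> x [^] a \<otimes> v) \<in> J"
      using Fw J.I_l_closed[OF v(3) Fc] unfolding a_minus_def by (intro J.a_closed J.a_inv_closed)
    moreover have "F \<otimes> w \<ominus> F \<otimes> (w \<ominus> x [^] a \<otimes> v) = F \<otimes> (x [^] a \<otimes> v)"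
      using Fc step.prems(2) v(1) pa by algebra
    moreover have "F \<otimes> (x [^] a \<otimes> v) = u [^] m \<otimes> (x [^] (m + a) \<otimes> ?E)"
    proof -
      have "y [^] m = u [^] m \<otimes> x [^] m" unfolding u(2) using uc xc by (simp add: nat_pow_distrib)
      then show ?thesis
        unfolding F(1) nat_pow_mult[OF xc, symmetric] using pa F1 yc F(3) v(1) by (simp, algebra)
    qed
    ultimately have "u [^] m \<otimes> (x [^] (m + a) \<otimes> ?E) \<in> J" by simp
    moreover have "u [^] m \<in> Units R" using u(1) by (rule Units_pow_closed)
    moreover have "x [^] (m + a) \<otimes> ?E \<in> carrier R" by (intro m_closed nat_pow_closed xc Ec)
    ultimately have "x [^] (m + a) \<otimes> ?E \<in> J" using J.Units_mult_cancel by blast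
    then have "?E \<in> J'" using regpow[OF Ec] JJ' by blast
    moreover have "(u \<otimes> (G \<otimes> v)) \<otimes> x \<in> J'" using J'.I_l_closed[OF xJ'] uc F(3) v(1) by simp
    ultimately have "?E \<ominus> (u \<otimes> (G \<otimes> v)) \<otimes> x \<in> J'"
      unfolding a_minus_def by (intro J'.a_closed J'.a_inv_closed)
    moreover have "?E \<ominus> (u \<otimes> (G \<otimes> v)) \<otimes> x = F1 \<otimes> v"
      unfolding u(2) using uc F1 F(3) v(1) xc by algebra
    ultimately have "F1 \<otimes> v \<in> J'" by simp
    moreover have "v \<notin> J'" using v(2) J'J by blast
    ultimately show False using step.IH[OF F(2) v(1)] by (simp add: J'_def)
  qed
qed

end

section \<open>Localized quotients\<close>

text \<open>The properties of the canonical map from \<open>R\<close> to the localization of \<open>R / I\<close> at \<open>S\<close>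
  which determine it up to isomorphism.\<close>

locale localized_quotient = R: cring R + A: cring A
  for R (structure) and A (structure) and I S and h +
  assumes I: "ideal I R" and S: "S \<subseteq> carrier R" "\<one>\<^bsub>R\<^esub> \<in> S" "\<And>s t. s \<in> S \<Longrightarrow> t \<in> S \<Longrightarrow> s \<otimes>\<^bsub>R\<^esub> t \<in> S"
    and h: "h \<in> ring_hom R A"
    and h_unit: "\<And>s. s \<in> S \<Longrightarrow> h s \<in> Units A"
    and h_frac: "\<And>y. y \<in> carrier A \<Longrightarrow> \<exists>f\<in>carrier R. \<exists>s\<in>S. y \<otimes>\<^bsub>A\<^esub> h s = h f"
    and h_zero: "\<And>f. f \<in> carrier R \<Longrightarrow> h f = \<zero>\<^bsub>A\<^esub> \<longleftrightarrow> (\<exists>s\<in>S. s \<otimes>\<^bsub>R\<^esub> f \<in> I)"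
begin

lemma h_carrier: "f \<in> carrier R \<Longrightarrow> h f \<in> carrier A"
  using h by (rule ring_hom_closed)

lemma h_mult: "f \<in> carrier R \<Longrightarrow> g \<in> carrier R \<Longrightarrow> h (f \<otimes>\<^bsub>R\<^esub> g) = h f \<otimes>\<^bsub>A\<^esub> h g"
  using h by (rule ring_hom_mult)

lemma h_add: "f \<in> carrier R \<Longrightarrow> g \<in> carrier R \<Longrightarrow> h (f \<oplus>\<^bsub>R\<^esub> g) = h f \<oplus>\<^bsub>A\<^esub> h g"
  using h by (rule ring_hom_add)

lemma h_one: "h \<one>\<^bsub>R\<^esub> = \<one>\<^bsub>A\<^esub>"
  using h by (rule ring_hom_one)

lemma h_eq_imp:
  assumes "f \<in> carrier R" "g \<in> carrier R" "h f = h g"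
  shows "\<exists>s\<in>S. s \<otimes>\<^bsub>R\<^esub> (f \<ominus>\<^bsub>R\<^esub> g) \<in> I"
proof -
  have "h (f \<ominus>\<^bsub>R\<^esub> g) \<oplus>\<^bsub>A\<^esub> h g = h f"
    using assms(1,2) by (simp add: h_add[symmetric]) (simp add: R.minus_eq R.a_assoc R.l_neg)
  then have "h (f \<ominus>\<^bsub>R\<^esub> g) = \<zero>\<^bsub>A\<^esub>"
    using assms h_carrier by (metis A.add.l_cancel_one A.add.m_comm R.minus_closed)
  then show ?thesis using assms h_zero by simp
qed

definition extend :: "'a set \<Rightarrow> 'c set" where
  "extend P = {y \<in> carrier A. \<exists>f\<in>P. \<exists>s\<in>S. y \<otimes>\<^bsub>A\<^esub> h s = h f}"

text \<open>Membership may be tested on any one representation as a fraction: comparing two of them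
  costs factors from \<open>S\<close>, and these cancel modulo a prime disjoint from
  \<open>S\<close>.\<close>

lemma extend_iff:
  assumes P: "primeideal P R" "I \<subseteq> P" "P \<inter> S = {}"
    and y: "y \<in> carrier A" "f \<in> carrier R" "s \<in> S" "y \<otimes>\<^bsub>A\<^esub> h s = h f"
  shows "y \<in> extend P \<longleftrightarrow> f \<in> P"
proof
  interpret P: primeideal P R by fact
  assume "y \<in> extend P"
  then obtain g t where g: "g \<in> P" "t \<in> S" "y \<otimes>\<^bsub>A\<^esub> h t = h g" by (auto simp: extend_def)
  have c: "g \<in> carrier R" "s \<in> carrier R" "t \<in> carrier R" using g y S P.a_Hcarr by auto
  have hc: "h s \<in> carrier A" "h t \<in> carrier A" using c h_carrier by auto
  have "h (f \<otimes>\<^bsub>R\<^esub> t) = (y \<otimes>\<^bsub>A\<^esub> h s) \<otimes>\<^bsub>A\<^esub> h t" using c y by (simp add: h_mult)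
  also have "\<dots> = (y \<otimes>\<^bsub>A\<^esub> h t) \<otimes>\<^bsub>A\<^esub> h s" using y(1) hc by (simp add: A.m_ac)
  also have "\<dots> = h (g \<otimes>\<^bsub>R\<^esub> s)" using c g by (simp add: h_mult)
  finally obtain q where q: "q \<in> S" "q \<otimes>\<^bsub>R\<^esub> (f \<otimes>\<^bsub>R\<^esub> t \<ominus>\<^bsub>R\<^esub> g \<otimes>\<^bsub>R\<^esub> s) \<in> I"
    using h_eq_imp[of "f \<otimes>\<^bsub>R\<^esub> t" "g \<otimes>\<^bsub>R\<^esub> s"] c y(2) by auto
  have qc: "q \<in> carrier R" "q \<notin> P" using q(1) S(1) P(3) by auto
  let ?d = "f \<otimes>\<^bsub>R\<^esub> t \<ominus>\<^bsub>R\<^esub> g \<otimes>\<^bsub>R\<^esub> s"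
  have dc: "?d \<in> carrier R" using c y(2) by simp
  have "q \<otimes>\<^bsub>R\<^esub> ?d \<in> P" using q(2) P(2) by (rule subsetD[rotated])
  then have "?d \<in> P" using P.I_prime[OF qc(1) dc] qc(2) by simp
  moreover have "g \<otimes>\<^bsub>R\<^esub> s \<in> P" using P.I_r_closed g(1) c(2) by blast
  ultimately have "(f \<otimes>\<^bsub>R\<^esub> t \<ominus>\<^bsub>R\<^esub> g \<otimes>\<^bsub>R\<^esub> s) \<oplus>\<^bsub>R\<^esub> g \<otimes>\<^bsub>R\<^esub> s \<in> P" by (rule P.a_closed)
  moreover have "(f \<otimes>\<^bsub>R\<^esub> t \<ominus>\<^bsub>R\<^esub> g \<otimes>\<^bsub>R\<^esub> s) \<oplus>\<^bsub>R\<^esub> g \<otimes>\<^bsub>R\<^esub> s = f \<otimes>\<^bsub>R\<^esub> t"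
    using c y(2) by (simp add: R.minus_eq R.a_assoc R.l_neg)
  ultimately have "f \<otimes>\<^bsub>R\<^esub> t \<in> P" by simp
  then show "f \<in> P" using P.I_prime[OF y(2) c(3)] g(2) P(3) by blast
qed (use y in \<open>auto simp: extend_def\<close>)

lemma extend_h_iff:
  assumes P: "primeideal P R" "I \<subseteq> P" "P \<inter> S = {}" and f: "f \<in> carrier R"
  shows "h f \<in> extend P \<longleftrightarrow> f \<in> P"
  using extend_iff[OF P h_carrier[OF f] f S(2)] h_carrier[OF f] by (simp add: h_one)

lemma extend_prime:
  assumes P: "primeideal P R" "I \<subseteq> P" "P \<inter> S = {}"
  shows "primeideal (extend P) A"
proof -
  interpret P: primeideal P R by fact
  note iff = extend_iff[OF P]
  have frac: "\<exists>f s. f \<in> carrier R \<and> s \<in> S \<and> y \<otimes>\<^bsub>A\<^esub> h s = h f" if "y \<in> carrier A" for y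
    using h_frac[OF that] by blast
  have Sc: "s \<in> carrier R" "h s \<in> carrier A" if "s \<in> S" for s using that S(1) h_carrier by auto
  have mult: "(x \<otimes>\<^bsub>A\<^esub> y) \<otimes>\<^bsub>A\<^esub> h (s \<otimes>\<^bsub>R\<^esub> t) = h (f \<otimes>\<^bsub>R\<^esub> g)"
    if "x \<in> carrier A" "y \<in> carrier A" "f \<in> carrier R" "s \<in> S" "x \<otimes>\<^bsub>A\<^esub> h s = h f"
      "g \<in> carrier R" "t \<in> S" "y \<otimes>\<^bsub>A\<^esub> h t = h g" for x y f g s t
  proof -
    have "(x \<otimes>\<^bsub>A\<^esub> y) \<otimes>\<^bsub>A\<^esub> h (s \<otimes>\<^bsub>R\<^esub> t) = (x \<otimes>\<^bsub>A\<^esub> h s) \<otimes>\<^bsub>A\<^esub> (y \<otimes>\<^bsub>A\<^esub> h t)"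
      using that(1,2) Sc[OF that(4)] Sc[OF that(7)] by (simp add: h_mult A.m_ac)
    then show ?thesis using that by (simp add: h_mult)
  qed
  have l_closed: "x \<otimes>\<^bsub>A\<^esub> a \<in> extend P" if aP: "a \<in> extend P" and x: "x \<in> carrier A" for a x
  proof -
    have a: "a \<in> carrier A" using aP by (simp add: extend_def)
    obtain f s where f: "f \<in> carrier R" "s \<in> S" "a \<otimes>\<^bsub>A\<^esub> h s = h f" using frac[OF a] by blast
    obtain g t where g: "g \<in> carrier R" "t \<in> S" "x \<otimes>\<^bsub>A\<^esub> h t = h g" using frac[OF x] by blast
    have "f \<in> P" using aP iff[OF a f] by simp
    then have "g \<otimes>\<^bsub>R\<^esub> f \<in> P" using P.I_l_closed g(1) by blast
    then show ?thesis
      using iff[OF A.m_closed[OF x a] R.m_closed[OF g(1) f(1)] S(3)[OF g(2) f(2)] mult[OF x a g f]]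
      by blast
  qed
  show ?thesis
  proof (rule primeidealI[OF idealI A.is_cring])
    show "ring A" by (rule A.ring_axioms)
    show "subgroup (extend P) (add_monoid A)"
    proof (rule A.add.subgroupI)
      show "extend P \<subseteq> carrier A" by (auto simp: extend_def)
      have "h \<zero>\<^bsub>R\<^esub> \<in> extend P" using extend_h_iff[OF P] P.zero_closed by simp
      then show "extend P \<noteq> {}" by blast
    next
      fix a assume a: "a \<in> extend P"
      then have ac: "a \<in> carrier A" by (simp add: extend_def)
      then have "(\<ominus>\<^bsub>A\<^esub> \<one>\<^bsub>A\<^esub>) \<otimes>\<^bsub>A\<^esub> a = \<ominus>\<^bsub>A\<^esub> a" by (simp add: A.l_minus)
      then show "\<ominus>\<^bsub>A\<^esub> a \<in> extend P" using l_closed[OF a, of "\<ominus>\<^bsub>A\<^esub> \<one>\<^bsub>A\<^esub>"] by simp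
    next
      fix a b assume ab: "a \<in> extend P" "b \<in> extend P"
      then have c: "a \<in> carrier A" "b \<in> carrier A" by (auto simp: extend_def)
      obtain f s where f: "f \<in> carrier R" "s \<in> S" "a \<otimes>\<^bsub>A\<^esub> h s = h f" using frac[OF c(1)] by blast
      obtain g t where g: "g \<in> carrier R" "t \<in> S" "b \<otimes>\<^bsub>A\<^esub> h t = h g" using frac[OF c(2)] by blast
      have fg: "f \<in> P" "g \<in> P" using ab iff[OF c(1) f] iff[OF c(2) g] by auto
      have "f \<otimes>\<^bsub>R\<^esub> t \<oplus>\<^bsub>R\<^esub> g \<otimes>\<^bsub>R\<^esub> s \<in> P"
        using fg P.I_r_closed Sc(1) f(2) g(2) by (intro P.a_closed) auto
      moreover have "(a \<oplus>\<^bsub>A\<^esub> b) \<otimes>\<^bsub>A\<^esub> h (s \<otimes>\<^bsub>R\<^esub> t) = h (f \<otimes>\<^bsub>R\<^esub> t \<oplus>\<^bsub>R\<^esub> g \<otimes>\<^bsub>R\<^esub> s)"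
      proof -
        note fc = f(1) Sc[OF f(2)] g(1) Sc[OF g(2)]
        have "(a \<oplus>\<^bsub>A\<^esub> b) \<otimes>\<^bsub>A\<^esub> h (s \<otimes>\<^bsub>R\<^esub> t) =
            (a \<otimes>\<^bsub>A\<^esub> h s) \<otimes>\<^bsub>A\<^esub> h t \<oplus>\<^bsub>A\<^esub> (b \<otimes>\<^bsub>A\<^esub> h t) \<otimes>\<^bsub>A\<^esub> h s"
        proof -
          have "a \<otimes>\<^bsub>A\<^esub> (h s \<otimes>\<^bsub>A\<^esub> h t) = (a \<otimes>\<^bsub>A\<^esub> h s) \<otimes>\<^bsub>A\<^esub> h t"
            using c(1) fc(3,6) by (rule A.m_assoc[symmetric])
          moreover have "b \<otimes>\<^bsub>A\<^esub> (h s \<otimes>\<^bsub>A\<^esub> h t) = (b \<otimes>\<^bsub>A\<^esub> h t) \<otimes>\<^bsub>A\<^esub> h s"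
            unfolding A.m_comm[OF fc(3,6)] using c(2) fc(6,3) by (rule A.m_assoc[symmetric])
          moreover have "(a \<oplus>\<^bsub>A\<^esub> b) \<otimes>\<^bsub>A\<^esub> (h s \<otimes>\<^bsub>A\<^esub> h t) =
              a \<otimes>\<^bsub>A\<^esub> (h s \<otimes>\<^bsub>A\<^esub> h t) \<oplus>\<^bsub>A\<^esub> b \<otimes>\<^bsub>A\<^esub> (h s \<otimes>\<^bsub>A\<^esub> h t)"
            by (rule A.l_distr[OF c A.m_closed[OF fc(3,6)]])
          ultimately show ?thesis by (simp only: h_mult[OF fc(2,5)])
        qed
        also have "\<dots> = h (f \<otimes>\<^bsub>R\<^esub> t \<oplus>\<^bsub>R\<^esub> g \<otimes>\<^bsub>R\<^esub> s)"
          unfolding f(3) g(3) using fc by (simp add: h_mult h_add)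
        finally show ?thesis .
      qed
      moreover have "f \<otimes>\<^bsub>R\<^esub> t \<oplus>\<^bsub>R\<^esub> g \<otimes>\<^bsub>R\<^esub> s \<in> carrier R"
        using f(1) g(1) Sc(1)[OF f(2)] Sc(1)[OF g(2)] by simp
      ultimately show "a \<oplus>\<^bsub>A\<^esub> b \<in> extend P"
        using iff[OF A.a_closed[OF c] _ S(3)[OF f(2) g(2)]] by blast
    qed
    show "x \<otimes>\<^bsub>A\<^esub> a \<in> extend P" "a \<otimes>\<^bsub>A\<^esub> x \<in> extend P" if "a \<in> extend P" "x \<in> carrier A" for a x
      using l_closed[OF that] that A.m_comm[of a x] by (auto simp: extend_def)
    have "h \<one>\<^bsub>R\<^esub> \<notin> extend P" using extend_h_iff[OF P, of "\<one>\<^bsub>R\<^esub>"] S(2) P(3) by auto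
    then show "carrier A \<noteq> extend P" using h_carrier[of "\<one>\<^bsub>R\<^esub>"] by auto
  next
    fix a b assume c: "a \<in> carrier A" "b \<in> carrier A" and ab: "a \<otimes>\<^bsub>A\<^esub> b \<in> extend P"
    obtain f s where f: "f \<in> carrier R" "s \<in> S" "a \<otimes>\<^bsub>A\<^esub> h s = h f" using frac[OF c(1)] by blast
    obtain g t where g: "g \<in> carrier R" "t \<in> S" "b \<otimes>\<^bsub>A\<^esub> h t = h g" using frac[OF c(2)] by blast
    have "f \<otimes>\<^bsub>R\<^esub> g \<in> P"
      using ab iff[OF A.m_closed[OF c] R.m_closed[OF f(1) g(1)] S(3)[OF f(2) g(2)] mult[OF c f g]]
      by blast
    then show "a \<in> extend P \<or> b \<in> extend P"
      using P.I_prime[OF f(1) g(1)] iff[OF c(1) f] iff[OF c(2) g] by blast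
  qed
qed

text \<open>By \<open>extend_h_iff\<close> a prime is recovered from its extension, so strict
  inclusions survive in the localization.\<close>

lemma krull_dim_ge:
  fixes k :: nat
  assumes P: "\<And>j. j \<le> k \<Longrightarrow> primeideal (P j) R" "\<And>j. j \<le> k \<Longrightarrow> I \<subseteq> P j" "\<And>j. j \<le> k \<Longrightarrow> P j \<inter> S = {}"
    and chain: "\<And>j. j < k \<Longrightarrow> P j \<subset> P (Suc j)"
  shows "enat k \<le> krull_dim A"
proof -
  have "extend (P j) \<subset> extend (P (Suc j))" if jk: "j < k" for j
  proof -
    obtain f where f: "f \<in> P (Suc j)" "f \<notin> P j" using chain[OF jk] by blast
    have fc: "f \<in> carrier R"
      using f(1) P(1)[of "Suc j"] jk ideal.Icarr[of "P (Suc j)" R] by (auto simp: primeideal_def)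
    have "h f \<in> extend (P i) \<longleftrightarrow> f \<in> P i" if "i \<le> k" for i
      by (rule extend_h_iff[OF P(1)[OF that] P(2)[OF that] P(3)[OF that] fc])
    then have "h f \<in> extend (P (Suc j))" "h f \<notin> extend (P j)" using f jk by auto
    moreover have "extend (P j) \<subseteq> extend (P (Suc j))"
      using chain[OF jk] unfolding extend_def by blast
    ultimately show ?thesis by blast
  qed
  moreover have "primeideal (extend (P j)) A" if "j \<le> k" for j
    by (rule extend_prime[OF P(1)[OF that] P(2)[OF that] P(3)[OF that]])
  ultimately have "\<exists>Q. (\<forall>j\<le>k. primeideal (Q j) A) \<and> (\<forall>j<k. Q j \<subset> Q (Suc j))"
    by (intro exI[of _ "\<lambda>j. extend (P j)"]) simp
  then show ?thesis unfolding krull_dim_def by (intro SUP_upper) simp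
qed

end

text \<open>\<open>T\<close> is the complement of the image of \<open>M\<close> in the quotient.
  Since \<open>I\<close> is contained in \<open>M\<close>, a class lies in \<open>T\<close> exactly
  if its representatives lie outside \<open>M\<close>, so denominators from \<open>T\<close> and
  from \<open>carrier R - M\<close> correspond.\<close>

lemma localized_quotientI:
  fixes R (structure)
  assumes R: "cring R" and I: "ideal I R" and M: "primeideal M R" "I \<subseteq> M"
  defines "B \<equiv> R Quot I"
  defines "T \<equiv> carrier B - (\<lambda>f. I +> f) ` M"
  shows "localized_quotient R (localization B T) I (carrier R - M) (\<lambda>f. loc_frac B T (I +> f) (I +> \<one>))"
proof -
  interpret R: cring R by fact
  interpret I: ideal I R by fact
  interpret M: primeideal M R by fact
  interpret B: cring B unfolding B_def by (rule I.quotient_is_cring[OF R])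
  let ?q = "\<lambda>f. I +> f"
  have q: "?q \<in> ring_hom R B" unfolding B_def by (rule I.rcos_ring_hom)
  note q_mult = ring_hom_mult[OF q] and q_add = ring_hom_add[OF q] and q_one = ring_hom_one[OF q]
    and q_closed = ring_hom_closed[OF q]
  have B_ex: "\<exists>f\<in>carrier R. X = ?q f" if "X \<in> carrier B" for X
    using that unfolding B_def FactRing_def A_RCOSETS_defs a_r_coset_def by auto
  have B_zero: "\<zero>\<^bsub>B\<^esub> = I" by (simp add: B_def FactRing_def)
  have q_eq: "?q f = ?q g \<longleftrightarrow> f \<ominus> g \<in> I" if "f \<in> carrier R" "g \<in> carrier R" for f g
    using R.quotient_eq_iff_same_a_r_cos[OF I that] by simp
  have q_zero: "?q f = I \<longleftrightarrow> f \<in> I" if "f \<in> carrier R" for f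
    using that I.rcos_const_imp_mem I.a_rcos_const by blast
  have T_iff: "?q f \<in> T \<longleftrightarrow> f \<notin> M" if f: "f \<in> carrier R" for f
  proof -
    have "f \<in> M" if "?q f = ?q g" "g \<in> M" for g
    proof -
      have g: "g \<in> carrier R" using that(2) M.a_Hcarr by blast
      have "f \<ominus> g \<in> M" using q_eq[OF f g] that(1) M(2) by blast
      then have "(f \<ominus> g) \<oplus> g \<in> M" using that(2) by (rule M.a_closed)
      then show ?thesis using f g by (simp add: R.minus_eq R.a_assoc R.l_neg)
    qed
    then show ?thesis using q_closed[OF f] by (auto simp: T_def)
  qed
  have one: "\<one> \<notin> M" using M.one_imp_carrier M.I_notcarr by blast
  have T: "T \<subseteq> carrier B" "\<one>\<^bsub>B\<^esub> \<in> T" "\<And>s t. s \<in> T \<Longrightarrow> t \<in> T \<Longrightarrow> s \<otimes>\<^bsub>B\<^esub> t \<in> T"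
  proof -
    show "T \<subseteq> carrier B" by (auto simp: T_def)
    show "\<one>\<^bsub>B\<^esub> \<in> T" unfolding q_one[symmetric] using T_iff[of \<one>] one by simp
    fix s t assume st: "s \<in> T" "t \<in> T"
    then obtain f g where fg: "f \<in> carrier R" "g \<in> carrier R" "s = ?q f" "t = ?q g"
      using B_ex[of s] B_ex[of t] unfolding T_def by blast
    have "f \<otimes> g \<notin> M" using M.I_prime[OF fg(1,2)] st fg T_iff by blast
    then show "s \<otimes>\<^bsub>B\<^esub> t \<in> T" using fg T_iff[of "f \<otimes> g"] by (simp add: q_mult)
  qed
  let ?L = "localization B T" and ?h = "\<lambda>f. loc_frac B T (?q f) (?q \<one>)"
  have L: "cring ?L" by (rule B.localization_cring[OF T])
  interpret L: cring ?L by (rule L)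
  note L_mult = B.localization_mult[OF T] and L_add = B.localization_add[OF T]
  have L_one: "\<one>\<^bsub>?L\<^esub> = loc_frac B T \<one>\<^bsub>B\<^esub> \<one>\<^bsub>B\<^esub>" and L_zero: "\<zero>\<^bsub>?L\<^esub> = loc_frac B T \<zero>\<^bsub>B\<^esub> \<one>\<^bsub>B\<^esub>"
    by (auto simp: localization_def)
  have L_closed: "loc_frac B T x t \<in> carrier ?L" if "x \<in> carrier B" "t \<in> T" for x t
    using B.localization_carrier[OF T] that by auto
  have Tc: "t \<in> carrier B" if "t \<in> T" for t using that T(1) by blast
  show ?thesis
  proof (intro localized_quotient.intro localized_quotient_axioms.intro R L I)
    show "carrier R - M \<subseteq> carrier R" "\<one> \<in> carrier R - M" using one by auto
    show "s \<otimes> t \<in> carrier R - M" if "s \<in> carrier R - M" "t \<in> carrier R - M" for s t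
      using that M.I_prime[of s t] by blast
    show "?h \<in> ring_hom R ?L"
      using T(2) q_closed
      by (intro ring_hom_memI) (simp_all add: q_one q_mult q_add L_closed L_mult L_add L_one)
    show "?h s \<in> Units ?L" if "s \<in> carrier R - M" for s
    proof -
      have s: "?q s \<in> carrier B" "?q s \<in> T" using that T_iff q_closed by auto
      have "?h s \<otimes>\<^bsub>?L\<^esub> loc_frac B T \<one>\<^bsub>B\<^esub> (?q s) = \<one>\<^bsub>?L\<^esub>"
        unfolding q_one L_one using s T(2) by (simp add: L_mult) (intro B.loc_frac_eqI[OF T]; simp)
      then show ?thesis
        using L_closed[OF s(1) T(2)] L_closed[OF B.one_closed s(2)] L.m_comm
        unfolding q_one Units_def by blast
    qed
    show "\<exists>f\<in>carrier R. \<exists>s\<in>carrier R - M. y \<otimes>\<^bsub>?L\<^esub> ?h s = ?h f" if yL: "y \<in> carrier ?L" for y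
    proof -
      obtain x t where xt: "x \<in> carrier B" "t \<in> T" "y = loc_frac B T x t"
        using yL B.localization_carrier[OF T] by auto
      obtain f where f: "f \<in> carrier R" "x = ?q f" using B_ex[OF xt(1)] by blast
      obtain s where s: "s \<in> carrier R" "t = ?q s" using B_ex[OF Tc[OF xt(2)]] by blast
      have "s \<notin> M" using T_iff[OF s(1)] xt(2) s(2) by simp
      moreover have "y \<otimes>\<^bsub>?L\<^esub> ?h s = ?h f"
        unfolding xt(3) q_one f(2)[symmetric] s(2)[symmetric] using xt(1,2) T(2) Tc[OF xt(2)]
        by (simp add: L_mult) (intro B.loc_frac_eqI[OF T]; simp)
      ultimately show ?thesis using f(1) s(1) by blast
    qed
    show "?h f = \<zero>\<^bsub>?L\<^esub> \<longleftrightarrow> (\<exists>s\<in>carrier R - M. s \<otimes> f \<in> I)" if f: "f \<in> carrier R" for f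
    proof -
      have "?h f = \<zero>\<^bsub>?L\<^esub> \<longleftrightarrow> (\<exists>t\<in>T. t \<otimes>\<^bsub>B\<^esub> ?q f = \<zero>\<^bsub>B\<^esub>)"
        unfolding q_one L_zero using q_closed[OF f] T(2) Tc
        by (subst B.loc_frac_eq_iff[OF T]) auto
      also have "\<dots> \<longleftrightarrow> (\<exists>s\<in>carrier R - M. ?q s \<otimes>\<^bsub>B\<^esub> ?q f = \<zero>\<^bsub>B\<^esub>)"
      proof
        assume "\<exists>t\<in>T. t \<otimes>\<^bsub>B\<^esub> ?q f = \<zero>\<^bsub>B\<^esub>"
        then obtain t where t: "t \<in> T" "t \<otimes>\<^bsub>B\<^esub> ?q f = \<zero>\<^bsub>B\<^esub>" by blast
        then obtain s where "s \<in> carrier R" "t = ?q s" using B_ex Tc by blast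
        then show "\<exists>s\<in>carrier R - M. ?q s \<otimes>\<^bsub>B\<^esub> ?q f = \<zero>\<^bsub>B\<^esub>" using t T_iff by blast
      qed (use T_iff in blast)
      also have "\<dots> \<longleftrightarrow> (\<exists>s\<in>carrier R - M. s \<otimes> f \<in> I)"
        using f by (intro bex_cong refl) (simp add: q_mult[symmetric] B_zero q_zero)
      finally show ?thesis .
    qed
  qed
qed

section \<open>Ideals generated by variables\<close>

text \<open>The ideal generated by the variables in \<open>V\<close>, described through monomials so
  that membership needs no generators; with all variables it is the maximal ideal of the
  origin.\<close>

definition var_ideal :: "nat \<Rightarrow> nat \<Rightarrow> (nat \<times> nat) set \<Rightarrow> ('k::field) poly_xs set" where
  "var_ideal c n V = {f. \<forall>m\<in>Poly_Mapping.keys f. m \<in> mons c n \<and> Poly_Mapping.keys m \<inter> V \<noteq> {}}"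

lemma var_ideal_monomial: "monomial_ideal c n (var_ideal c n V :: ('k::field) poly_xs set)"
proof (rule monomial_idealI(1))
  show "{m \<in> mons c n. Poly_Mapping.keys m \<inter> V \<noteq> {}} \<subseteq> mons c n" by blast
  show "v \<in> {m \<in> mons c n. Poly_Mapping.keys m \<inter> V \<noteq> {}}"
    if "u \<in> {m \<in> mons c n. Poly_Mapping.keys m \<inter> V \<noteq> {}}" "mon_dvd u v" "v \<in> mons c n" for u v
    using that mon_dvd_keys by blast
  show "f \<in> var_ideal c n V \<longleftrightarrow> Poly_Mapping.keys f \<subseteq> {m \<in> mons c n. Poly_Mapping.keys m \<inter> V \<noteq> {}}"
    for f :: "'k poly_xs"
    by (auto simp: var_ideal_def)
qed

lemma var_ideal_mult:
  assumes "f \<in> var_ideal c n V" "g \<in> carrier (polyR c n)"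
  shows "f * g \<in> var_ideal c n V"
  unfolding var_ideal_def
proof (clarify, intro conjI)
  fix m assume "m \<in> Poly_Mapping.keys (f * g)"
  then obtain a b where ab: "m = a + b" "a \<in> Poly_Mapping.keys f" "b \<in> Poly_Mapping.keys g"
    using keys_mult[of f g] by blast
  have "a \<in> mons c n" "Poly_Mapping.keys a \<inter> V \<noteq> {}" "b \<in> mons c n"
    using assms ab by (auto simp: var_ideal_def carrier_polyR)
  then show "m \<in> mons c n" "Poly_Mapping.keys m \<inter> V \<noteq> {}"
    unfolding ab(1) by (auto simp: mons_add_iff keys_plus_mon)
qed

lemma var_ideal_diff:
  assumes "f \<in> var_ideal c n V" "g \<in> var_ideal c n V"
  shows "f - g \<in> var_ideal c n V"
proof -
  have "m \<in> Poly_Mapping.keys f \<or> m \<in> Poly_Mapping.keys g" if "m \<in> Poly_Mapping.keys (f - g)" for m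
    using that keys_diff[of f g] by blast
  then show ?thesis using assms unfolding var_ideal_def mem_Collect_eq by blast
qed

text \<open>Modulo the ideal, polynomials are represented by their parts free of the variables in \<open>V\<close>.\<close>

lemma var_ideal_prime: "primeideal (var_ideal c n V) (polyR c n :: ('k::field) poly_xs ring)"
proof (rule primeidealI)
  show "ideal (var_ideal c n V) (polyR c n :: 'k poly_xs ring)"
    using var_ideal_monomial by (rule monomial_ideal_ideal)
  show "cring (polyR c n :: 'k poly_xs ring)" by (rule polyR_cring)
  have "(1 :: 'k poly_xs) \<in> carrier (polyR c n)" "(1 :: 'k poly_xs) \<notin> var_ideal c n V"
    by (auto simp: carrier_polyR zero_mons var_ideal_def)
  then show "carrier (polyR c n) \<noteq> (var_ideal c n V :: 'k poly_xs set)" by blast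
  fix f g :: "'k poly_xs"
  assume f: "f \<in> carrier (polyR c n)" and g: "g \<in> carrier (polyR c n)"
    and "f \<otimes>\<^bsub>polyR c n\<^esub> g \<in> var_ideal c n V"
  then have fg: "f * g \<in> var_ideal c n V" by simp
  define part where "part h = (\<Sum>m\<in>{m \<in> Poly_Mapping.keys h. Poly_Mapping.keys m \<inter> V = {}}.
      Poly_Mapping.single m (Poly_Mapping.lookup h m))" for h :: "'k poly_xs"
  have look: "Poly_Mapping.lookup (part h) m =
      (if Poly_Mapping.keys m \<inter> V = {} then Poly_Mapping.lookup h m else 0)" for h m
    unfolding part_def by (auto simp: lookup_sum lookup_single when_def in_keys_iff)
  have keys_part: "m \<in> Poly_Mapping.keys (part h) \<longleftrightarrow> m \<in> Poly_Mapping.keys h \<and> Poly_Mapping.keys m \<inter> V = {}" for h m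
    by (simp add: in_keys_iff look)
  have part_c: "part h \<in> carrier (polyR c n)" if "h \<in> carrier (polyR c n)" for h
    using that keys_part by (auto simp: carrier_polyR)
  have rest: "h - part h \<in> var_ideal c n V" if "h \<in> carrier (polyR c n)" for h
  proof -
    have "m \<in> Poly_Mapping.keys h \<and> Poly_Mapping.keys m \<inter> V \<noteq> {}" if "m \<in> Poly_Mapping.keys (h - part h)" for m
      using that by (auto simp: in_keys_iff lookup_minus look split: if_splits)
    then show ?thesis using that unfolding var_ideal_def carrier_polyR by blast
  qed
  have "f * g - (f - part f) * g - (g - part g) * part f \<in> var_ideal c n V"
    by (rule var_ideal_diff[OF var_ideal_diff[OF fg var_ideal_mult[OF rest[OF f] g]]
          var_ideal_mult[OF rest[OF g] part_c[OF f]]])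
  moreover have "f * g - (f - part f) * g - (g - part g) * part f = part f * part g"
    by (simp add: algebra_simps)
  ultimately have pp: "part f * part g \<in> var_ideal c n V" by simp
  have "part f * part g = 0"
  proof (rule ccontr)
    assume "part f * part g \<noteq> 0"
    then obtain m where m: "m \<in> Poly_Mapping.keys (part f * part g)" by (metis keys_eq_empty ex_in_conv)
    then obtain a b where "m = a + b" "a \<in> Poly_Mapping.keys (part f)" "b \<in> Poly_Mapping.keys (part g)"
      using keys_mult[of "part f" "part g"] by blast
    then have "Poly_Mapping.keys m \<inter> V = {}" using keys_part by (simp add: keys_plus_mon Int_Un_distrib2)
    then show False using pp m by (auto simp: var_ideal_def)
  qed
  \<comment> \<open>The absence of zero divisors rests on a linear order of the monomials, which
    comes from the lexicographic order on index pairs.\<close>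
  then have "part f = 0 \<or> part g = 0" by (rule mult_eq_0_iff[THEN iffD1])
  then show "f \<in> var_ideal c n V \<or> g \<in> var_ideal c n V"
    using rest[OF f] rest[OF g] by auto
qed

lemma var_ideal_supset_iff:
  assumes "monomial_ideal c n (J :: ('k::field) poly_xs set)"
  shows "J \<subseteq> var_ideal c n V \<longleftrightarrow> (\<forall>u\<in>mon_set J. Poly_Mapping.keys u \<inter> V \<noteq> {})"
proof
  assume "J \<subseteq> var_ideal c n V"
  then show "\<forall>u\<in>mon_set J. Poly_Mapping.keys u \<inter> V \<noteq> {}"
    unfolding mon_set_def var_ideal_def by fastforce
next
  assume "\<forall>u\<in>mon_set J. Poly_Mapping.keys u \<inter> V \<noteq> {}"
  then show "J \<subseteq> var_ideal c n V"
    using monomial_ideal_iff[OF assms] mon_set_subset[OF assms] unfolding var_ideal_def by blast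
qed

lemma all_vars_iff: "m \<in> mons c n \<Longrightarrow> Poly_Mapping.keys m \<inter> ({1..c} \<times> {1..n}) \<noteq> {} \<longleftrightarrow> m \<noteq> 0"
  unfolding mons_def by (auto simp: Int_absorb2)

lemma const_poly_mult: "const_poly a * const_poly b = (const_poly (a * b) :: ('k::field) poly_xs)"
  by (simp add: const_poly_def mult_single)

lemma const_poly_one: "const_poly 1 = (1 :: ('k::field) poly_xs)"
  by (simp add: const_poly_def)

text \<open>Modulo \<open>M\<close> a polynomial is its constant term, and nonzero constants are
  units. The statement concerns the quotient because the Cohen-Macaulay property is tested at
  maximal ideals of that ring.\<close>

lemma maximalideal_vars_Quot:
  fixes c n :: nat and J :: "('k::field) poly_xs set"
  defines "M \<equiv> var_ideal c n ({1..c} \<times> {1..n})"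
  assumes J: "ideal J (polyR c n)" "J \<subseteq> M"
  shows "maximalideal ((\<lambda>f. J +>\<^bsub>polyR c n\<^esub> f) ` M) (polyR c n Quot J)"
proof -
  let ?R = "polyR c n :: 'k poly_xs ring" and ?B = "polyR c n Quot J"
  let ?q = "\<lambda>f. J +>\<^bsub>polyR c n\<^esub> f"
  interpret R: cring ?R by (rule polyR_cring)
  interpret I: ideal J ?R by fact
  interpret M: primeideal M ?R unfolding M_def by (rule var_ideal_prime)
  interpret B: cring ?B by (rule I.quotient_is_cring[OF polyR_cring])
  have q: "?q \<in> ring_hom ?R ?B" by (rule I.rcos_ring_hom)
  have B_ex: "\<exists>f\<in>carrier ?R. X = ?q f" if "X \<in> carrier ?B" for X
    using that unfolding FactRing_def A_RCOSETS_defs a_r_coset_def by auto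
  have one: "\<one>\<^bsub>?R\<^esub> \<notin> M" using M.one_imp_carrier M.I_notcarr by blast
  show ?thesis
  proof (rule maximalidealI)
    show "ideal (?q ` M) ?B" by (rule R.ring_ideal_imp_quot_ideal[OF J(1) M.is_ideal])
    show "carrier ?B \<noteq> ?q ` M"
    proof
      assume "carrier ?B = ?q ` M"
      then have "?q \<one>\<^bsub>?R\<^esub> \<in> ?q ` M" using ring_hom_closed[OF q R.one_closed] by simp
      then obtain m where m: "m \<in> M" "?q \<one>\<^bsub>?R\<^esub> = ?q m" by blast
      have mc: "m \<in> carrier ?R" using m(1) M.a_Hcarr by blast
      have "\<one>\<^bsub>?R\<^esub> \<ominus>\<^bsub>?R\<^esub> m \<in> M"
        using R.quotient_eq_iff_same_a_r_cos[OF J(1) R.one_closed mc] m(2) J(2) by blast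
      then have "(\<one>\<^bsub>?R\<^esub> \<ominus>\<^bsub>?R\<^esub> m) \<oplus>\<^bsub>?R\<^esub> m \<in> M" using m(1) by (rule M.a_closed)
      moreover have "(\<one>\<^bsub>?R\<^esub> \<ominus>\<^bsub>?R\<^esub> m) \<oplus>\<^bsub>?R\<^esub> m = \<one>\<^bsub>?R\<^esub>" using mc by algebra
      ultimately show False using one by metis
    qed
    fix K assume K: "ideal K ?B" "?q ` M \<subseteq> K" "K \<subseteq> carrier ?B"
    interpret K: ideal K ?B by fact
    show "K = ?q ` M \<or> K = carrier ?B"
    proof (rule disjCI)
      assume "K \<noteq> carrier ?B"
      have "K \<subseteq> ?q ` M"
      proof (rule ccontr)
        assume "\<not> K \<subseteq> ?q ` M"
        then obtain X where X: "X \<in> K" "X \<notin> ?q ` M" by blast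
        then obtain f where f: "f \<in> carrier ?R" "X = ?q f" using B_ex K(3) by blast
        define a where "a = Poly_Mapping.lookup f 0"
        \<comment> \<open>\<open>g\<close> cancels everything in \<open>f\<close> but the constant
          term, and it lies in \<open>M\<close>; so the class of the constant \<open>a\<close> lies
          in \<open>K\<close>.\<close>
        define g where "g = const_poly a - f"
        have gk: "m \<in> Poly_Mapping.keys f \<and> m \<noteq> 0" if "m \<in> Poly_Mapping.keys g" for m
          using that by (auto simp: g_def in_keys_iff lookup_minus const_poly_def lookup_single when_def a_def split: if_splits)
        have gM: "g \<in> M"
          using gk f(1) unfolding M_def var_ideal_def carrier_polyR mem_Collect_eq
          by (metis all_vars_iff subsetD)
        have "a \<noteq> 0"
        proof
          assume "a = 0"
          then have "m \<noteq> 0" if "m \<in> Poly_Mapping.keys f" for m using that by (auto simp: a_def in_keys_iff)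
          then have "f \<in> M" using f(1) unfolding M_def var_ideal_def carrier_polyR mem_Collect_eq
            by (metis all_vars_iff subsetD)
          then show False using X(2) f(2) by blast
        qed
        have "?q f \<oplus>\<^bsub>?B\<^esub> ?q g \<in> K" using X(1) f(2) gM K(2) by (intro K.a_closed) auto
        then have "?q (f \<oplus>\<^bsub>?R\<^esub> g) \<in> K" using ring_hom_add[OF q f(1)] gM M.a_Hcarr by auto
        then have ca: "?q (const_poly a) \<in> K" by (simp add: g_def)
        have "?q (const_poly (inverse a)) \<otimes>\<^bsub>?B\<^esub> ?q (const_poly a) \<in> K"
          by (intro K.I_l_closed[OF ca] ring_hom_closed[OF q] const_poly_carrier)
        then have "?q (const_poly (inverse a) \<otimes>\<^bsub>?R\<^esub> const_poly a) \<in> K"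
          using ring_hom_mult[OF q, of "const_poly (inverse a)" "const_poly a"] const_poly_carrier by metis
        then have "?q \<one>\<^bsub>?R\<^esub> \<in> K" using \<open>a \<noteq> 0\<close> by (simp add: const_poly_mult const_poly_one)
        then have "\<one>\<^bsub>?B\<^esub> \<in> K" by (simp only: ring_hom_one[OF q])
        then show False using K.one_imp_carrier \<open>K \<noteq> carrier ?B\<close> by blast
      qed
      then show "K = ?q ` M" using K(2) by blast
    qed
  qed
qed

section \<open>Depth and dimension\<close>

lemma nested_combs_hom:
  fixes A (structure)
  assumes h: "h \<in> ring_hom (polyR c n :: ('k::field) poly_xs ring) A" and A: "cring A"
    and fs: "set fs \<subseteq> carrier (polyR c n)" and g: "g \<in> nested_combs c n fs"
  shows "g \<in> carrier (polyR c n) \<and> h g \<in> ring_combs A (map h fs)"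
  using fs g
proof (induction fs arbitrary: g)
  case Nil
  interpret A: cring A by fact
  obtain a where a: "g = const_poly a" "a \<noteq> 0" using Nil by auto
  have "h (const_poly a) \<otimes> h (const_poly (inverse a)) = h (\<one>\<^bsub>polyR c n\<^esub>)"
    using ring_hom_mult[OF h const_poly_carrier const_poly_carrier, of a "inverse a"] a(2)
    by (simp add: const_poly_mult const_poly_one)
  then have "h (const_poly a) \<otimes> h (const_poly (inverse a)) = \<one>" by (simp only: ring_hom_one[OF h])
  moreover have hc: "h (const_poly b) \<in> carrier A" for b
    by (intro ring_hom_closed[OF h] const_poly_carrier)
  ultimately have "h (const_poly (inverse a)) \<otimes> h (const_poly a) = \<one>"
    "h (const_poly a) \<otimes> h (const_poly (inverse a)) = \<one>" by (simp_all only: A.m_comm)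
  then have "h g \<in> Units A" using hc unfolding a(1) Units_def by blast
  then show ?case by (simp add: a(1) const_poly_carrier)
next
  case (Cons f fs)
  interpret A: cring A by fact
  interpret R: cring "polyR c n :: 'k poly_xs ring" by (rule polyR_cring)
  obtain m F G where g: "g = f ^ m * (F + f * G)" "F \<in> nested_combs c n fs" "G \<in> carrier (polyR c n)"
    using Cons.prems(2) by auto
  have f: "f \<in> carrier (polyR c n)" using Cons.prems(1) by simp
  have F: "F \<in> carrier (polyR c n)" "h F \<in> ring_combs A (map h fs)"
    using Cons.IH[OF _ g(2)] Cons.prems(1) by auto
  have pow: "h (f ^ m) = h f [^] m" for m
  proof (induction m)
    case 0
    show ?case using ring_hom_one[OF h] by simp
  next
    case (Suc m)
    have "h (f ^ m * f) = h (f ^ m) \<otimes> h f"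
      using ring_hom_mult[OF h polyR_power_closed[OF f] f] by simp
    then show ?case using Suc by (simp add: mult.commute)
  qed
  have fG: "f * G \<in> carrier (polyR c n)" using polyR_mult_closed[OF f g(3)] .
  have sum: "F + f * G \<in> carrier (polyR c n)" using R.a_closed[OF F(1) fG] by simp
  have "h g = h (f ^ m) \<otimes> h (F + f * G)"
    unfolding g(1) using ring_hom_mult[OF h polyR_power_closed[OF f] sum] by simp
  also have "h (F + f * G) = h F \<oplus> h f \<otimes> h G"
    using ring_hom_add[OF h F(1) fG] ring_hom_mult[OF h f g(3)] by simp
  finally have "h g = h f [^] m \<otimes> (h F \<oplus> h f \<otimes> h G)" by (simp only: pow)
  moreover have "g \<in> carrier (polyR c n)"
    unfolding g(1) by (intro polyR_mult_closed polyR_power_closed f sum)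
  ultimately show ?case using F(2) ring_hom_closed[OF h g(3)] by auto
qed

text \<open>If the sequence were longer than \<open>card F\<close>, its numerators would admit a
  nested combination all of whose monomials involve a variable outside \<open>F\<close>, and which
  therefore kills \<open>w\<close> modulo \<open>J\<close>. For a regular sequence this is
  impossible, and clearing denominators changes its elements only by units.\<close>

lemma regular_sequence_length_le:
  fixes c n :: nat and A (structure) and J :: "('k::field) poly_xs set"
  defines "X \<equiv> {1..c} \<times> {1..n}"
  assumes loc: "localized_quotient (polyR c n) A J (carrier (polyR c n) - var_ideal c n X) h"
    and A: "noetherian_local A" and J: "monomial_ideal c n J"
    and w: "w \<in> mons c n" "F \<subseteq> X"
    and colon: "\<And>u. u \<in> mons c n \<Longrightarrow> w + u \<in> mon_set J \<longleftrightarrow> \<not> Poly_Mapping.keys u \<subseteq> F"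
    and xs: "regular_sequence A xs" "set xs \<subseteq> (THE m. maximalideal m A)"
  shows "length xs \<le> card F"
proof (rule ccontr)
  let ?R = "polyR c n :: 'k poly_xs ring"
  let ?S = "carrier ?R - var_ideal c n X"
  interpret A: noetherian_local A by (rule A)
  interpret L: localized_quotient ?R A J ?S h by (rule loc)
  have finF: "finite F" using w(2) finite_subset by (auto simp: X_def)
  assume "\<not> length xs \<le> card F"
  then have long: "card F < length xs" by simp
  have xsc: "set xs \<subseteq> carrier A" using xs(1) by (simp add: regular_sequence_def)
  have "\<forall>x\<in>set xs. \<exists>f s. f \<in> carrier ?R \<and> s \<in> ?S \<and> x \<otimes> h s = h f"
    using L.h_frac xsc by (meson subsetD)
  then obtain \<phi> \<sigma> where \<phi>: "\<And>x. x \<in> set xs \<Longrightarrow> \<phi> x \<in> carrier ?R \<and> \<sigma> x \<in> ?S \<and> x \<otimes> h (\<sigma> x) = h (\<phi> x)"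
    by metis
  define fs where "fs = map \<phi> xs"
  have fs: "set fs \<subseteq> carrier ?R" using \<phi> by (auto simp: fs_def)
  obtain g where g: "g \<in> nested_combs c n fs" "g \<in> carrier ?R"
    "\<And>m. m \<in> Poly_Mapping.keys g \<Longrightarrow> \<not> Poly_Mapping.keys m \<subseteq> F"
    using ex_nested_comb_vanishing[OF fs finF] long by (auto simp: fs_def)
  have hg: "h g \<in> ring_combs A (map h fs)"
    using nested_combs_hom[OF L.h A.is_cring fs g(1)] by blast
  have wc: "monom_poly w \<in> carrier ?R" using w(1) by (simp add: monom_poly_carrier)
  \<comment> \<open>A denominator \<open>s\<close> lies outside the ideal of the origin, so it has a
    constant term and \<open>w\<close> survives as a monomial of \<open>s * monom_poly w\<close>;
    but \<open>colon\<close> at 0 says that \<open>w\<close> is not in \<open>J\<close>.\<close>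
  have hw: "h (monom_poly w) \<noteq> \<zero>"
  proof
    assume "h (monom_poly w) = \<zero>"
    then obtain s where s: "s \<in> ?S" "s * monom_poly w \<in> J" using L.h_zero[OF wc] by auto
    then obtain m where m: "m \<in> Poly_Mapping.keys s" "m \<in> mons c n" "Poly_Mapping.keys m \<inter> X = {}"
      by (auto simp: var_ideal_def carrier_polyR)
    then have "m = 0" using all_vars_iff[OF m(2)] by (auto simp: X_def)
    then have "w \<in> Poly_Mapping.keys (s * monom_poly w)" using m(1) by (force simp: keys_mult_monom)
    then have "w + 0 \<in> mon_set J" using s(2) monomial_ideal_iff[OF J] by auto
    then show False using colon[of 0] by (simp add: zero_mons)
  qed
  have hgw: "h g \<otimes> h (monom_poly w) = \<zero>"
  proof -
    have "Poly_Mapping.keys (g * monom_poly w) \<subseteq> mon_set J"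
    proof
      fix m assume "m \<in> Poly_Mapping.keys (g * monom_poly w)"
      then obtain u where u: "m = u + w" "u \<in> Poly_Mapping.keys g" by (auto simp: keys_mult_monom)
      have "u \<in> mons c n" using u(2) g(2) by (auto simp: carrier_polyR)
      then show "m \<in> mon_set J" using colon[of u] g(3)[OF u(2)] u(1) by (simp add: add.commute)
    qed
    then have "g * monom_poly w \<in> J" using monomial_ideal_iff[OF J] by blast
    then have "\<exists>s\<in>?S. s \<otimes>\<^bsub>?R\<^esub> (g \<otimes>\<^bsub>?R\<^esub> monom_poly w) \<in> J"
      using L.S(2) by (intro bexI[of _ "\<one>\<^bsub>?R\<^esub>"]) auto
    then have "h (g \<otimes>\<^bsub>?R\<^esub> monom_poly w) = \<zero>" using L.h_zero[OF L.R.m_closed[OF g(2) wc]] by blast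
    then show ?thesis using L.h_mult[OF g(2) wc] by simp
  qed
  have Idl0: "Idl {} = {\<zero>}"
  proof
    show "Idl {} \<subseteq> {\<zero>}" by (intro A.genideal_minimal A.zeroideal) simp
    interpret I0: ideal "Idl {}" A by (rule A.genideal_ideal) simp
    show "{\<zero>} \<subseteq> Idl {}" using I0.zero_closed by simp
  qed
  have "h g \<otimes> h (monom_poly w) \<notin> Idl (set (take 0 xs))"
  proof (rule A.ring_combs_not_kill[OF xs])
    show "length (map h fs) = length xs" by (simp add: fs_def)
    show "\<exists>u\<in>Units A. map h fs ! j = u \<otimes> xs ! j" if "j < length xs" for j
    proof -
      have x: "xs ! j \<in> set xs" using that by simp
      have u: "h (\<sigma> (xs ! j)) \<in> Units A" using \<phi>[OF x] by (intro L.h_unit) blast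
      moreover have "map h fs ! j = h (\<sigma> (xs ! j)) \<otimes> xs ! j"
        using that \<phi>[OF x] A.m_comm[OF subsetD[OF xsc x] A.Units_closed[OF u]]
        by (simp add: fs_def)
      ultimately show ?thesis by blast
    qed
    show "h (monom_poly w) \<notin> Idl (set (take 0 xs))" using hw by (simp add: Idl0)
    show "h (monom_poly w) \<in> carrier A" using wc by (rule L.h_carrier)
  qed (use hg in simp_all)
  then show False using hgw by (simp add: Idl0)
qed

text \<open>The right-hand side is the dimension of \<open>R / P\<close> for the associated prime \<open>P = (J : w)\<close>, which
  bounds the depth; the left-hand side is the length of a chain of primes above \<open>J\<close>.\<close>

theorem cohen_macaulay_associated_prime:
  fixes c n :: nat and J :: "('k::field) poly_xs set"
  defines "X \<equiv> {1..c} \<times> {1..n}"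
  assumes CM: "cohen_macaulay (polyR c n Quot J)" and J: "monomial_ideal c n J"
    and V: "V \<subseteq> X" "\<And>u. u \<in> mon_set J \<Longrightarrow> Poly_Mapping.keys u \<inter> V \<noteq> {}"
    and w: "w \<in> mons c n" "F \<subseteq> X"
    and colon: "\<And>u. u \<in> mons c n \<Longrightarrow> w + u \<in> mon_set J \<longleftrightarrow> \<not> Poly_Mapping.keys u \<subseteq> F"
  shows "card (X - V) \<le> card F"
proof -
  let ?R = "polyR c n :: 'k poly_xs ring" and ?B = "polyR c n Quot J"
  let ?q = "\<lambda>f. J +>\<^bsub>polyR c n\<^esub> f"
  define M where "M = (var_ideal c n X :: 'k poly_xs set)"
  define T where "T = carrier ?B - ?q ` M"
  define A where "A = localization ?B T"
  define h where "h f = loc_frac ?B T (?q f) (?q \<one>\<^bsub>?R\<^esub>)" for f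
  have idJ: "ideal J ?R" using J by (rule monomial_ideal_ideal)
  have sub: "J \<subseteq> var_ideal c n W" if "V \<subseteq> W" for W
    using V(2) that unfolding var_ideal_supset_iff[OF J] by blast
  have JM: "J \<subseteq> M" unfolding M_def using sub[OF V(1)] .
  have loc: "localized_quotient ?R A J (carrier ?R - M) h"
    unfolding A_def T_def h_def
    by (rule localized_quotientI[OF polyR_cring idJ _ JM]) (simp add: M_def var_ideal_prime)
  interpret L: localized_quotient ?R A J "carrier ?R - M" h by (rule loc)
  have "maximalideal (?q ` M) ?B"
    unfolding M_def X_def by (rule maximalideal_vars_Quot[OF idJ]) (use JM in \<open>simp add: M_def X_def\<close>)
  then have CML: "cohen_macaulay_local A"
    using CM unfolding cohen_macaulay_def A_def T_def by blast
  then have A: "noetherian_local A"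
    unfolding cohen_macaulay_local_def local_ring_def
    by (intro noetherian_local.intro noetherian_local_axioms.intro) auto
  have "finite X" by (simp add: X_def)
  then have "finite (X - V)" by simp
  \<comment> \<open>Adjoining the variables outside \<open>V\<close> one at a time gives a strict
    chain of primes from that of \<open>V\<close> up to the ideal of the origin.\<close>
  then obtain zs where zs: "set zs = X - V" "distinct zs" using finite_distinct_list by blast
  then have lzs: "length zs = card (X - V)" using distinct_card by metis
  have "enat (card (X - V)) \<le> krull_dim A"
  proof (rule L.krull_dim_ge)
    fix j assume "j \<le> card (X - V)"
    have P: "V \<union> set (take j zs) \<subseteq> X" using V(1) zs(1) set_take_subset[of j zs] by blast
    show "primeideal (var_ideal c n (V \<union> set (take j zs))) ?R" by (rule var_ideal_prime)
    show "J \<subseteq> var_ideal c n (V \<union> set (take j zs))" by (rule sub) blast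
    show "var_ideal c n (V \<union> set (take j zs)) \<inter> (carrier ?R - M) = {}"
      using P unfolding M_def var_ideal_def by blast
  next
    fix j assume j: "j < card (X - V)"
    let ?z = "zs ! j"
    have take: "set (take (Suc j) zs) = insert ?z (set (take j zs))"
      using j lzs by (simp add: take_Suc_conv_app_nth)
    have z: "?z \<in> X - V" using j lzs zs(1) nth_mem by metis
    have znot: "?z \<notin> set (take j zs)"
      using zs(2) j lzs by (auto simp: in_set_conv_nth nth_eq_iff_index_eq)
    let ?m = "monom_poly (Poly_Mapping.single ?z 1) :: 'k poly_xs"
    have "Poly_Mapping.single ?z 1 \<in> mons c n" using z by (auto simp: mons_def X_def)
    then have "?m \<in> var_ideal c n (V \<union> set (take (Suc j) zs))" "?m \<notin> var_ideal c n (V \<union> set (take j zs))"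
      using z znot by (auto simp: var_ideal_def take)
    moreover have "var_ideal c n (V \<union> set (take j zs)) \<subseteq> (var_ideal c n (V \<union> set (take (Suc j) zs)) :: 'k poly_xs set)"
      unfolding take var_ideal_def by blast
    ultimately show "(var_ideal c n (V \<union> set (take j zs)) :: 'k poly_xs set) \<subset> var_ideal c n (V \<union> set (take (Suc j) zs))"
      by blast
  qed
  also have "krull_dim A = local_depth A" using CML by (simp add: cohen_macaulay_local_def)
  also have "\<dots> \<le> enat (card F)"
    unfolding local_depth_def
  proof (rule SUP_least)
    fix xs assume "xs \<in> {xs. regular_sequence A xs \<and> set xs \<subseteq> (THE m. maximalideal m A)}"
    then have "length xs \<le> card F"
      using regular_sequence_length_le[OF loc[unfolded M_def X_def] A J w(1) w(2)[unfolded X_def] colon]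
      by blast
    then show "enat (length xs) \<le> enat (card F)" by simp
  qed
  finally show ?thesis by simp
qed

section \<open>Colon chains\<close>

context monomial_chain
begin

context
  fixes r v
  assumes r: "1 \<le> r" "\<And>n. r \<le> n \<Longrightarrow> mon_generated i J r n"
    and v: "v \<in> mons c r" "\<And>k j. (k, j) \<in> Poly_Mapping.keys v \<Longrightarrow> j \<le> i"
begin

text \<open>As \<open>v\<close> uses only columns up to \<open>i\<close>, the maps fix it and so
  commute with multiplication by \<open>v\<close>.\<close>

lemma colon_invariant:
  assumes "r \<le> n" "u \<in> mon_set (colon_mon c r (J r) v)" "\<pi> \<in> Inc_between i r n"
  shows "mon_act \<pi> u \<in> mon_set (colon_mon c n (J n) v)"
proof -
  have \<pi>: "\<pi> \<in> Inc i" using assms(3) by (simp add: Inc_between_def)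
  have u: "u \<in> mons c r" "u + v \<in> mon_set (J r)"
    using assms(2) unfolding colon_mon_monomial(2)[OF monomial[OF r(1)]] by auto
  have "mon_act \<pi> u + v \<in> mon_set (J n)"
    using invariant[OF r(1) assms(1) u(2) assms(3)] mon_act_add[OF u(1) v(1) \<pi>] mon_act_fixed[OF v(1) \<pi> v(2)]
    by simp
  moreover have "mon_act \<pi> u \<in> mons c n" by (rule mon_act_mons[OF u(1) assms(3) r(1)])
  moreover have "1 \<le> n" using r(1) assms(1) by simp
  ultimately show ?thesis unfolding colon_mon_monomial(2)[OF monomial[OF \<open>1 \<le> n\<close>]] by simp
qed

text \<open>If an image of \<open>u\<close> divides \<open>w + v\<close>, then the image of the
  truncated difference \<open>u - v\<close> divides \<open>w\<close>, because the maps fix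
  \<open>v\<close>. And \<open>u - v\<close> lies in the colon ideal at \<open>r\<close>, since
  \<open>u\<close> divides \<open>u - v + v\<close>.\<close>

lemma colon_generated:
  assumes "r \<le> n"
  shows "mon_generated i (\<lambda>n. colon_mon c n (J n) v) r n"
  unfolding mon_generated_def
proof
  have n: "1 \<le> n" using r(1) assms by simp
  fix w assume "w \<in> mon_set (colon_mon c n (J n) v)"
  then have w: "w \<in> mons c n" "w + v \<in> mon_set (J n)"
    unfolding colon_mon_monomial(2)[OF monomial[OF n]] by auto
  obtain u \<pi> where u: "u \<in> mon_set (J r)" "\<pi> \<in> Inc_between i r n" "mon_dvd (mon_act \<pi> u) (w + v)"
    using r(2)[OF assms] w(2) unfolding mon_generated_def by blast
  have \<pi>: "\<pi> \<in> Inc i" using u(2) by (simp add: Inc_between_def)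
  have um: "u \<in> mons c r" using u(1) mon_set_mons[OF r(1)] by blast
  have uv: "u - v \<in> mons c r" using um keys_diff[of u v] v(1) unfolding mons_def by blast
  have "mon_dvd u (u - v + v)"
    unfolding mon_dvd_iff lookup_add lookup_minus by (intro allI) arith
  then have "u - v + v \<in> mon_set (J r)"
    using mon_set_upward[OF monomial[OF r(1)] u(1)] uv v(1) by (simp add: mons_add_iff)
  then have "u - v \<in> mon_set (colon_mon c r (J r) v)"
    unfolding colon_mon_monomial(2)[OF monomial[OF r(1)]] using uv by simp
  moreover have "mon_dvd (mon_act \<pi> u - v) w"
    unfolding mon_dvd_iff
  proof
    fix p
    have "Poly_Mapping.lookup (mon_act \<pi> u) p \<le> Poly_Mapping.lookup w p + Poly_Mapping.lookup v p"
      using u(3) unfolding mon_dvd_iff lookup_add by blast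
    then show "Poly_Mapping.lookup (mon_act \<pi> u - v) p \<le> Poly_Mapping.lookup w p"
      by (simp add: lookup_minus)
  qed
  moreover have "mon_act \<pi> (u - v) = mon_act \<pi> u - v"
    using mon_act_diff[OF um v(1) \<pi>] mon_act_fixed[OF v(1) \<pi> v(2)] by simp
  ultimately show "\<exists>u\<in>mon_set (colon_mon c r (J r) v). \<exists>\<pi>\<in>Inc_between i r n. mon_dvd (mon_act \<pi> u) w"
    using u(2) by metis
qed

lemma chain_gamma_colon:
  "chain_gamma c i (\<lambda>n. colon_mon c n (J n) v) = gamma c r i (colon_mon c r (J r) v)"
proof (rule chain_gamma_eq)
  show "monomial_ideal c n (colon_mon c n (J n) v)" if "1 \<le> n" for n
    by (rule colon_mon_monomial(1)[OF monomial[OF that]])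
  show "1 \<le> r" by (rule r(1))
  show "generated_by c i (\<lambda>n. colon_mon c n (J n) v) r n" if "r \<le> n" for n
  proof (rule generated_byI[OF colon_generated[OF that]])
    have "1 \<le> n" using that r(1) by simp
    then show "monomial_ideal c n (colon_mon c n (J n) v)" by (rule colon_mon_monomial(1)[OF monomial])
    show "monomial_ideal c r (colon_mon c r (J r) v)" by (rule colon_mon_monomial(1)[OF monomial[OF r(1)]])
    show "1 \<le> r" by (rule r(1))
    show "mon_act \<pi> u \<in> mon_set (colon_mon c n (J n) v)"
      if "u \<in> mon_set (colon_mon c r (J r) v)" "\<pi> \<in> Inc_between i r n" for u \<pi>
      by (rule colon_invariant[OF \<open>r \<le> n\<close> that])
  qed
qed

text \<open>Up to bounded error the codimension of the \<open>n\<close>-th ideal is \<open>\<gamma> n\<close>, and every associated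
  prime of the colon chain is an associated prime of the original chain; equality of the
  codimensions of all associated primes therefore forces equality of the leading coefficients.\<close>

theorem gamma_colon_eq:
  assumes notin: "\<And>n. r \<le> n \<Longrightarrow> v \<notin> mon_set (J n)"
    and CM: "\<And>n. N \<le> n \<Longrightarrow> cohen_macaulay (polyR c n Quot J n)"
  shows "gamma c r i (colon_mon c r (J r) v) = gamma c r i (J r)"
proof -
  let ?Q = "colon_mon c r (J r) v"
  note Jr = monomial[OF r(1)]
  note Q = colon_mon_monomial[OF Jr, of v]
  have sub: "mon_set (J r) \<subseteq> mon_set ?Q"
  proof
    fix u assume u: "u \<in> mon_set (J r)"
    have um: "u \<in> mons c r" using u mon_set_mons[OF r(1)] by blast
    have "mon_dvd u (u + v)" by (auto simp: mon_dvd_def)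
    then have "u + v \<in> mon_set (J r)"
      using mon_set_upward[OF Jr u] um v(1) by (simp add: mons_add_iff)
    then show "u \<in> mon_set ?Q" unfolding Q(2) using um by simp
  qed
  have "0 \<notin> mon_set ?Q" unfolding Q(2) using notin[of r] by simp
  then have proper: "?Q \<noteq> carrier (polyR c r)" "J r \<noteq> carrier (polyR c r)"
    using sub monomial_ideal_proper_iff[OF Q(1)] monomial_ideal_proper_iff[OF Jr] by auto
  obtain C where C: "i_cover c r i (J r) C" "gamma c r i (J r) = enat (card C)"
    "\<And>D. i_cover c r i (J r) D \<Longrightarrow> card C \<le> card D"
    using gamma_attained[OF Jr proper(2)] by metis
  obtain C' where C': "i_cover c r i ?Q C'" "gamma c r i ?Q = enat (card C')"
    "\<And>D. i_cover c r i ?Q D \<Longrightarrow> card C' \<le> card D"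
    using gamma_attained[OF Q(1) proper(1)] by metis
  have Cc: "C \<subseteq> {1..c}" "C' \<subseteq> {1..c}" using C(1) C'(1) by (auto simp: i_cover_def)
  have "i_cover c r i (J r) C'"
    using C'(1) sub unfolding i_cover_iff[OF Q(1) proper(1)] i_cover_iff[OF Jr proper(2)] by blast
  then have le: "card C \<le> card C'" by (rule C(3))
  have "\<not> card C < card C'"
  proof
    assume less: "card C < card C'"
    \<comment> \<open>\<open>N\<close> and \<open>r\<close> bring \<open>n\<close> into the range of
      the hypotheses. With n = i + t the final inequality reads
      \<open>t \<le> c * i + c * (i + r * 2 ^ c)\<close>, which the remaining summands
      exclude.\<close>
    define n where "n = N + r + i + c * i + c * (i + r * 2 ^ c) + 1"
    have n: "N \<le> n" "r \<le> n" "1 \<le> n" using r(1) by (auto simp: n_def)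
    note Jn = monomial[OF n(3)]
    define X where "X = {1..c} \<times> {1..n}"
    \<comment> \<open>The first \<open>i\<close> columns together with the rows of \<open>C\<close>.
      A monomial of \<open>J r\<close> either avoids these columns and is covered by
      \<open>C\<close>, or it uses one of them and its images keep that column.\<close>
    define V where "V = {(k, j) \<in> X. j \<le> i \<or> k \<in> C}"
    have hit: "Poly_Mapping.keys u \<inter> V \<noteq> {}" if u: "u \<in> mon_set (J n)" for u
    proof -
      have keysX: "Poly_Mapping.keys u \<subseteq> X" using u mon_set_mons[OF n(3)] by (auto simp: mons_def X_def)
      obtain g \<pi> where g: "g \<in> mon_set (J r)" "\<pi> \<in> Inc_between i r n" "mon_dvd (mon_act \<pi> g) u"
        using r(2)[OF n(2)] u unfolding mon_generated_def by blast
      have gm: "g \<in> mons c r" using g(1) mon_set_mons[OF r(1)] by blast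
      have \<pi>: "\<pi> \<in> Inc i" using g(2) by (simp add: Inc_between_def)
      have key: "(k, \<pi> j) \<in> Poly_Mapping.keys u" if "(k, j) \<in> Poly_Mapping.keys g" for k j
        using that mon_dvd_keys[OF g(3)] unfolding keys_mon_act[OF gm \<pi>] by auto
      show ?thesis
      proof (cases "\<forall>(k, j)\<in>Poly_Mapping.keys g. i < j")
        case True
        then obtain k j where kj: "k \<in> C" "(k, j) \<in> Poly_Mapping.keys g"
          using C(1) g(1) unfolding i_cover_iff[OF Jr proper(2)] by blast
        then show ?thesis using key keysX by (auto simp: V_def)
      next
        case False
        then obtain k j where kj: "(k, j) \<in> Poly_Mapping.keys g" "j \<le> i" by (auto simp: not_less)
        have "1 \<le> j" using kj(1) gm by (auto simp: mons_def)
        then have "\<pi> j \<le> i" using Inc_le_iff[OF \<pi>] kj(2) by simp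
        then show ?thesis using key[OF kj(1)] keysX by (auto simp: V_def)
      qed
    qed
    have vX: "Poly_Mapping.keys v \<subseteq> X" using v(1) n(2) by (fastforce simp: mons_def X_def)
    have finX: "finite X" by (simp add: X_def)
    have up: "u + w \<in> mon_set (J n)" if "u \<in> mon_set (J n)" "Poly_Mapping.keys (u + w) \<subseteq> X" for u w
      using mon_set_upward[OF Jn that(1)] that(2) by (auto simp: mon_dvd_def mons_def X_def)
    \<comment> \<open>Since \<open>w\<close> is a multiple of \<open>v\<close>, the images of
      monomials of \<open>?Q\<close> multiply \<open>w\<close> into \<open>J n\<close>; so none of
      them is a monomial in the variables \<open>F\<close> alone, which is what the pigeonhole bound
      asks for.\<close>
    obtain w F where w: "Poly_Mapping.keys w \<subseteq> X" "F \<subseteq> X" "mon_dvd v w"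
      and colon: "\<And>u. Poly_Mapping.keys u \<subseteq> X \<Longrightarrow> w + u \<in> mon_set (J n) \<longleftrightarrow> \<not> Poly_Mapping.keys u \<subseteq> F"
      using ex_monomial_prime_colon[OF finX vX notin[OF n(2)] up] by metis
    have "card (X - V) \<le> card F"
      unfolding X_def
    proof (rule cohen_macaulay_associated_prime[OF CM[OF n(1)] Jn])
      show "V \<subseteq> {1..c} \<times> {1..n}" by (auto simp: V_def X_def)
      show "w \<in> mons c n" "F \<subseteq> {1..c} \<times> {1..n}" using w by (auto simp: mons_def X_def)
      show "w + u \<in> mon_set (J n) \<longleftrightarrow> \<not> Poly_Mapping.keys u \<subseteq> F" if "u \<in> mons c n" for u
        using colon that by (simp add: mons_def X_def)
    qed (rule hit)
    also have "card F \<le> (c - card C') * n + c * (i + r * 2 ^ c)"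
    proof (rule card_avoiding_le[where U = "mon_set ?Q"])
      show "F \<subseteq> {1..c} \<times> {1..n}" using w(2) by (simp add: X_def)
      show "mon_set ?Q \<subseteq> mons c r" by (rule mon_set_subset[OF Q(1)])
      show "1 \<le> r" "r \<le> n" using r(1) n(2) by auto
      show "card C' \<le> c" using card_mono[OF _ Cc(2)] by simp
      show "\<not> Poly_Mapping.keys (mon_act \<pi> u) \<subseteq> F" if "u \<in> mon_set ?Q" "\<pi> \<in> Inc_between i r n" for u \<pi>
      proof -
        have *: "mon_act \<pi> u \<in> mons c n" "mon_act \<pi> u + v \<in> mon_set (J n)"
          using colon_invariant[OF n(2) that] unfolding colon_mon_monomial(2)[OF Jn] by auto
        obtain x where x: "w = v + x" using w(3) by (auto simp: mon_dvd_def)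
        have "mon_act \<pi> u + v + x \<in> mon_set (J n)"
          using up[OF *(2)] *(1) w(1) vX x by (simp add: keys_plus_mon mons_def X_def)
        then have "w + mon_act \<pi> u \<in> mon_set (J n)" by (simp add: x ac_simps)
        then show ?thesis using colon *(1) by (simp add: mons_def X_def)
      qed
      show "\<exists>u\<in>mon_set ?Q. \<forall>(k, j)\<in>Poly_Mapping.keys u. i < j \<and> k \<notin> D" if D: "D \<subseteq> {1..c}" "card D < card C'" for D
      proof -
        have "\<not> i_cover c r i ?Q D" using C'(3)[of D] D(2) by auto
        then obtain u where "u \<in> mon_set ?Q" "\<forall>(k, j)\<in>Poly_Mapping.keys u. i < j"
          "\<not> (\<exists>k\<in>D. \<exists>j. (k, j) \<in> Poly_Mapping.keys u)"
          using D(1) unfolding i_cover_iff[OF Q(1) proper(1)] by blast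
        then show ?thesis by blast
      qed
    qed
    finally have bound: "card (X - V) \<le> (c - card C') * n + c * (i + r * 2 ^ c)" .
    have "X - V = ({1..c} - C) \<times> {i<..n}" by (auto simp: X_def V_def)
    then have "card (X - V) = (c - card C) * (n - i)"
      using Cc(1) by (simp add: card_Diff_subset finite_subset)
    \<comment> \<open>The smaller cover leaves at least one more row free, which contributes
      \<open>n - i\<close> variables.\<close>
    moreover have "((c - card C') + 1) * (n - i) \<le> (c - card C) * (n - i)"
      using less card_mono[OF _ Cc(2)] by (intro mult_right_mono) auto
    ultimately have "((c - card C') + 1) * (n - i) \<le> (c - card C') * n + c * (i + r * 2 ^ c)"
      using bound by simp
    moreover obtain t where t: "n = i + t" by (metis n_def add.assoc add.commute)
    ultimately have "t \<le> (c - card C') * i + c * (i + r * 2 ^ c)"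
      by (simp add: algebra_simps)
    also have "\<dots> \<le> c * i + c * (i + r * 2 ^ c)" by (intro add_right_mono mult_right_mono) auto
    finally show False using t by (simp add: n_def)
  qed
  then show ?thesis using le C(2) C'(2) by simp
qed

end

end

section \<open>The maximum over admissible sets\<close>

theorem corollary4p12:
  fixes c i r :: nat
    and I :: "nat \<Rightarrow> ('k::field) poly_xs set"
  assumes "c \<ge> 1"
    and "invariant_chain c i I"
    and "\<forall>n\<ge>1. monomial_ideal c n (I n) \<and> I n \<noteq> carrier (polyR c n)"
    and "r \<ge> ind c i I"
    and "\<exists>N. \<forall>n\<ge>N. cohen_macaulay (polyR c n Quot I n)"
  shows "chain_gamma c i I =
    Max {chain_gamma c i (\<lambda>n. colon_mon c n (I n) (v_mon i M)) | M. M \<in> admissible c r i (I r)}"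
proof -
  have mono: "monomial_ideal c n (I n)" "0 \<notin> mon_set (I n)" if "1 \<le> n" for n
    using assms(3) that monomial_ideal_proper_iff by blast+
  interpret monomial_chain c i I
  proof
    show "monomial_ideal c n (I n)" if "1 \<le> n" for n by (rule mono(1)[OF that])
    fix m n u \<pi> assume "1 \<le> m" "m \<le> n" "u \<in> mon_set (I m)" "\<pi> \<in> Inc_between i m n"
    then have "poly_act \<pi> (monom_poly u) \<in> I n"
      using assms(2) unfolding invariant_chain_def mon_set_def by blast
    then show "mon_act \<pi> u \<in> mon_set (I n)" by (simp add: poly_act_monom mon_set_def)
  qed
  note r = mon_generated_ind(1)[OF assms(4)] mon_generated_ind(2)[OF assms(4)]
  obtain N where N: "\<And>n. N \<le> n \<Longrightarrow> cohen_macaulay (polyR c n Quot I n)" using assms(5) by blast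
  have gens: "u \<in> mon_set (I r)" if "u \<in> min_gens c r (I r)" for u
    using that min_gens_iff[OF mono(1)[OF r(1)]] by blast
  have gamma_I: "chain_gamma c i I = gamma c r i (I r)"
  proof (rule chain_gamma_eq[OF mono(1) r(1)])
    fix n assume n: "r \<le> n"
    show "generated_by c i I r n"
      using r n invariant[OF r(1) n] by (intro generated_byI mono) auto
  qed
  have eq: "chain_gamma c i (\<lambda>n. colon_mon c n (I n) (v_mon i M)) = chain_gamma c i I"
    if M: "M \<in> admissible c r i (I r)" for M
  proof -
    let ?v = "v_mon i M"
    have Mm: "u \<in> mons c r" if "u \<in> M" for u
      using that M gens mon_set_mons[OF r(1)] by (auto simp: admissible_def gens_mixed_def)
    have keys_low: "(k, j) \<in> Poly_Mapping.keys u \<and> j \<le> i"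
      if "(k, j) \<in> Poly_Mapping.keys (low_part i u)" for k j u
      using that by (auto simp: in_keys_iff lookup_low_part split: if_splits)
    have keys_v: "\<exists>u\<in>M. (k, j) \<in> Poly_Mapping.keys (low_part i u)" if "(k, j) \<in> Poly_Mapping.keys ?v" for k j
      using that keys_sum[of "low_part i" M] unfolding v_mon_def by blast
    have v: "?v \<in> mons c r" "\<And>k j. (k, j) \<in> Poly_Mapping.keys ?v \<Longrightarrow> j \<le> i"
    proof -
      show "?v \<in> mons c r"
        unfolding mons_def mem_Collect_eq
      proof
        fix p assume p: "p \<in> Poly_Mapping.keys ?v"
        obtain k j where kj: "p = (k, j)" by (cases p)
        obtain u where "u \<in> M" "(k, j) \<in> Poly_Mapping.keys u"
          using keys_v[of k j] p keys_low[of k j] unfolding kj by blast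
        then show "p \<in> {1..c} \<times> {1..r}" using Mm[of u] unfolding mons_def kj by blast
      qed
      show "j \<le> i" if "(k, j) \<in> Poly_Mapping.keys ?v" for k j
        using keys_v[OF that] keys_low by blast
    qed
    \<comment> \<open>A generator dividing \<open>?v\<close> inherits its columns and so belongs to
      \<open>gens_below\<close>; this is where admissibility enters.\<close>
    have v_r: "?v \<notin> mon_set (I r)"
    proof
      assume "?v \<in> mon_set (I r)"
      then obtain g where g: "g \<in> min_gens c r (I r)" "mon_dvd g ?v" by (rule min_gens_dvd[OF mono(1)[OF r(1)]])
      have "g \<noteq> 0" using gens[OF g(1)] mono(2)[OF r(1)] by auto
      then have "mon_max g \<le> i" using v(2) mon_dvd_keys[OF g(2)] by (subst mon_max_le_iff) auto
      then have "g \<in> gens_below c r i (I r)" using g(1) by (simp add: gens_below_def)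
      then show False using M g(2) by (auto simp: admissible_def)
    qed
    \<comment> \<open>A monomial whose image divides \<open>?v\<close> uses only columns up to
      \<open>i\<close>, hence equals its image; so no new divisors of \<open>?v\<close> appear at
      larger widths.\<close>
    have v_n: "?v \<notin> mon_set (I n)" if n: "r \<le> n" for n
    proof
      assume "?v \<in> mon_set (I n)"
      then obtain u \<pi> where u: "u \<in> mon_set (I r)" "\<pi> \<in> Inc_between i r n" "mon_dvd (mon_act \<pi> u) ?v"
        using r(2)[OF n] unfolding mon_generated_def by blast
      have um: "u \<in> mons c r" using u(1) mon_set_mons[OF r(1)] by blast
      have \<pi>: "\<pi> \<in> Inc i" using u(2) by (simp add: Inc_between_def)
      have "j \<le> i" if kj: "(k, j) \<in> Poly_Mapping.keys u" for k j
      proof -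
        have "(k, \<pi> j) \<in> Poly_Mapping.keys ?v"
          using kj mon_dvd_keys[OF u(3)] unfolding keys_mon_act[OF um \<pi>] by auto
        moreover have "1 \<le> j" using kj um by (auto simp: mons_def)
        ultimately show ?thesis using v(2) Inc_le_iff[OF \<pi>] by blast
      qed
      then have "mon_dvd u ?v" using u(3) mon_act_fixed[OF um \<pi>] by metis
      then show False using mon_set_upward[OF mono(1)[OF r(1)] u(1) _ v(1)] v_r by blast
    qed
    have "chain_gamma c i (\<lambda>n. colon_mon c n (I n) ?v) = gamma c r i (colon_mon c r (I r) ?v)"
      using r v by (rule chain_gamma_colon)
    also have "\<dots> = gamma c r i (I r)"
      using r v v_n N by (rule gamma_colon_eq)
    finally show ?thesis by (simp only: gamma_I)
  qed
  have "w \<noteq> 0" if "w \<in> gens_below c r i (I r)" for w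
    using that gens[of w] mono(2)[OF r(1)] by (auto simp: gens_below_def)
  then have "{} \<in> admissible c r i (I r)"
    using mon_dvd_keys by (fastforce simp: admissible_def v_mon_def)
  then have ne: "chain_gamma c i I \<in>
      {chain_gamma c i (\<lambda>n. colon_mon c n (I n) (v_mon i M)) | M. M \<in> admissible c r i (I r)}"
    using eq[of "{}"] by (intro CollectI exI[of _ "{}"]) simp
  have all: "x = chain_gamma c i I"
    if x: "x \<in> {chain_gamma c i (\<lambda>n. colon_mon c n (I n) (v_mon i M)) | M. M \<in> admissible c r i (I r)}"
    for x
  proof -
    obtain M where "x = chain_gamma c i (\<lambda>n. colon_mon c n (I n) (v_mon i M))" "M \<in> admissible c r i (I r)"
      using x by (elim CollectE exE conjE)
    then show ?thesis using eq by simp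
  qed
  \<comment> \<open>All values coincide and the empty set contributes one, so \<open>Max\<close> is
    taken over a singleton.\<close>
  have "{chain_gamma c i (\<lambda>n. colon_mon c n (I n) (v_mon i M)) | M. M \<in> admissible c r i (I r)} =
      {chain_gamma c i I}" (is "?S = _")
  proof (intro Set.equalityI subsetI)
    show "x \<in> {chain_gamma c i I}" if "x \<in> ?S" for x using all[OF that] by simp
    show "x \<in> ?S" if "x \<in> {chain_gamma c i I}" for x using that ne by (simp only: singleton_iff)
  qed
  then show ?thesis by simp
qed

end
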